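(* Let $\mathbb{F}$ be a non-Archimedean local field, let $G$ be an algebraic group defined over $\mathbb{F}$, and let $k\ge 1$ be an integer. Then: (1) If $P_k$ is surjective on $G(\mathbb{F})$ and $H$ is an algebraic subgroup of $G$ defined over $\mathbb{F}$, then $P_k$ is surjective on $H(\mathbb{F})$. (2) If $H$ is a closed (not necessarily algebraic) normal subgroup of $G(\mathbb{F})$ and $P_k$ is dense in $H$ as well as in $G(\mathbb{F})/H$, then $P_k$ is surjective on $G(\mathbb{F})$. In particular, for any algebraic normal subgroup $H$ of $G$ defined over $\mathbb{F}$, $P_k$ is surjective on $G(\mathbb{F})$ if and only if $P_k$ is surjective on both $H(\mathbb{F})$ and $G(\mathbb{F})/H(\mathbb{F})$.
   Context: Algebraic groups defined over $\mathbb{F}$ are smooth affine $\mathbb{F}$-groups, and $G(\mathbb{F})$ carries the topology inherited from $\mathbb{F}$; "closed" in (2) refers to this topology. For a topological group $A$ and $k\ge1$, $P_k\colon A\to A$ is $P_k(x)=x^k$; "$P_k$ is surjective on $A$" means this map is surjective and "$P_k$ is dense in $A$" means its image is dense in $A$. *)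

theory Defs
  imports "HOL-Analysis.Analysis" "HOL-Algebra.Coset" "HOL-Library.Poly_Mapping"
begin

section \<open>Non-Archimedean local fields\<close>

text \<open>A field with a nontrivial non-Archimedean absolute value whose topology is locally compact.
  Completeness, discreteness of the value group and finiteness of the residue field follow. All
  characteristics are allowed.\<close>

definition field_topology :: "('f::field \<Rightarrow> real) \<Rightarrow> 'f topology" where
  "field_topology v = Metric_space.mtopology UNIV (\<lambda>x y. v (x - y))"

locale nonarch_local_field =
  fixes v :: "'f::field \<Rightarrow> real"
  assumes nonneg: "0 \<le> v x"
    and eq_0_iff: "v x = 0 \<longleftrightarrow> x = 0"
    and mult: "v (x * y) = v x * v y"
    and ultrametric: "v (x + y) \<le> max (v x) (v y)"
    and nontrivial: "\<exists>x. x \<noteq> 0 \<and> v x \<noteq> 1"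
    and locally_compact: "locally_compact_space (field_topology v)"

lemma (in nonarch_local_field) Metric_space: "Metric_space UNIV (\<lambda>x y. v (x - y))"
proof
  have "v 1 * v 1 = v 1" "v 1 \<noteq> 0"
    using mult[of 1 1] eq_0_iff[of 1] by auto
  then have v1: "v 1 = 1" by simp
  have "v (-1) * v (-1) = 1"
    using mult[of "-1" "-1"] v1 by simp
  then have vm1: "v (-1) = 1"
    using nonneg[of "-1"] by (metis abs_of_nonneg abs_1 real_sqrt_abs2 real_sqrt_one)
  show "v (x - y) = v (y - x)" for x y
    using mult[of "-1" "x - y"] vm1 by simp
  show "v (x - z) \<le> v (x - y) + v (y - z)" for x y z
    using ultrametric[of "x - y" "y - z"] nonneg[of "x - y"] nonneg[of "y - z"] by simp
qed (simp_all add: nonneg eq_0_iff)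

lemma (in nonarch_local_field) topspace_field_topology [simp]: "topspace (field_topology v) = UNIV"
  by (simp add: field_topology_def Metric_space.topspace_mtopology[OF Metric_space])

section \<open>Affine schemes of finite type and their points\<close>

text \<open>Polynomials over a coefficient ring, with variables indexed by a type.\<close>

type_synonym ('x, 'f) mpoly = "('x \<Rightarrow>\<^sub>0 nat) \<Rightarrow>\<^sub>0 'f"

definition Const :: "'f::comm_ring_1 \<Rightarrow> ('x, 'f) mpoly" where
  "Const c = Poly_Mapping.single 0 c"

text \<open>Evaluation at a point \<open>x\<close> with coordinates in an algebra with structure map \<open>\<phi>\<close>.\<close>

definition eval_poly ::
    "('f::comm_ring_1 \<Rightarrow> 'r::comm_ring_1) \<Rightarrow> ('x \<Rightarrow> 'r) \<Rightarrow> ('x, 'f) mpoly \<Rightarrow> 'r" where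
  "eval_poly \<phi> x p = (\<Sum>m\<in>Poly_Mapping.keys p. \<phi> (Poly_Mapping.lookup p m) *
     (\<Prod>i\<in>Poly_Mapping.keys m. x i ^ Poly_Mapping.lookup m i))"

text \<open>A ring is a module over itself, and its submodules are its ideals.\<close>

abbreviation is_ideal :: "'r::comm_ring_1 set \<Rightarrow> bool" where
  "is_ideal \<equiv> module.subspace (*)"

abbreviation ideal_gen :: "'r::comm_ring_1 set \<Rightarrow> 'r set" where
  "ideal_gen \<equiv> module.span (*)"

lemma module_mult: "module ((*) :: 'r::comm_ring_1 \<Rightarrow> 'r \<Rightarrow> 'r)"
  by unfold_locales (simp_all add: algebra_simps)

text \<open>A set \<open>E\<close> of polynomials in the variables \<open>'n\<close> represents the closed subscheme of affine
  \<open>'n\<close>-space with ideal \<open>ideal_gen E\<close>; up to isomorphism these are all affine schemes of finite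
  type. If \<open>\<phi> : 'f \<rightarrow> 'r\<close> is an algebra and \<open>J\<close> an ideal of it, the points of this scheme
  with values in the algebra \<open>'r / J\<close> are the elements of \<open>points \<phi> J E\<close>, taken modulo \<open>J\<close> in each
  coordinate.\<close>

definition points ::
    "('f::comm_ring_1 \<Rightarrow> 'r::comm_ring_1) \<Rightarrow> 'r set \<Rightarrow> ('n, 'f) mpoly set \<Rightarrow> ('n \<Rightarrow> 'r) set" where
  "points \<phi> J E = {x. \<forall>p\<in>E. eval_poly \<phi> x p \<in> J}"

text \<open>Test algebras are the quotients of the polynomial algebra in countably many variables, that
  is, up to isomorphism all countably generated algebras. Since schemes of finite type
  are considered, this loses nothing compared with arbitrary commutative algebras: any
  statement below involves finitely many points, and these have coordinates in a finitely generated
  subalgebra.\<close>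

type_synonym 'f test_ring = "(nat, 'f) mpoly"

abbreviation test_points ::
    "'f::comm_ring_1 test_ring set \<Rightarrow> ('n, 'f) mpoly set \<Rightarrow> ('n \<Rightarrow> 'f test_ring) set" where
  "test_points J E \<equiv> points Const J E"

definition cong_mod :: "'r::comm_ring_1 set \<Rightarrow> ('n \<Rightarrow> 'r) \<Rightarrow> ('n \<Rightarrow> 'r) \<Rightarrow> bool" where
  "cong_mod J x y \<longleftrightarrow> (\<forall>i. x i - y i \<in> J)"

text \<open>Smoothness is Grothendieck's definition by infinitesimal lifting: if \<open>N\<close> is an ideal of square
  zero in an algebra \<open>C\<close>, every \<open>C/N\<close>-valued point lifts to a \<open>C\<close>-valued point. Here
  \<open>C\<close> is the test ring modulo \<open>J\<close>, and \<open>N = K/J\<close>. (Finite presentation holds automatically.)\<close>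

definition smooth_scheme :: "('n, 'f::field) mpoly set \<Rightarrow> bool" where
  "smooth_scheme E \<longleftrightarrow>
     (\<forall>J K :: 'f test_ring set.
        is_ideal J \<and> is_ideal K \<and> J \<subseteq> K \<and> (\<forall>a\<in>K. \<forall>b\<in>K. a * b \<in> J) \<longrightarrow>
        (\<forall>x\<in>test_points K E. \<exists>y\<in>test_points J E. cong_mod K y x))"

section \<open>Algebraic groups\<close>

text \<open>An affine scheme of finite type together with polynomial maps giving a multiplication, a unit
  and an inversion. In \<open>gp_mult\<close> the variables \<open>Inl i\<close> are the coordinates of the left factor
  and the variables \<open>Inr i\<close> those of the right factor.\<close>

record (overloaded) ('n, 'f) affine_group =
  gp_eqs :: "('n, 'f) mpoly set"
  gp_mult :: "'n \<Rightarrow> ('n + 'n, 'f) mpoly"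
  gp_unit :: "'n \<Rightarrow> 'f"
  gp_inv :: "'n \<Rightarrow> ('n, 'f) mpoly"

definition mult_pt ::
    "('n, 'f::field) affine_group \<Rightarrow> ('f \<Rightarrow> 'r::comm_ring_1) \<Rightarrow> ('n \<Rightarrow> 'r) \<Rightarrow> ('n \<Rightarrow> 'r) \<Rightarrow> 'n \<Rightarrow> 'r" where
  "mult_pt G \<phi> x y = (\<lambda>i. eval_poly \<phi> (case_sum x y) (gp_mult G i))"

definition unit_pt :: "('n, 'f::field) affine_group \<Rightarrow> ('f \<Rightarrow> 'r::comm_ring_1) \<Rightarrow> 'n \<Rightarrow> 'r" where
  "unit_pt G \<phi> = (\<lambda>i. \<phi> (gp_unit G i))"

definition inv_pt ::
    "('n, 'f::field) affine_group \<Rightarrow> ('f \<Rightarrow> 'r::comm_ring_1) \<Rightarrow> ('n \<Rightarrow> 'r) \<Rightarrow> 'n \<Rightarrow> 'r" where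
  "inv_pt G \<phi> x = (\<lambda>i. eval_poly \<phi> x (gp_inv G i))"

text \<open>The scheme is a group scheme if its points with values in every algebra form a group.\<close>

definition group_scheme :: "('n::finite, 'f::field) affine_group \<Rightarrow> bool" where
  "group_scheme G \<longleftrightarrow>
     (\<forall>J :: 'f test_ring set. is_ideal J \<longrightarrow>
        (let X = test_points J (gp_eqs G); m = mult_pt G Const; e = unit_pt G Const;
             i = inv_pt G Const
         in (\<forall>x\<in>X. \<forall>y\<in>X. m x y \<in> X) \<and> e \<in> X \<and> (\<forall>x\<in>X. i x \<in> X) \<and>
            (\<forall>x\<in>X. \<forall>y\<in>X. \<forall>z\<in>X. cong_mod J (m (m x y) z) (m x (m y z))) \<and>
            (\<forall>x\<in>X. cong_mod J (m e x) x \<and> cong_mod J (m x e) x) \<and>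
            (\<forall>x\<in>X. cong_mod J (m (i x) x) e \<and> cong_mod J (m x (i x)) e)))"

definition algebraic_group :: "('n::finite, 'f::field) affine_group \<Rightarrow> bool" where
  "algebraic_group G \<longleftrightarrow> group_scheme G \<and> smooth_scheme (gp_eqs G)"

text \<open>A closed subscheme with the group operations of \<open>G\<close> that is itself an algebraic group; in
  particular it is smooth over the ground field.\<close>

definition algebraic_subgroup ::
    "('n::finite, 'f::field) affine_group \<Rightarrow> ('n, 'f) affine_group \<Rightarrow> bool" where
  "algebraic_subgroup H G \<longleftrightarrow>
     H = G\<lparr>gp_eqs := gp_eqs H\<rparr> \<and> gp_eqs G \<subseteq> ideal_gen (gp_eqs H) \<and> algebraic_group H"

text \<open>Normality is that of group schemes: conjugation is tested on points in all algebras, not only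
  on points in the ground field.\<close>

definition algebraic_normal_subgroup ::
    "('n::finite, 'f::field) affine_group \<Rightarrow> ('n, 'f) affine_group \<Rightarrow> bool" where
  "algebraic_normal_subgroup H G \<longleftrightarrow>
     algebraic_subgroup H G \<and>
     (\<forall>J :: 'f test_ring set. is_ideal J \<longrightarrow>
        (\<forall>g\<in>test_points J (gp_eqs G). \<forall>h\<in>test_points J (gp_eqs H).
           mult_pt G Const (mult_pt G Const g h) (inv_pt G Const g) \<in> test_points J (gp_eqs H)))"

section \<open>The group of rational points and its topology\<close>

definition rational_points :: "('n::finite, 'f::field) affine_group \<Rightarrow> ('n \<Rightarrow> 'f) monoid" where
  "rational_points G =
     \<lparr>carrier = points id {0} (gp_eqs G), mult = mult_pt G id, one = unit_pt G id\<rparr>"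

text \<open>The topology as a subset of affine space over the field; it does not depend on the chosen
  closed embedding.\<close>

definition rational_topology ::
    "('f::field \<Rightarrow> real) \<Rightarrow> ('n::finite, 'f) affine_group \<Rightarrow> ('n \<Rightarrow> 'f) topology" where
  "rational_topology v G =
     subtopology (product_topology (\<lambda>_. field_topology v) UNIV) (carrier (rational_points G))"

lemma Const_0 [simp]: "Const 0 = 0" and Const_1 [simp]: "Const 1 = 1"
  and Const_add: "Const (a + b) = Const a + Const b"
  and Const_mult: "Const (a * b) = Const a * Const b"
  by (simp_all add: Const_def single_add mult_single)

lemma Const_eq_iff: "(Const a :: ('x, 'f::comm_ring_1) mpoly) = Const b \<longleftrightarrow> a = b"
  by (metis Const_def lookup_single_eq)

lemma eval_poly_Const:
  "eval_poly Const (\<lambda>i. Const (x i)) p = (Const (eval_poly id x p) :: ('y, 'f::comm_ring_1) mpoly)"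
proof -
  have sum: "Const (sum f A) = (\<Sum>a\<in>A. (Const (f a) :: ('y, 'f) mpoly))"
    for f :: "'b \<Rightarrow> 'f" and A
    by (induction A rule: infinite_finite_induct) (simp_all add: Const_add)
  have prod: "Const (prod f A) = (\<Prod>a\<in>A. (Const (f a) :: ('y, 'f) mpoly))"
    for f :: "'b \<Rightarrow> 'f" and A
    by (induction A rule: infinite_finite_induct) (simp_all add: Const_mult)
  have power: "Const (a ^ n) = (Const a ^ n :: ('y, 'f) mpoly)" for a n
    by (induction n) (simp_all add: Const_mult)
  show ?thesis
    by (simp add: eval_poly_def sum prod power Const_mult)
qed

lemma group_rational_points:
  assumes "group_scheme G"
  shows "group (rational_points G)"
proof -
  let ?c = "\<lambda>x i. Const (x i) :: 'b test_ring"
  let ?X = "points id {0} (gp_eqs G)"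
  have ideal: "is_ideal ({0} :: 'b test_ring set)"
    by (rule module.subspace_single_0[OF module_mult])
  have X: "?c x \<in> test_points {0} (gp_eqs G) \<longleftrightarrow> x \<in> ?X" for x
    by (auto simp: points_def eval_poly_Const Const_eq_iff simp flip: Const_0)
  have m: "mult_pt G Const (?c x) (?c y) = ?c (mult_pt G id x y)" for x y
  proof -
    have "case_sum (?c x) (?c y) = ?c (case_sum x y)"
      by (auto simp: fun_eq_iff split: sum.split)
    then show ?thesis
      by (simp add: mult_pt_def eval_poly_Const)
  qed
  have e: "unit_pt G Const = ?c (unit_pt G id)"
    by (simp add: unit_pt_def)
  have i: "inv_pt G Const (?c x) = ?c (inv_pt G id x)" for x
    by (simp add: inv_pt_def eval_poly_Const)
  have c: "cong_mod {0} (?c x) (?c y) \<longleftrightarrow> x = y" for x y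
    by (simp add: cong_mod_def Const_eq_iff fun_eq_iff)
  note G = assms[unfolded group_scheme_def Let_def, rule_format, OF ideal]
  show ?thesis
  proof (rule groupI, unfold rational_points_def, simp_all, goal_cases)
    case (1 x y)
    then show ?case using G X m by metis
  next
    case 2
    then show ?case using G X e by metis
  next
    case (3 x y z)
    then have "cong_mod {0} (mult_pt G Const (mult_pt G Const (?c x) (?c y)) (?c z))
       (mult_pt G Const (?c x) (mult_pt G Const (?c y) (?c z)))"
      using G X by blast
    then show ?case by (simp only: m c)
  next
    case (4 x)
    then have "cong_mod {0} (mult_pt G Const (unit_pt G Const) (?c x)) (?c x)"
      using G X by blast
    then show ?case by (simp only: m c e)
  next
    case (5 x)
    then have "cong_mod {0} (mult_pt G Const (inv_pt G Const (?c x)) (?c x)) (unit_pt G Const)"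
      and "inv_pt G Const (?c x) \<in> test_points {0} (gp_eqs G)"
      using G X by blast+
    then show ?case by (auto simp only: m c e i X)
  qed
qed

lemma (in nonarch_local_field) topspace_rational_topology:
  "topspace (rational_topology v G) = carrier (rational_points G)"
  by (simp add: rational_topology_def)

section \<open>Power maps\<close>

definition quotient_topology :: "'a topology \<Rightarrow> ('a \<Rightarrow> 'b) \<Rightarrow> 'b topology" where
  "quotient_topology T f =
     topology (\<lambda>U. U \<subseteq> f ` topspace T \<and> openin T {x \<in> topspace T. f x \<in> U})"

lemma quotient_map_quotient_topology: "quotient_map T (quotient_topology T f) f"
proof -
  let ?P = "\<lambda>U. U \<subseteq> f ` topspace T \<and> openin T {x \<in> topspace T. f x \<in> U}"
  have Int: "{x \<in> topspace T. f x \<in> U \<inter> V} = {x \<in> topspace T. f x \<in> U} \<inter> {x \<in> topspace T. f x \<in> V}"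
    for U V by auto
  have Un: "{x \<in> topspace T. f x \<in> \<Union>\<K>} = (\<Union>U\<in>\<K>. {x \<in> topspace T. f x \<in> U})" for \<K>
    by auto
  have "istopology ?P"
    unfolding istopology_def Int Un by auto
  then have op: "openin (quotient_topology T f) = ?P"
    by (simp add: quotient_topology_def topology_inverse')
  have "{x \<in> topspace T. f x \<in> f ` topspace T} = topspace T" by auto
  then have "topspace (quotient_topology T f) = f ` topspace T"
    unfolding topspace_def[of "quotient_topology T f"] op by auto
  then show ?thesis
    by (auto simp: quotient_map_def op)
qed

definition power_image :: "('a, 'm) monoid_scheme \<Rightarrow> nat \<Rightarrow> 'a set" where
  "power_image A k = (\<lambda>x. x [^]\<^bsub>A\<^esub> k) ` carrier A"

definition power_surjective :: "('a, 'm) monoid_scheme \<Rightarrow> nat \<Rightarrow> bool" where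
  "power_surjective A k \<longleftrightarrow> power_image A k = carrier A"

text \<open>Here \<open>T\<close> is the topology of the topological group \<open>A\<close>.\<close>

definition power_dense :: "'a topology \<Rightarrow> ('a, 'm) monoid_scheme \<Rightarrow> nat \<Rightarrow> bool" where
  "power_dense T A k \<longleftrightarrow> T closure_of power_image A k = topspace T"

end

theory Submission
  imports Defs "Jordan_Normal_Form.Char_Poly"
begin

text \<open>
  Write \<open>\<Gamma>\<close> for the group of rational points, \<open>O\<close> for the valuation ring with uniformizer \<open>\<pi>\<close>, and \<open>p\<close>
  for the residue characteristic. If the image of \<open>P\<^sub>k\<close> is dense, so is that of \<open>P\<^sub>K\<close> for
  every \<open>K = k ^ m\<close>. This forces every element of \<open>\<Gamma>\<close> to have, in a sense made precise below, an exponent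
  prime to \<open>k\<close>; and such an element has \<open>k\<close>-th roots in every Zariski closed subgroup that
  contains it.

  \<^item> Linearity. The translates of the coordinate functions span a finite-dimensional space of
    functions on \<open>\<Gamma>\<close>. This makes \<open>\<Gamma>\<close> a group of \<open>N \<times> N\<close> matrices whose entries depend continuously on
    the point, while the coordinates of the point are linear in the entries
    (\<open>ex_matrix_embedding\<close>).

  \<^item> All elements are integral, that is, their characteristic polynomials have coefficients in \<open>O\<close>, or
    equivalently their powers are bounded (\<open>integral_G\<close>). Suppose first that \<open>g\<close> is close to
    \<open>x ^ K\<close> with \<open>K = k ^ m\<close> large. Then \<open>x ^ K\<close> is bounded in terms of \<open>g\<close>, so by Gauss's lemma for weighted norms
    the coefficients of the characteristic polynomial of \<open>x\<close> are bounded by a number that tends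
    to \<open>1\<close> for \<open>K \<rightarrow> \<infinity>\<close>. As the valuation is discrete, \<open>x\<close> is integral, hence so are
    \<open>x ^ K\<close> and \<open>g\<close>. This applies to the elements of \<open>H\<close>. In general \<open>g\<close> is only close to \<open>x ^ K * h\<close> with
    \<open>h \<in> H\<close>. By a formula of Amitsur all elements of the \<open>O\<close>-algebra generated by \<open>H\<close> are integral
    (\<open>integral_weighted\<close>). Its closure is bounded modulo its largest \<open>F\<close>-subspace, which is a nil ideal and
    therefore nilpotent. Such a nilpotent part does not influence the growth of powers
    (\<open>chi_coset_bound\<close>), and the factor \<open>h\<close> does no harm.

  \<^item> Exponents. Now the closed \<open>O\<close>-algebra \<open>R\<close> generated by \<open>\<Gamma>\<close> consists of integral elements, and
    the theorem of Cayley and Hamilton with the finiteness of \<open>O / \<pi>\<close> gives a single \<open>e > 0\<close> with \<open>g ^ e \<in> 1 + \<pi> R\<close> for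
    all \<open>g\<close>; hence \<open>e * p ^ i\<close> is an exponent of \<open>\<Gamma>\<close> modulo \<open>1 + \<pi> ^ Suc i R\<close>. In these quotients \<open>k ^ m\<close>-th powers
    exhaust first \<open>H\<close> and then \<open>\<Gamma>\<close> modulo \<open>H\<close>, so the exponents can be replaced by numbers \<open>M\<close>
    prime to \<open>k\<close> (\<open>uniform_exponent_transfer\<close>). If \<open>p\<close> does not divide \<open>k\<close>, this gives
    \<open>g ^ (M * p ^ a) \<rightarrow> 1\<close>. If \<open>p\<close> divides \<open>k\<close>, then \<open>M\<close> is the same for all \<open>i\<close>, so \<open>g ^ M\<close> is
    unipotent, and even \<open>g ^ M = 1\<close> in characteristic \<open>p\<close>.

  \<^item> Roots (\<open>roots_if_dense\<close>). In the first case a root of \<open>g\<close> is a limit of powers \<open>g ^ b\<close> with \<open>k * b\<close> congruent to \<open>1\<close>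
    modulo \<open>M * p ^ a\<close>; in characteristic \<open>p\<close> it is a power of \<open>g\<close>. In the remaining case the field has
    characteristic zero, \<open>t \<mapsto> (g ^ M) ^ t\<close> is a polynomial curve, and its value at \<open>1 / k\<close> is a root of
    \<open>g ^ M\<close> that commutes with \<open>g\<close>; a combination of it with a power of \<open>g\<close> is a root of \<open>g\<close>. A Zariski
    closed subgroup that contains \<open>g\<close> also contains the root.

  The second assertion follows at once, and the first one from the same argument with \<open>H = \<Gamma>\<close>. The third
  combines both, because surjectivity implies density and passes to quotients.
\<close>

(* Below, eval_poly is the evaluation of polynomials in several variables. *)
hide_const (open) Ring_Hom_Poly.eval_poly
hide_fact (open) Ring_Hom_Poly.eval_poly_def

section \<open>Local fields\<close>

context nonarch_local_field
begin

lemma v_0 [simp]: "v 0 = 0"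
  by (simp add: eq_0_iff)

lemma v_1 [simp]: "v 1 = 1"
  using mult[of 1 1] eq_0_iff[of 1] by auto

lemma v_minus [simp]: "v (- a) = v a"
proof -
  have "v (-1) * v (-1) = 1"
    using mult[of "-1" "-1"] by simp
  then have "v (-1) = 1"
    using nonneg[of "-1"] by (metis abs_of_nonneg abs_1 real_sqrt_abs2 real_sqrt_one)
  then show ?thesis
    using mult[of "-1" a] by simp
qed

lemma v_minus_commute: "v (a - b) = v (b - a)"
  using v_minus[of "a - b"] by simp

lemma v_diff: "v (a - b) \<le> max (v a) (v b)"
  using ultrametric[of a "-b"] by simp

lemma v_pos: "a \<noteq> 0 \<Longrightarrow> 0 < v a"
  using nonneg[of a] eq_0_iff[of a] by linarith

lemma v_power: "v (a ^ n) = v a ^ n"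
  by (induction n) (simp_all add: mult)

lemma v_inverse: "v (inverse a) = inverse (v a)"
proof (cases "a = 0")
  case False
  then have "v (inverse a) * v a = 1"
    by (simp flip: mult)
  then show ?thesis
    by (metis inverse_unique mult.commute)
qed simp

lemma v_divide: "v (a / b) = v a / v b"
  by (simp add: divide_inverse mult v_inverse)

lemma v_sum_le:
  assumes "\<And>i. i \<in> A \<Longrightarrow> v (f i) \<le> C" "0 \<le> C"
  shows "v (sum f A) \<le> C"
  using assms
proof (induction A rule: infinite_finite_induct)
  case (insert x A)
  then have "v (f x) \<le> C" "v (sum f A) \<le> C" by auto
  then show ?case
    using ultrametric[of "f x" "sum f A"] insert.hyps by simp
qed auto

lemma v_of_nat_le: "v (of_nat n) \<le> 1"
proof (induction n)
  case (Suc n)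
  then show ?case using ultrametric[of 1 "of_nat n"] by simp
qed simp

lemma v_eq_if_close: "v (a - b) < v a \<Longrightarrow> v b = v a"
  using v_diff[of a "a - b"] ultrametric[of b "a - b"] by simp

lemma ex_small: "\<exists>c. 0 < v c \<and> v c < 1"
proof -
  obtain x where x: "x \<noteq> 0" "v x \<noteq> 1" using nontrivial by blast
  show ?thesis
  proof (cases "v x < 1")
    case True then show ?thesis using x v_pos by blast
  next
    case False
    then have "v (inverse x) < 1" "0 < v (inverse x)"
      using x v_pos[of x] by (simp_all add: v_inverse inverse_less_1_iff)
    then show ?thesis by blast
  qed
qed

lemma ex_smaller:
  assumes "0 < e"
  shows "\<exists>c. 0 < v c \<and> v c < e"
proof -
  obtain c where c: "0 < v c" "v c < 1" using ex_small by blast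
  obtain n where "v c ^ n < e" using real_arch_pow_inv[OF assms c(2)] by blast
  then show ?thesis using c(1) by (intro exI[of _ "c ^ n"]) (simp add: v_power)
qed

lemma ex_compact_ball:
  "\<exists>K e. compactin (field_topology v) K \<and> 0 < e \<and> {x. v x < e} \<subseteq> K"
proof -
  interpret M: Metric_space UNIV "\<lambda>x y. v (x - y)" by (rule Metric_space)
  obtain U K where UK: "openin (field_topology v) U" "compactin (field_topology v) K" "0 \<in> U" "U \<subseteq> K"
    using locally_compact unfolding locally_compact_space_def
    by (metis UNIV_I topspace_field_topology)
  then obtain e where "0 < e" "M.mball 0 e \<subseteq> U"
    by (auto simp: field_topology_def M.openin_mtopology)
  moreover have "M.mball 0 e = {x. v x < e}"
    by (auto simp: M.mball_def)
  ultimately show ?thesis using UK by blast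
qed

text \<open>A scalar multiple of the sequence lies in a compact neighbourhood of \<open>0\<close>.\<close>

lemma bounded_convergent_subsequence:
  assumes "\<And>n. v (X n) \<le> C"
  shows "\<exists>l r. strict_mono (r :: nat \<Rightarrow> nat) \<and> (\<lambda>n. v (X (r n) - l)) \<longlonglongrightarrow> 0"
proof -
  interpret M: Metric_space UNIV "\<lambda>x y. v (x - y)" by (rule Metric_space)
  obtain K e where K: "compactin (field_topology v) K" "0 < e" "{x. v x < e} \<subseteq> K"
    using ex_compact_ball by blast
  have C: "0 \<le> C" using assms[of 0] nonneg[of "X 0"] by linarith
  then obtain c where c: "0 < v c" "v c < e / (C + 1)"
    using ex_smaller[of "e / (C + 1)"] K(2) by auto
  have "v (c * X n) < e" for n
  proof -
    have "v (c * X n) \<le> v c * (C + 1)"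
      using assms[of n] c(1) by (simp add: mult)
    also have "\<dots> < e" using c C by (simp add: pos_less_divide_eq)
    finally show ?thesis .
  qed
  then have "range (\<lambda>n. c * X n) \<subseteq> K" using K(3) by auto
  then obtain l r where r: "strict_mono (r :: nat \<Rightarrow> nat)"
      "limitin M.mtopology ((\<lambda>n. c * X n) \<circ> r) l sequentially"
    using K(1) unfolding field_topology_def M.compactin_sequentially by blast
  have "(\<lambda>n. v (c * X (r n) - l)) \<longlonglongrightarrow> 0"
    using r(2) by (simp add: M.limitin_metric_dist_null o_def)
  then have "(\<lambda>n. inverse (v c) * v (c * X (r n) - l)) \<longlonglongrightarrow> inverse (v c) * 0"
    by (intro tendsto_intros)
  moreover have "inverse (v c) * v (c * X (r n) - l) = v (X (r n) - l / c)" for n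
  proof -
    have "c \<noteq> 0" using c(1) by auto
    then have "X (r n) - l / c = inverse c * (c * X (r n) - l)"
      by (simp add: field_simps)
    then show ?thesis by (simp only: mult v_inverse)
  qed
  ultimately show ?thesis using r(1) by auto
qed

text \<open>If the values less than \<open>1\<close> had no maximum, some sequence of values would approach their
  supremum strictly from below; but along a convergent subsequence the values are eventually constant,
  since nearby elements of an ultrametric field have the same value.\<close>

lemma ex_uniformizer: "\<exists>\<pi>. 0 < v \<pi> \<and> v \<pi> < 1 \<and> (\<forall>a. v a < 1 \<longrightarrow> v a \<le> v \<pi>)"
proof (rule ccontr)
  assume no: "\<not> ?thesis"
  obtain c where c: "0 < v c" "v c < 1" using ex_small by blast
  define S where "S = v ` {a. v a < 1}"
  have bdd: "bdd_above S" unfolding S_def by (rule bdd_aboveI[of _ 1]) auto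
  have ne: "S \<noteq> {}" using c by (auto simp: S_def)
  have less: "v a < Sup S" if "v a < 1" for a
  proof (cases "a = 0")
    case True
    then have "\<exists>s\<in>S. v a < s" using c by (auto simp: S_def)
    then show ?thesis using less_cSup_iff[OF ne bdd] by simp
  next
    case False
    then obtain b where "v b < 1" "v a < v b" using no \<open>v a < 1\<close> v_pos[of a] by (metis not_le)
    then show ?thesis using less_cSup_iff[OF ne bdd] by (auto simp: S_def)
  qed
  have "\<exists>a. v a < 1 \<and> Sup S - 1 / Suc n < v a" for n
    using less_cSup_iff[OF ne bdd, of "Sup S - 1 / Suc n"] by (auto simp: S_def)
  then obtain X where X: "\<And>n. v (X n) < 1" "\<And>n. Sup S - 1 / Suc n < v (X n)" by metis
  obtain l r where r: "strict_mono (r :: nat \<Rightarrow> nat)" "(\<lambda>n. v (X (r n) - l)) \<longlonglongrightarrow> 0"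
    using bounded_convergent_subsequence[of X 1] X(1) less_imp_le by blast
  have S0: "0 < Sup S" using less[OF c(2)] c(1) by linarith
  have lim: "(\<lambda>n. v (X (r n))) \<longlonglongrightarrow> Sup S"
  proof (rule real_tendsto_sandwich)
    show "(\<lambda>n. Sup S - 1 / Suc (r n)) \<longlonglongrightarrow> Sup S"
    proof -
      have "(\<lambda>n. Sup S - 1 / Suc n) \<longlonglongrightarrow> Sup S - 0"
        by (intro tendsto_intros LIMSEQ_Suc lim_1_over_n)
      from LIMSEQ_subseq_LIMSEQ[OF this r(1)] show ?thesis by (simp add: o_def)
    qed
    show "\<forall>\<^sub>F n in sequentially. Sup S - 1 / Suc (r n) \<le> v (X (r n))"
      using X(2) less_imp_le by (intro always_eventually) blast
    show "\<forall>\<^sub>F n in sequentially. v (X (r n)) \<le> Sup S"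
      using less X(1) less_imp_le by (intro always_eventually) blast
  qed simp
  have "\<forall>\<^sub>F n in sequentially. v (X (r n) - l) < Sup S / 2 \<and> Sup S / 2 < v (X (r n))"
    using order_tendstoD(2)[OF r(2), of "Sup S / 2"] order_tendstoD(1)[OF lim, of "Sup S / 2"] S0
    by (auto elim: eventually_elim2)
  then have ev: "\<forall>\<^sub>F n in sequentially. v l = v (X (r n))"
  proof eventually_elim
    case (elim n)
    then have "v (X (r n) - l) < v (X (r n))" by linarith
    then show ?case by (rule v_eq_if_close)
  qed
  then obtain n where "v l = v (X (r n))"
    using eventually_happens'[OF _ ev] by auto
  then have "v l < 1" using X(1) by simp
  moreover have "v l = Sup S"
  proof -
    have "(\<lambda>n. v (X (r n))) \<longlonglongrightarrow> v l"
      using tendsto_eventually[of "\<lambda>n. v (X (r n))" "v l" sequentially] ev by (simp add: eq_commute)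
    then show ?thesis using lim LIMSEQ_unique by blast
  qed
  ultimately show False using less[of l] by simp
qed

text \<open>Total boundedness of a compact ball, rescaled to the valuation ring.\<close>

lemma finite_residues:
  assumes "0 < v \<pi>"
  shows "\<exists>R. finite R \<and> (\<forall>a. v a \<le> 1 \<longrightarrow> (\<exists>b\<in>R. v (a - b) \<le> v \<pi>))"
proof -
  interpret M: Metric_space UNIV "\<lambda>x y. v (x - y)" by (rule Metric_space)
  obtain K e where K: "compactin (field_topology v) K" "0 < e" "{x. v x < e} \<subseteq> K"
    using ex_compact_ball by blast
  obtain c where c: "0 < v c" "v c < e" using ex_smaller K(2) by blast
  then have c0: "c \<noteq> 0" by auto
  have "M.mtotally_bounded K"
    using K(1) by (simp add: field_topology_def M.compactin_imp_mtotally_bounded)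
  then obtain R where R: "finite R" "K \<subseteq> (\<Union>x\<in>R. M.mball x (v (c * \<pi>)))"
    using c assms unfolding M.mtotally_bounded_def by (metis mult mult_pos_pos)
  have "\<exists>b\<in>R. v (a - b / c) \<le> v \<pi>" if "v a \<le> 1" for a
  proof -
    have "v (c * a) \<le> v c" using that c(1) by (simp add: mult)
    then have "c * a \<in> K" using K(3) c(2) by auto
    then obtain b where b: "b \<in> R" "v (b - c * a) < v (c * \<pi>)"
      using R(2) by (auto simp: M.mball_def)
    have "v (c * (a - b / c)) = v (b - c * a)"
      using c0 by (simp add: algebra_simps v_minus_commute)
    with b(2) have "v c * v (a - b / c) < v c * v \<pi>" by (simp add: mult)
    with c(1) have "v (a - b / c) < v \<pi>" by (simp only: mult_less_cancel_left_pos)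
    with b(1) show ?thesis using less_imp_le by blast
  qed
  then show ?thesis using R(1) by (intro exI[of _ "(\<lambda>b. b / c) ` R"]) auto
qed

text \<open>Two natural numbers agree modulo the maximal ideal, so some positive integer has value less
  than \<open>1\<close>; a prime factor of the least such integer has value less than \<open>1\<close> as well.\<close>

lemma ex_residue_char: "\<exists>p. prime (p::nat) \<and> v (of_nat p) < 1"
proof -
  obtain \<pi> where \<pi>: "0 < v \<pi>" "v \<pi> < 1" using ex_small by blast
  obtain R where R: "finite R" "\<And>a. v a \<le> 1 \<Longrightarrow> \<exists>b\<in>R. v (a - b) \<le> v \<pi>"
    using finite_residues[OF \<pi>(1)] by blast
  have "\<forall>n::nat. \<exists>b. b \<in> R \<and> v (of_nat n - b) \<le> v \<pi>"
    using R(2) v_of_nat_le by blast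
  then obtain f where f: "\<And>n::nat. f n \<in> R" "\<And>n::nat. v (of_nat n - f n) \<le> v \<pi>"
    by metis
  have "\<not> inj f"
    using f(1) R(1) by (meson finite_imageD finite_subset image_subsetI infinite_UNIV_nat)
  then obtain m n where mn: "m < n" "f m = f n"
    by (metis injI linorder_neqE_nat)
  have "of_nat (n - m) = (of_nat n - f n) - (of_nat m - f m)"
    using mn by (simp add: of_nat_diff)
  then have "v (of_nat (n - m)) \<le> v \<pi>"
    using v_diff[of "of_nat n - f n" "of_nat m - f m"] f(2)[of n] f(2)[of m] by simp
  then have ex: "\<exists>d>0. v (of_nat d) < 1" using mn \<pi>(2) by (intro exI[of _ "n - m"]) auto
  define d where "d = (LEAST d. 0 < d \<and> v (of_nat d) < 1)"
  have d: "0 < d" "v (of_nat d) < 1" using LeastI_ex[OF ex] by (auto simp: d_def)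
  have "d \<noteq> 1" using d(2) by auto
  then obtain p where p: "prime p" "p dvd d" using prime_factor_nat by blast
  then obtain r where r: "d = p * r" by auto
  have "0 < r" "r < d" using r d(1) p(1) prime_gt_1_nat[of p] by auto
  then have "\<not> v (of_nat r) < 1" using not_less_Least[of r] by (auto simp: d_def)
  then have "v (of_nat r) = 1" using v_of_nat_le[of r] by linarith
  then show ?thesis using p(1) d(2) r by (auto simp: mult)
qed

end

context nonarch_local_field
begin

text \<open>Convergence with respect to \<open>v\<close>, expressed by real numbers because the type of the field
  carries no topology.\<close>

definition null_diff :: "(nat \<Rightarrow> 'f) \<Rightarrow> 'f \<Rightarrow> bool" where
  "null_diff X x \<longleftrightarrow> (\<lambda>n. v (X n - x)) \<longlonglongrightarrow> 0"

lemma null_diff_le: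
  assumes "\<And>n. v (X n - x) \<le> f n" "f \<longlonglongrightarrow> 0"
  shows "null_diff X x"
  unfolding null_diff_def
  by (rule tendsto_sandwich[OF _ _ tendsto_const assms(2)])
    (use assms(1) nonneg in \<open>auto intro!: always_eventually\<close>)

lemma null_diff_const: "null_diff (\<lambda>_. x) x"
  by (simp add: null_diff_def)

lemma null_diff_add:
  assumes "null_diff X x" "null_diff Y y"
  shows "null_diff (\<lambda>n. X n + Y n) (x + y)"
proof (rule null_diff_le)
  show "v (X n + Y n - (x + y)) \<le> v (X n - x) + v (Y n - y)" for n
  proof -
    have eq: "X n + Y n - (x + y) = (X n - x) + (Y n - y)" by simp
    show ?thesis
      unfolding eq using ultrametric[of "X n - x" "Y n - y"] nonneg[of "X n - x"] nonneg[of "Y n - y"] by linarith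
  qed
  show "(\<lambda>n. v (X n - x) + v (Y n - y)) \<longlonglongrightarrow> 0"
    using assms tendsto_add[of "\<lambda>n. v (X n - x)" 0 sequentially "\<lambda>n. v (Y n - y)" 0]
    by (simp add: null_diff_def)
qed

lemma null_diff_mult:
  assumes "null_diff X x" "null_diff Y y"
  shows "null_diff (\<lambda>n. X n * Y n) (x * y)"
proof (rule null_diff_le)
  let ?f = "\<lambda>n. v (X n - x) * (v y + v (Y n - y)) + v x * v (Y n - y)"
  show "v (X n * Y n - x * y) \<le> ?f n" for n
  proof -
    have eq: "X n * Y n - x * y = (X n - x) * Y n + x * (Y n - y)"
      by (simp add: algebra_simps)
    have "v (X n * Y n - x * y) \<le> max (v (X n - x) * v (Y n)) (v x * v (Y n - y))"
      unfolding eq mult[symmetric] by (rule ultrametric)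
    moreover have "v (Y n) \<le> v y + v (Y n - y)"
      using ultrametric[of y "Y n - y"] nonneg[of y] nonneg[of "Y n - y"] by simp
    then have "v (X n - x) * v (Y n) \<le> v (X n - x) * (v y + v (Y n - y))"
      using nonneg by (intro mult_left_mono)
    moreover have "0 \<le> v (X n - x) * (v y + v (Y n - y))" "0 \<le> v x * v (Y n - y)"
      using nonneg by simp_all
    ultimately show ?thesis by linarith
  qed
  have "?f \<longlonglongrightarrow> 0 * (v y + 0) + v x * 0"
    using assms unfolding null_diff_def by (intro tendsto_intros)
  then show "?f \<longlonglongrightarrow> 0" by simp
qed

lemma null_diff_sum:
  "(\<And>i. i \<in> I \<Longrightarrow> null_diff (X i) (x i)) \<Longrightarrow> null_diff (\<lambda>n. \<Sum>i\<in>I. X i n) (\<Sum>i\<in>I. x i)"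
  by (induction I rule: infinite_finite_induct) (auto intro: null_diff_const null_diff_add)

lemma null_diff_prod:
  "(\<And>i. i \<in> I \<Longrightarrow> null_diff (X i) (x i)) \<Longrightarrow> null_diff (\<lambda>n. \<Prod>i\<in>I. X i n) (\<Prod>i\<in>I. x i)"
  by (induction I rule: infinite_finite_induct) (auto intro: null_diff_const null_diff_mult)

lemma null_diff_power:
  "null_diff X x \<Longrightarrow> null_diff (\<lambda>n. X n ^ k) (x ^ k)"
  by (induction k) (auto intro: null_diff_const null_diff_mult)

lemma null_diff_unique:
  assumes "null_diff X x" "null_diff X y"
  shows "x = y"
proof -
  have "null_diff (\<lambda>n. X n + (-1) * X n) (x + (-1) * y)"
    using assms by (intro null_diff_add null_diff_mult null_diff_const)
  then show ?thesis by (simp add: null_diff_def LIMSEQ_const_iff eq_0_iff)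
qed

text \<open>One passes to a subsequence for each index in turn.\<close>

lemma bounded_family_subsequence:
  assumes "finite I" "\<And>i n. i \<in> I \<Longrightarrow> v (X n i) \<le> C"
  shows "\<exists>l r. strict_mono (r :: nat \<Rightarrow> nat) \<and> (\<forall>i\<in>I. null_diff (\<lambda>n. X (r n) i) (l i))"
  using assms
proof (induction I)
  case empty
  then show ?case using strict_mono_id by auto
next
  case (insert i I)
  obtain l r where lr: "strict_mono (r :: nat \<Rightarrow> nat)" "\<forall>j\<in>I. null_diff (\<lambda>n. X (r n) j) (l j)"
    using insert.IH insert.prems by auto
  obtain l' r' where l': "strict_mono (r' :: nat \<Rightarrow> nat)" "(\<lambda>n. v (X (r (r' n)) i - l')) \<longlonglongrightarrow> 0"
    using bounded_convergent_subsequence[of "\<lambda>n. X (r n) i" C] insert.prems by auto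
  have "null_diff (\<lambda>n. X (r (r' n)) j) (l j)" if "j \<in> I" for j
    using LIMSEQ_subseq_LIMSEQ[OF _ l'(1), of "\<lambda>n. v (X (r n) j - l j)" 0] lr(2) that
    by (auto simp: null_diff_def o_def)
  moreover have "strict_mono (\<lambda>n. r (r' n))" using lr(1) l'(1) by (simp add: strict_mono_def)
  ultimately show ?case
    using l'(2) insert.hyps
    by (intro exI[of _ "l(i := l')"] exI[of _ "\<lambda>n. r (r' n)"]) (auto simp: null_diff_def)
qed

end

section \<open>Valued algebras\<close>

text \<open>The properties of the algebra of \<open>d \<times> d\<close> matrices over the field on which the argument rests: \<open>sc\<close> embeds
  the scalars, \<open>nm\<close> is the maximum norm of the entries, and \<open>chi x i\<close> is the coefficient of \<open>t ^ i\<close> in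
  \<open>det (1 - t x)\<close>, the reversed characteristic polynomial. The assumption \<open>chi_power\<close> says that bounds on the
  eigenvalues of \<open>x ^ K\<close> give bounds on the eigenvalues of \<open>x\<close>, in a form that does not
  mention eigenvalues; \<open>amitsur\<close> says that sums of elements of a multiplicative set of integral matrices are
  integral. The carrier \<open>A\<close> is a subset of a type because the size of the matrices is not known beforehand.\<close>

locale valued_algebra = nonarch_local_field v
  for v :: "'f::field \<Rightarrow> real" +
  fixes sc :: "'f \<Rightarrow> 'r::ring_1"
    and A :: "'r set"
    and nm :: "'r \<Rightarrow> real"
    and chi :: "'r \<Rightarrow> nat \<Rightarrow> 'f"
    and d D :: nat
  assumes sc_add: "sc (a + b) = sc a + sc b"
    and sc_mult: "sc (a * b) = sc a * sc b"
    and sc_1 [simp]: "sc 1 = 1"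
    and sc_commute: "sc c * x = x * sc c"
    and sc_in [simp, intro]: "sc c \<in> A"
    and add_in [intro]: "x \<in> A \<Longrightarrow> y \<in> A \<Longrightarrow> x + y \<in> A"
    and mult_in [intro]: "x \<in> A \<Longrightarrow> y \<in> A \<Longrightarrow> x * y \<in> A"
    and nm_nonneg [simp]: "0 \<le> nm x"
    and nm_eq_0: "x \<in> A \<Longrightarrow> nm x = 0 \<longleftrightarrow> x = 0"
    and nm_add: "x \<in> A \<Longrightarrow> y \<in> A \<Longrightarrow> nm (x + y) \<le> max (nm x) (nm y)"
    and nm_mult: "x \<in> A \<Longrightarrow> y \<in> A \<Longrightarrow> nm (x * y) \<le> nm x * nm y"
    and nm_sc: "x \<in> A \<Longrightarrow> nm (sc c * x) = v c * nm x"
    and nm_1 [simp]: "nm 1 = 1"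
    and nm_value: "x \<in> A \<Longrightarrow> \<exists>c. v c = nm x"
    and bounded_subsequence: "(\<And>n. X n \<in> A) \<Longrightarrow> (\<And>n. nm (X n) \<le> C) \<Longrightarrow>
          \<exists>l r. l \<in> A \<and> strict_mono (r :: nat \<Rightarrow> nat) \<and> (\<lambda>n. nm (X (r n) - l)) \<longlonglongrightarrow> 0"
    and dependent: "(\<And>i. Y i \<in> A) \<Longrightarrow>
          \<exists>c. (\<exists>i\<le>D. c i \<noteq> 0) \<and> (\<Sum>i\<le>D. sc (c i) * Y (i::nat)) = 0"
    and chi_0: "x \<in> A \<Longrightarrow> chi x 0 = 1"
    and chi_beyond: "x \<in> A \<Longrightarrow> d < i \<Longrightarrow> chi x i = 0"
    and chi_le: "x \<in> A \<Longrightarrow> v (chi x i) \<le> nm x ^ i"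
    and chi_scale: "x \<in> A \<Longrightarrow> chi (sc c * x) i = c ^ i * chi x i"
    and chi_power: "x \<in> A \<Longrightarrow> 0 < K \<Longrightarrow> 0 < C \<Longrightarrow> (\<And>i. v (chi (x ^ K) i) \<le> C ^ i) \<Longrightarrow>
          v (chi x i) ^ K \<le> C ^ i"
    and chi_continuous: "(\<And>n. X n \<in> A) \<Longrightarrow> x \<in> A \<Longrightarrow> (\<lambda>n. nm (X n - x)) \<longlonglongrightarrow> 0 \<Longrightarrow>
          (\<lambda>n. v (chi (X n) i - chi x i)) \<longlonglongrightarrow> 0"
    and cayley_hamilton: "x \<in> A \<Longrightarrow> (\<Sum>i\<le>d. sc (chi x i) * x ^ (d - i)) = 0"
    and amitsur: "M \<subseteq> A \<Longrightarrow> (\<And>x y. x \<in> M \<Longrightarrow> y \<in> M \<Longrightarrow> x * y \<in> M) \<Longrightarrow>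
          (\<And>x i. x \<in> M \<Longrightarrow> v (chi x i) \<le> 1) \<Longrightarrow> set xs \<subseteq> M \<Longrightarrow> v (chi (sum_list xs) i) \<le> 1"
begin

lemma sc_0 [simp]: "sc 0 = 0"
  using sc_add[of 0 0] by simp

lemma sc_minus: "sc (- c) = - sc c"
  using sc_add[of c "- c"] by (simp add: eq_neg_iff_add_eq_0 add.commute)

lemma sc_diff: "sc (a - b) = sc a - sc b"
  using sc_add[of a "- b"] by (simp add: sc_minus)

lemma sc_of_nat: "sc (of_nat n) = of_nat n"
  by (induction n) (simp_all add: sc_add)

lemma sc_left_commute: "x * (sc c * y) = sc c * (x * y)"
  by (metis mult.assoc sc_commute)

lemma one_in [simp, intro]: "1 \<in> A" and zero_in [simp, intro]: "0 \<in> A"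
  using sc_in[of 1] sc_in[of 0] by simp_all

lemma minus_in [intro]: "x \<in> A \<Longrightarrow> - x \<in> A"
  using mult_in[OF sc_in[of "-1"], of x] by (simp add: sc_minus)

lemma diff_in [intro]: "x \<in> A \<Longrightarrow> y \<in> A \<Longrightarrow> x - y \<in> A"
  using add_in[of x "- y"] by auto

lemma power_in [intro]: "x \<in> A \<Longrightarrow> x ^ n \<in> A"
  by (induction n) auto

lemma sum_in [intro]: "(\<And>i. i \<in> I \<Longrightarrow> f i \<in> A) \<Longrightarrow> sum f I \<in> A"
  by (induction I rule: infinite_finite_induct) auto

lemma nm_0 [simp]: "nm 0 = 0"
  by (simp add: nm_eq_0)

lemma nm_minus: "x \<in> A \<Longrightarrow> nm (- x) = nm x"
  using nm_sc[of x "-1"] by (simp add: sc_minus)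

definition converges :: "(nat \<Rightarrow> 'r) \<Rightarrow> 'r \<Rightarrow> bool" where
  "converges X x \<longleftrightarrow> (\<forall>n. X n \<in> A) \<and> x \<in> A \<and> (\<lambda>n. nm (X n - x)) \<longlonglongrightarrow> 0"

lemma converges_const: "x \<in> A \<Longrightarrow> converges (\<lambda>_. x) x"
  by (simp add: converges_def)

lemma converges_nm_le:
  assumes "\<And>n. X n \<in> A" "x \<in> A" "\<And>n. nm (X n - x) \<le> f n" "f \<longlonglongrightarrow> 0"
  shows "converges X x"
  unfolding converges_def using assms
  by (auto intro!: tendsto_sandwich[of "\<lambda>_. 0" "\<lambda>n. nm (X n - x)" sequentially f])

lemma converges_add:
  assumes "converges X x" "converges Y y"
  shows "converges (\<lambda>n. X n + Y n) (x + y)"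
proof (rule converges_nm_le)
  have in': "X n \<in> A" "Y n \<in> A" "x \<in> A" "y \<in> A" for n
    using assms by (auto simp: converges_def)
  then show "X n + Y n \<in> A" "x + y \<in> A" for n by auto
  show "nm (X n + Y n - (x + y)) \<le> nm (X n - x) + nm (Y n - y)" for n
  proof -
    have eq: "X n + Y n - (x + y) = (X n - x) + (Y n - y)" by simp
    have "nm (X n + Y n - (x + y)) \<le> max (nm (X n - x)) (nm (Y n - y))"
      unfolding eq using in' by (intro nm_add) auto
    moreover have "0 \<le> nm (X n - x)" "0 \<le> nm (Y n - y)" by simp_all
    ultimately show ?thesis by linarith
  qed
  show "(\<lambda>n. nm (X n - x) + nm (Y n - y)) \<longlonglongrightarrow> 0"
    using assms tendsto_add[of "\<lambda>n. nm (X n - x)" 0 sequentially "\<lambda>n. nm (Y n - y)" 0]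
    by (simp add: converges_def)
qed

lemma converges_mult:
  assumes "converges X x" "converges Y y"
  shows "converges (\<lambda>n. X n * Y n) (x * y)"
proof (rule converges_nm_le)
  have in': "X n \<in> A" "Y n \<in> A" "x \<in> A" "y \<in> A" for n
    using assms by (auto simp: converges_def)
  then show "X n * Y n \<in> A" "x * y \<in> A" for n by auto
  let ?f = "\<lambda>n. nm (X n - x) * (nm y + nm (Y n - y)) + nm x * nm (Y n - y)"
  show "nm (X n * Y n - x * y) \<le> ?f n" for n
  proof -
    have "nm (Y n) \<le> max (nm y) (nm (Y n - y))"
      using nm_add[of y "Y n - y"] in' by auto
    then have Y: "nm (Y n) \<le> nm y + nm (Y n - y)"
      using nm_nonneg[of y] nm_nonneg[of "Y n - y"] by linarith
    have eq: "X n * Y n - x * y = (X n - x) * Y n + x * (Y n - y)"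
      by (simp add: algebra_simps)
    have "nm (X n * Y n - x * y) \<le> max (nm ((X n - x) * Y n)) (nm (x * (Y n - y)))"
      unfolding eq using in' by (intro nm_add) auto
    moreover have "nm ((X n - x) * Y n) \<le> nm (X n - x) * nm (Y n)"
      using in' by (intro nm_mult) auto
    moreover have "nm (X n - x) * nm (Y n) \<le> nm (X n - x) * (nm y + nm (Y n - y))"
      using Y by (intro mult_left_mono) auto
    moreover have "nm (x * (Y n - y)) \<le> nm x * nm (Y n - y)"
      using in' by (intro nm_mult) auto
    moreover have "0 \<le> nm (X n * Y n - x * y)" "0 \<le> nm x * nm (Y n - y)"
      "0 \<le> nm (X n - x) * (nm y + nm (Y n - y))" by simp_all
    ultimately show ?thesis by linarith
  qed
  have "?f \<longlonglongrightarrow> 0 * (nm y + 0) + nm x * 0"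
    using assms unfolding converges_def by (intro tendsto_intros) auto
  then show "?f \<longlonglongrightarrow> 0" by simp
qed

lemma converges_power:
  assumes "converges X x"
  shows "converges (\<lambda>n. X n ^ k) (x ^ k)"
  by (induction k) (use assms in \<open>auto intro: converges_const converges_mult\<close>)

lemma converges_diff:
  assumes "converges X x" "converges Y y"
  shows "converges (\<lambda>n. X n - Y n) (x - y)"
proof -
  have "converges (\<lambda>n. X n + sc (-1) * Y n) (x + sc (-1) * y)"
    using assms by (intro converges_add converges_mult converges_const) auto
  then show ?thesis by (simp add: sc_minus)
qed

lemma converges_unique: "converges X x \<Longrightarrow> converges X y \<Longrightarrow> x = y"
proof -
  assume *: "converges X x" "converges X y"
  have "converges (\<lambda>n. X n - X n) (x - y)" using * by (rule converges_diff)
  then have "x - y \<in> A" "nm (x - y) = 0"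
    using nm_minus[of "x - y"] by (auto simp: converges_def LIMSEQ_const_iff)
  then show ?thesis using nm_eq_0 by simp
qed

lemma converges_eventually_close:
  assumes "converges X x" "0 < e"
  shows "\<exists>n. nm (X n - x) < e"
  using assms order_tendstoD(2)[of "\<lambda>n. nm (X n - x)" 0 sequentially e]
  by (auto simp: converges_def eventually_sequentially)

section \<open>Integral elements\<close>

definition integral_elem :: "'r \<Rightarrow> bool" where
  "integral_elem x \<longleftrightarrow> x \<in> A \<and> (\<forall>i. v (chi x i) \<le> 1)"

lemma integral_limit:
  assumes "converges X x" "\<And>n. integral_elem (X n)"
  shows "integral_elem x"
proof -
  have "v (chi x i) \<le> 1" for i
  proof -
    have "(\<lambda>n. v (chi (X n) i - chi x i)) \<longlonglongrightarrow> 0"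
      using assms(1) chi_continuous by (simp add: converges_def)
    then obtain n where "v (chi (X n) i - chi x i) < 1"
      using order_tendstoD(2)[of _ 0 sequentially 1] by (force simp: eventually_sequentially)
    moreover have "v (chi (X n) i) \<le> 1" using assms(2) by (simp add: integral_elem_def)
    ultimately show ?thesis
      using v_diff[of "chi (X n) i" "chi (X n) i - chi x i"] by simp
  qed
  then show ?thesis using assms(1) by (simp add: integral_elem_def converges_def)
qed

lemma v_le_1_if_less:
  assumes "0 < v \<pi>" "\<forall>a. v a < 1 \<longrightarrow> v a \<le> v \<pi>" "v a < 1 / v \<pi>"
  shows "v a \<le> 1"
proof (rule ccontr)
  assume "\<not> v a \<le> 1"
  then have a: "1 < v a" by simp
  then have "v (inverse a) < 1" by (simp add: v_inverse inverse_less_1_iff)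
  then have "v (inverse a) \<le> v \<pi>" using assms(2) by blast
  then have "inverse (v a) * v a \<le> v \<pi> * v a"
    using a by (intro mult_right_mono) (auto simp: v_inverse)
  moreover have "inverse (v a) * v a = 1" using a by (intro left_inverse) auto
  ultimately have "1 \<le> v \<pi> * v a" by simp
  then show False using assms(1,3) by (simp add: field_simps)
qed

text \<open>The number \<open>q\<close> is the least value above \<open>1\<close>. A bound \<open>C ^ i\<close> for the coefficients of \<open>x ^ K\<close> yields the bound \<open>C ^ (i / K)\<close>
  for those of \<open>x\<close>; once this is less than \<open>q\<close>, they lie in the valuation ring. It is essential that \<open>K\<close>
  depends only on \<open>C\<close> and not on \<open>x\<close>.\<close>

lemma ex_power_bound: "\<exists>q>1. \<forall>C K x. x \<in> A \<longrightarrow> 0 < K \<longrightarrow> 1 \<le> C \<longrightarrow> C ^ d < q ^ K \<longrightarrow>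
    (\<forall>i. v (chi (x ^ K) i) \<le> C ^ i) \<longrightarrow> integral_elem x"
proof -
  obtain \<pi> where \<pi>: "0 < v \<pi>" "v \<pi> < 1" "\<forall>a. v a < 1 \<longrightarrow> v a \<le> v \<pi>"
    using ex_uniformizer by blast
  show ?thesis
  proof (intro exI[of _ "1 / v \<pi>"] conjI allI impI)
    show "1 < 1 / v \<pi>" using \<pi> by simp
    fix C :: real and K x
    assume *: "x \<in> A" "0 < K" "1 \<le> C" "C ^ d < (1 / v \<pi>) ^ K" "\<forall>i. v (chi (x ^ K) i) \<le> C ^ i"
    have "v (chi x i) \<le> 1" for i
    proof (cases "d < i")
      case True then show ?thesis using * by (simp add: chi_beyond)
    next
      case False
      have "v (chi x i) ^ K \<le> C ^ i" using * by (intro chi_power) auto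
      also have "\<dots> \<le> C ^ d" using * False by (intro power_increasing) auto
      also have "\<dots> < (1 / v \<pi>) ^ K" by fact
      finally have "v (chi x i) < 1 / v \<pi>"
        using \<pi> by (meson not_less power_mono zero_le_divide_1_iff less_imp_le order.strict_trans2 order_less_irrefl)
      then show ?thesis using \<pi> v_le_1_if_less by blast
    qed
    then show "integral_elem x" using * by (simp add: integral_elem_def)
  qed
qed

lemma integral_if_chi_powers_bounded:
  assumes "x \<in> A" "1 \<le> C" "\<And>j i. v (chi (x ^ j) i) \<le> C ^ i"
  shows "integral_elem x"
proof -
  obtain q where q: "1 < q" "\<forall>C K x. x \<in> A \<longrightarrow> 0 < K \<longrightarrow> 1 \<le> C \<longrightarrow> C ^ d < q ^ K \<longrightarrow>
    (\<forall>i. v (chi (x ^ K) i) \<le> C ^ i) \<longrightarrow> integral_elem x"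
    using ex_power_bound by blast
  obtain K where K: "C ^ d < q ^ K" using real_arch_pow[OF q(1)] by blast
  have "1 \<le> C ^ d" using assms(2) by simp
  then have "0 < K" using K by (cases K) auto
  then show ?thesis using q(2) K assms by blast
qed

lemma integral_if_powers_bounded:
  assumes "x \<in> A" "\<And>j. nm (x ^ j) \<le> C"
  shows "integral_elem x"
proof (rule integral_if_chi_powers_bounded[of x "max 1 C"])
  fix j i
  have "v (chi (x ^ j) i) \<le> nm (x ^ j) ^ i" using assms(1) by (intro chi_le) auto
  also have "\<dots> \<le> max 1 C ^ i" using assms(2)[of j] by (intro power_mono) auto
  finally show "v (chi (x ^ j) i) \<le> max 1 C ^ i" .
qed (use assms in auto)

text \<open>The theorem of Cayley and Hamilton expresses \<open>x ^ d\<close> by lower powers with coefficients in the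
  valuation ring.\<close>

lemma integral_power_eq:
  assumes "integral_elem x"
  shows "\<exists>c. (\<forall>l. v (c l) \<le> 1) \<and> x ^ j = (\<Sum>l<d. sc (c l) * x ^ l)"
proof (induction j)
  case 0
  have x: "x \<in> A" using assms by (simp add: integral_elem_def)
  have "0 < d"
  proof (rule ccontr)
    assume "\<not> 0 < d"
    then have "(1::'r) = 0" using cayley_hamilton[OF x] by (simp add: chi_0[OF x])
    then show False using nm_1 nm_0 by (metis zero_neq_one)
  qed
  then have "x ^ 0 = (\<Sum>l<d. sc (if l = 0 then 1 else 0) * x ^ l)"
    by (simp add: if_distrib[of sc] if_distrib[of "\<lambda>z. z * _"] sum.delta cong: if_cong)
  then show ?case by (intro exI[of _ "\<lambda>l. if l = 0 then 1 else 0"]) simp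
next
  case (Suc j)
  have x: "x \<in> A" and chi: "\<And>i. v (chi x i) \<le> 1" using assms by (simp_all add: integral_elem_def)
  obtain c where c: "\<And>l. v (c l) \<le> 1" "x ^ j = (\<Sum>l<d. sc (c l) * x ^ l)" using Suc by blast
  show ?case
  proof (cases d)
    case 0
    then show ?thesis using c(2) by (intro exI[of _ "\<lambda>_. 0"]) simp
  next
    case (Suc d')
    have "0 = (\<Sum>i\<le>d. sc (chi x i) * x ^ (d - i))" using cayley_hamilton[OF x] by simp
    also have "\<dots> = (\<Sum>l\<le>d. sc (chi x (d - l)) * x ^ l)"
      by (rule sum.reindex_bij_witness[of _ "\<lambda>i. d - i" "\<lambda>i. d - i"]) auto
    also have "\<dots> = (\<Sum>l<d. sc (chi x (d - l)) * x ^ l) + x ^ d"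
      by (simp add: lessThan_Suc_atMost[symmetric] chi_0[OF x])
    finally have xd: "x ^ d = - (\<Sum>l<d. sc (chi x (d - l)) * x ^ l)"
      by (simp add: eq_neg_iff_add_eq_0 add.commute)
    define c' where "c' l = (if l = 0 then 0 else c (l - 1)) - c d' * chi x (d - l)" for l
    have "x ^ Suc j = x ^ j * x" by (simp add: power_commutes)
    also have "\<dots> = (\<Sum>l<d. sc (c l) * x ^ l) * x" by (simp only: c(2))
    also have "\<dots> = (\<Sum>l<d. sc (c l) * x ^ Suc l)"
      by (simp add: sum_distrib_right mult.assoc power_commutes)
    also have "\<dots> = (\<Sum>l<d'. sc (c l) * x ^ Suc l) + sc (c d') * x ^ d"
      by (simp add: Suc)
    also have "(\<Sum>l<d'. sc (c l) * x ^ Suc l) = (\<Sum>l<d. sc (if l = 0 then 0 else c (l - 1)) * x ^ l)"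
      unfolding Suc sum.lessThan_Suc_shift by (simp del: power_Suc)
    also have "\<dots> + sc (c d') * x ^ d = (\<Sum>l<d. sc (c' l) * x ^ l)"
      by (simp add: xd c'_def sc_diff sc_mult sum_distrib_left left_diff_distrib sum_subtractf mult.assoc)
    finally have "x ^ Suc j = (\<Sum>l<d. sc (c' l) * x ^ l)" .
    moreover have "v (c' l) \<le> 1" for l
    proof -
      have "v (if l = 0 then 0 else c (l - 1)) \<le> 1" using c(1) by simp
      moreover have "v (c d' * chi x (d - l)) \<le> 1"
        using c(1)[of d'] chi[of "d - l"] nonneg by (simp add: mult mult_le_one)
      ultimately show ?thesis
        unfolding c'_def using v_diff[of "if l = 0 then 0 else c (l - 1)" "c d' * chi x (d - l)"]
        by linarith
    qed
    ultimately show ?thesis by blast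
  qed
qed

lemma nm_sum_le:
  assumes "\<And>i. i \<in> I \<Longrightarrow> f i \<in> A" "\<And>i. i \<in> I \<Longrightarrow> nm (f i) \<le> C" "0 \<le> C"
  shows "nm (sum f I) \<le> C"
  using assms
proof (induction I rule: infinite_finite_induct)
  case (insert i I)
  have "nm (f i + sum f I) \<le> max (nm (f i)) (nm (sum f I))"
    using insert.prems by (intro nm_add) auto
  moreover have "nm (sum f I) \<le> C" using insert by auto
  moreover have "nm (f i) \<le> C" using insert by auto
  ultimately show ?case using insert.hyps by simp
qed auto

lemma integral_powers_bounded:
  assumes "integral_elem x"
  shows "\<exists>C\<ge>1. \<forall>j. nm (x ^ j) \<le> C"
proof -
  have x: "x \<in> A" using assms by (simp add: integral_elem_def)
  define C where "C = Max (insert 1 ((\<lambda>l. nm (x ^ l)) ` {..<d}))"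
  have C: "1 \<le> C" "\<And>l. l < d \<Longrightarrow> nm (x ^ l) \<le> C" by (auto simp: C_def)
  have "nm (x ^ j) \<le> C" for j
  proof -
    obtain c where c: "\<And>l. v (c l) \<le> 1" "x ^ j = (\<Sum>l<d. sc (c l) * x ^ l)"
      using integral_power_eq[OF assms] by blast
    show ?thesis unfolding c(2)
    proof (rule nm_sum_le)
      fix l assume l: "l \<in> {..<d}"
      show "sc (c l) * x ^ l \<in> A" using x by auto
      have "nm (sc (c l) * x ^ l) = v (c l) * nm (x ^ l)" using x by (intro nm_sc) auto
      also have "\<dots> \<le> 1 * C" using c(1) C l by (intro mult_mono) auto
      finally show "nm (sc (c l) * x ^ l) \<le> C" by simp
    qed (use C in simp)
  qed
  then show ?thesis using C by blast
qed

lemma integral_power: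
  assumes "integral_elem x"
  shows "integral_elem (x ^ n)"
proof -
  obtain C where "\<And>j. nm (x ^ j) \<le> C" using integral_powers_bounded[OF assms] by blast
  then show ?thesis
    using assms by (intro integral_if_powers_bounded[of _ C]) (auto simp: integral_elem_def simp flip: power_mult)
qed

section \<open>Orders over the valuation ring\<close>

text \<open>The module over the valuation ring that is generated by \<open>S\<close>.\<close>

inductive_set ospan :: "'r set \<Rightarrow> 'r set" for S where
  zero: "0 \<in> ospan S"
| step: "x \<in> ospan S \<Longrightarrow> s \<in> S \<Longrightarrow> v c \<le> 1 \<Longrightarrow> x + sc c * s \<in> ospan S"

text \<open>Such a ring may be unbounded; its divisible part, defined below, measures by how much.\<close>

definition is_order :: "'r set \<Rightarrow> bool" where
  "is_order R \<longleftrightarrow> R \<subseteq> A \<and> 1 \<in> R \<and> (\<forall>x\<in>R. \<forall>y\<in>R. x + y \<in> R \<and> x * y \<in> R) \<and>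
     (\<forall>c. \<forall>x\<in>R. v c \<le> 1 \<longrightarrow> sc c * x \<in> R)"

lemma orderD:
  assumes "is_order R"
  shows "x \<in> R \<Longrightarrow> x \<in> A" "1 \<in> R" "x \<in> R \<Longrightarrow> y \<in> R \<Longrightarrow> x + y \<in> R"
    "x \<in> R \<Longrightarrow> y \<in> R \<Longrightarrow> x * y \<in> R" "v c \<le> 1 \<Longrightarrow> x \<in> R \<Longrightarrow> sc c * x \<in> R"
    "x \<in> R \<Longrightarrow> - x \<in> R" "0 \<in> R" "x \<in> R \<Longrightarrow> y \<in> R \<Longrightarrow> x - y \<in> R"
    "x \<in> R \<Longrightarrow> x ^ n \<in> R" "v c \<le> 1 \<Longrightarrow> sc c \<in> R"
proof -
  note R = assms[unfolded is_order_def]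
  show a: "x \<in> R \<Longrightarrow> x \<in> A" and one: "1 \<in> R" and add: "\<And>x y. x \<in> R \<Longrightarrow> y \<in> R \<Longrightarrow> x + y \<in> R"
    and mult: "\<And>x y. x \<in> R \<Longrightarrow> y \<in> R \<Longrightarrow> x * y \<in> R"
    and sc: "\<And>c x. v c \<le> 1 \<Longrightarrow> x \<in> R \<Longrightarrow> sc c * x \<in> R"
    for x using R by auto
  show minus: "- x \<in> R" if "x \<in> R" for x using sc[of "-1" x] that by (simp add: sc_minus)
  show "x - y \<in> R" if "x \<in> R" "y \<in> R" for x y using add[of x "- y"] minus[of y] that by simp
  show "0 \<in> R" using sc[of 0 1] one by simp
  show "x ^ n \<in> R" if "x \<in> R" for x using that by (induction n) (auto intro: one mult)
  show "sc c \<in> R" if "v c \<le> 1" for c using sc[of c 1] that one by simp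
qed

lemma ospan_base: "s \<in> S \<Longrightarrow> s \<in> ospan S"
  using ospan.step[OF ospan.zero, of s S 1] by simp

lemma ospan_add: "x \<in> ospan S \<Longrightarrow> y \<in> ospan S \<Longrightarrow> x + y \<in> ospan S"
proof (rotate_tac, induction y rule: ospan.induct)
  case (step y s c)
  then have "(x + y) + sc c * s \<in> ospan S" by (intro ospan.step) auto
  then show ?case by (simp add: add.assoc)
qed simp

lemma ospan_sc: "x \<in> ospan S \<Longrightarrow> v c \<le> 1 \<Longrightarrow> sc c * x \<in> ospan S"
proof (induction x rule: ospan.induct)
  case (step x s a)
  then have "sc c * x + sc (c * a) * s \<in> ospan S"
    by (intro ospan.step) (auto simp: mult mult_le_one nonneg)
  then show ?case by (simp add: sc_mult distrib_left mult.assoc)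
qed (simp add: ospan.zero)

lemma ospan_mult:
  assumes "\<And>s t. s \<in> S \<Longrightarrow> t \<in> S \<Longrightarrow> s * t \<in> S" "x \<in> ospan S" "y \<in> ospan S"
  shows "x * y \<in> ospan S"
  using assms(3)
proof (induction y rule: ospan.induct)
  case (step y s c)
  have "x * s \<in> ospan S"
    using assms(2)
  proof (induction x rule: ospan.induct)
    case (step x t a)
    then have "x * s + sc a * (t * s) \<in> ospan S"
      using assms(1) \<open>s \<in> S\<close> by (intro ospan.step) auto
    then show ?case by (simp add: algebra_simps)
  qed (simp add: ospan.zero)
  then have "x * y + sc c * (x * s) \<in> ospan S"
    using step by (intro ospan_add ospan_sc) auto
  then show ?case by (simp add: distrib_left sc_left_commute)
qed (simp add: ospan.zero)

lemma ospan_in: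
  assumes "S \<subseteq> A" "x \<in> ospan S" shows "x \<in> A"
  using assms(2) by (induction x rule: ospan.induct) (use assms(1) in auto)

lemma order_ospan:
  assumes "S \<subseteq> A" "1 \<in> S" "\<And>s t. s \<in> S \<Longrightarrow> t \<in> S \<Longrightarrow> s * t \<in> S"
  shows "is_order (ospan S)"
  using assms ospan_in[OF assms(1)] ospan_mult[OF assms(3)]
  by (auto simp: is_order_def intro: ospan_base ospan_add ospan_sc)

lemma nm_ospan_le:
  assumes "S \<subseteq> A" "\<And>s. s \<in> S \<Longrightarrow> nm s \<le> C" "0 \<le> C" "x \<in> ospan S"
  shows "nm x \<le> C"
  using assms(4)
proof (induction x rule: ospan.induct)
  case (step x s c)
  have "nm (x + sc c * s) \<le> max (nm x) (nm (sc c * s))"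
    using step assms(1) ospan_in[OF assms(1)] by (intro nm_add) auto
  moreover have "nm (sc c * s) = v c * nm s" using step assms(1) by (intro nm_sc) auto
  moreover have "v c * nm s \<le> 1 * C" using step assms(2) by (intro mult_mono) auto
  ultimately show ?case using step by linarith
qed (use assms in simp)

text \<open>The multiples of elements of \<open>S\<close> by scalars of the valuation ring form a multiplicative set of integral
  elements, to whose sums \<open>amitsur\<close> applies.\<close>

lemma integral_ospan:
  assumes "\<And>s t. s \<in> S \<Longrightarrow> t \<in> S \<Longrightarrow> s * t \<in> S" "\<And>s. s \<in> S \<Longrightarrow> integral_elem s" "x \<in> ospan S"
  shows "integral_elem x"
proof -
  define M where "M = {sc c * s | c s. v c \<le> 1 \<and> s \<in> S}"
  have S: "S \<subseteq> A" using assms(2) by (auto simp: integral_elem_def)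
  have "\<exists>xs. set xs \<subseteq> M \<and> x = sum_list xs"
    using assms(3)
  proof (induction x rule: ospan.induct)
    case zero
    then show ?case by (intro exI[of _ "[]"]) simp
  next
    case (step x s c)
    then obtain xs where "set xs \<subseteq> M" "x = sum_list xs" by blast
    then show ?case using step by (intro exI[of _ "sc c * s # xs"]) (auto simp: M_def add.commute)
  qed
  then obtain xs where xs: "set xs \<subseteq> M" "x = sum_list xs" by blast
  have "v (chi x i) \<le> 1" for i
    unfolding xs(2)
  proof (rule amitsur[OF _ _ _ xs(1)])
    show "M \<subseteq> A" using S by (auto simp: M_def)
    show "y * z \<in> M" if yz: "y \<in> M" "z \<in> M" for y z
    proof -
      obtain a s b t where "y = sc a * s" "z = sc b * t" "v a \<le> 1" "v b \<le> 1" "s \<in> S" "t \<in> S"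
        using yz unfolding M_def by blast
      moreover have "sc a * s * (sc b * t) = sc (a * b) * (s * t)"
        by (metis mult.assoc sc_left_commute sc_mult)
      ultimately show ?thesis
        using assms(1) unfolding M_def mem_Collect_eq
        by (intro exI[of _ "a * b"] exI[of _ "s * t"]) (auto simp: mult mult_le_one nonneg)
    qed
    show "v (chi y i) \<le> 1" if "y \<in> M" for y i
    proof -
      obtain c s where y: "y = sc c * s" "v c \<le> 1" "s \<in> S" using \<open>y \<in> M\<close> unfolding M_def by blast
      then have "v (chi y i) = v c ^ i * v (chi s i)"
        using S by (auto simp: chi_scale mult v_power)
      also have "\<dots> \<le> 1"
        using y assms(2)[of s] by (intro mult_le_one power_le_one) (auto simp: nonneg integral_elem_def)
      finally show ?thesis .
    qed
  qed
  then show ?thesis using ospan_in[OF S assms(3)] by (simp add: integral_elem_def)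
qed

definition seq_closure :: "'r set \<Rightarrow> 'r set" where
  "seq_closure R = {x. \<exists>X. (\<forall>n. X n \<in> R) \<and> converges X x}"

lemma seq_closure_subset: "R \<subseteq> A \<Longrightarrow> R \<subseteq> seq_closure R"
proof
  fix x assume "R \<subseteq> A" "x \<in> R"
  then show "x \<in> seq_closure R"
    unfolding seq_closure_def by (auto intro!: exI[of _ "\<lambda>_. x"] converges_const)
qed

lemma seq_closure_in: "x \<in> seq_closure R \<Longrightarrow> x \<in> A"
  by (auto simp: seq_closure_def converges_def)

lemma seq_closure_closed:
  assumes "\<And>n. X n \<in> seq_closure R" "converges X x"
  shows "x \<in> seq_closure R"
proof -
  have "\<exists>y\<in>R. y \<in> A \<and> nm (y - X n) < 1 / Suc n" for n
  proof -
    obtain Y where "\<And>m. Y m \<in> R" "converges Y (X n)" using assms(1)[of n] by (auto simp: seq_closure_def)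
    then show ?thesis using converges_eventually_close[of Y "X n" "1 / Suc n"]
      by (auto simp: converges_def)
  qed
  then obtain Y where Y: "\<And>n. Y n \<in> R" "\<And>n. Y n \<in> A" "\<And>n. nm (Y n - X n) < 1 / Suc n" by metis
  have in': "X n \<in> A" "x \<in> A" for n using assms(2) by (auto simp: converges_def)
  have "converges Y x"
  proof (rule converges_nm_le)
    show "nm (Y n - x) \<le> 1 / Suc n + nm (X n - x)" for n
    proof -
      have eq: "Y n - x = (Y n - X n) + (X n - x)" by simp
      have "nm (Y n - x) \<le> max (nm (Y n - X n)) (nm (X n - x))"
        unfolding eq using in' Y by (intro nm_add) auto
      moreover have "0 \<le> nm (X n - x)" "0 \<le> 1 / real (Suc n)" by simp_all
      ultimately show ?thesis using Y(3)[of n] by linarith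
    qed
    have "(\<lambda>n. 1 / real (Suc n) + nm (X n - x)) \<longlonglongrightarrow> 0 + 0"
      using assms(2) by (intro tendsto_add LIMSEQ_Suc lim_1_over_n) (auto simp: converges_def)
    then show "(\<lambda>n. 1 / real (Suc n) + nm (X n - x)) \<longlonglongrightarrow> 0" by simp
  qed (use Y in' in auto)
  then show ?thesis using Y by (auto simp: seq_closure_def)
qed

lemma order_seq_closure:
  assumes "is_order R"
  shows "is_order (seq_closure R)"
  unfolding is_order_def
proof (intro conjI ballI allI impI)
  show "seq_closure R \<subseteq> A" using seq_closure_in by blast
  have "R \<subseteq> A" using orderD(1)[OF assms] by auto
  then show "1 \<in> seq_closure R" using seq_closure_subset[of R] orderD(2)[OF assms] by auto
  fix x assume "x \<in> seq_closure R"
  then obtain X where X: "\<And>n. X n \<in> R" "converges X x" by (auto simp: seq_closure_def)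
  show "sc c * x \<in> seq_closure R" if "v c \<le> 1" for c
    using converges_mult[OF converges_const[OF sc_in] X(2), of c] orderD(5)[OF assms \<open>v c \<le> 1\<close> X(1)]
    unfolding seq_closure_def by (intro CollectI exI[of _ "\<lambda>n. sc c * X n"] conjI allI)
  fix y assume "y \<in> seq_closure R"
  then obtain Y where Y: "\<And>n. Y n \<in> R" "converges Y y" by (auto simp: seq_closure_def)
  show "x + y \<in> seq_closure R"
    using converges_add[OF X(2) Y(2)] orderD(3)[OF assms X(1) Y(1)]
    unfolding seq_closure_def by (intro CollectI exI[of _ "\<lambda>n. X n + Y n"] conjI allI)
  show "x * y \<in> seq_closure R"
    using converges_mult[OF X(2) Y(2)] orderD(4)[OF assms X(1) Y(1)]
    unfolding seq_closure_def by (intro CollectI exI[of _ "\<lambda>n. X n * Y n"] conjI allI)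
qed

lemma integral_seq_closure:
  "(\<And>x. x \<in> R \<Longrightarrow> integral_elem x) \<Longrightarrow> x \<in> seq_closure R \<Longrightarrow> integral_elem x"
  by (auto simp: seq_closure_def intro: integral_limit)

end

context valued_algebra
begin

section \<open>The largest subspace of an order\<close>

definition divisible_part :: "'r set \<Rightarrow> 'r set" where
  "divisible_part R = {a \<in> R. \<forall>c. sc c * a \<in> R}"

lemma divisible_part_closed:
  assumes "is_order R"
  shows "a \<in> divisible_part R \<Longrightarrow> b \<in> divisible_part R \<Longrightarrow> a + b \<in> divisible_part R"
    and "a \<in> divisible_part R \<Longrightarrow> b \<in> R \<Longrightarrow> a * b \<in> divisible_part R"
    and "b \<in> R \<Longrightarrow> a \<in> divisible_part R \<Longrightarrow> b * a \<in> divisible_part R"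
    and "a \<in> divisible_part R \<Longrightarrow> sc c * a \<in> divisible_part R"
    and "0 \<in> divisible_part R"
proof -
  note R = orderD[OF assms]
  show "a \<in> divisible_part R \<Longrightarrow> b \<in> divisible_part R \<Longrightarrow> a + b \<in> divisible_part R"
    by (auto simp: divisible_part_def distrib_left intro: R)
  show "a \<in> divisible_part R \<Longrightarrow> b \<in> R \<Longrightarrow> a * b \<in> divisible_part R"
    by (auto simp: divisible_part_def mult.assoc[symmetric] intro: R)
  show "b \<in> R \<Longrightarrow> a \<in> divisible_part R \<Longrightarrow> b * a \<in> divisible_part R"
    by (auto simp: divisible_part_def sc_left_commute[symmetric] intro: R)
  show "a \<in> divisible_part R \<Longrightarrow> sc c * a \<in> divisible_part R"
    by (auto simp: divisible_part_def mult.assoc[symmetric] sc_mult[symmetric])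
  show "0 \<in> divisible_part R"
    by (auto simp: divisible_part_def R)
qed

text \<open>The coefficient \<open>chi a i\<close> gets multiplied by \<open>c ^ i\<close> when \<open>a\<close> is multiplied by \<open>c\<close>. It can
  stay bounded for all \<open>c\<close> only if it vanishes.\<close>

lemma nilpotent_if_multiples_integral:
  assumes "\<And>c. integral_elem (sc c * a)"
  shows "a ^ d = 0"
proof -
  have a: "a \<in> A" using assms[of 1] by (simp add: integral_elem_def)
  have 0: "chi a i = 0" if "0 < i" for i
  proof (rule ccontr)
    assume "chi a i \<noteq> 0"
    then have pos: "0 < v (chi a i)" by (rule v_pos)
    obtain c where c: "0 < v c" "v c < min 1 (v (chi a i))"
      using ex_smaller[of "min 1 (v (chi a i))"] pos by auto
    have "v (chi (sc (inverse c) * a) i) \<le> 1" using assms by (simp add: integral_elem_def)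
    then have "inverse (v c ^ i) * v (chi a i) \<le> 1"
      using a by (simp add: chi_scale mult v_power v_inverse power_inverse)
    then have "v (chi a i) \<le> v c ^ i" using c(1) by (simp add: field_simps)
    also have "\<dots> \<le> v c ^ 1" using c that by (intro power_decreasing) auto
    finally show False using c(2) by simp
  qed
  have "(\<Sum>i\<le>d. sc (chi a i) * a ^ (d - i)) = (\<Sum>i\<in>{0}. sc (chi a i) * a ^ (d - i))"
    using 0 by (intro sum.mono_neutral_right) auto
  then show ?thesis using cayley_hamilton[OF a] by (simp add: chi_0[OF a])
qed

text \<open>Suppose that a product of \<open>D\<close> elements of the nil algebra \<open>I\<close> does not vanish. The products \<open>V j\<close> of its last \<open>j\<close>
  factors, for \<open>j \<le> D\<close>, are linearly dependent. If \<open>V s\<close> is the first one with a non-zero coefficient, the relation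
  reads \<open>V s = b * V s\<close> with \<open>b \<in> I\<close>, because every later \<open>V j\<close> is a left multiple of \<open>V s\<close> by an element
  of \<open>I\<close>. As \<open>b\<close> is nilpotent, \<open>V s = 0\<close>, a contradiction.\<close>

lemma nil_algebra_nilpotent:
  assumes I: "I \<subseteq> A" "\<And>a b. a \<in> I \<Longrightarrow> b \<in> I \<Longrightarrow> a + b \<in> I" "\<And>a b. a \<in> I \<Longrightarrow> b \<in> I \<Longrightarrow> a * b \<in> I"
    "\<And>a c. a \<in> I \<Longrightarrow> sc c * a \<in> I" "0 \<in> I"
    and nil: "\<And>a. a \<in> I \<Longrightarrow> a ^ d = 0"
    and xs: "set xs \<subseteq> I" "length xs = D"
  shows "prod_list xs = 0"
proof (rule ccontr)
  assume P: "prod_list xs \<noteq> 0"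
  define V where "V j = prod_list (drop (D - j) xs)" for j
  have prod_in: "prod_list ys \<in> I" if "set ys \<subseteq> I" "ys \<noteq> []" for ys
    using that
  proof (induction ys)
    case (Cons y ys)
    then show ?case by (cases "ys = []") (auto intro: I(3))
  qed simp
  have prod_A: "prod_list ys \<in> A" if "set ys \<subseteq> I" for ys
    using prod_in[OF that] I(1) by (cases "ys = []") auto
  have factor: "V j = prod_list (take (j - s) (drop (D - j) xs)) * V s" if "s \<le> j" "j \<le> D" for s j
  proof -
    have "drop (D - j) xs = take (j - s) (drop (D - j) xs) @ drop (j - s) (drop (D - j) xs)"
      by (rule append_take_drop_id[symmetric])
    moreover have "drop (j - s) (drop (D - j) xs) = drop (D - s) xs"
      using that by simp
    ultimately show ?thesis unfolding V_def by (metis prod_list.append)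
  qed
  have V0: "V s \<noteq> 0" if "s \<le> D" for s
    using factor[of s D] that P xs by (auto simp: V_def)
  have "V j \<in> A" for j
    unfolding V_def using xs by (intro prod_A) (auto dest: in_set_dropD)
  then obtain c where c: "\<exists>i\<le>D. c i \<noteq> 0" "(\<Sum>i\<le>D. sc (c i) * V i) = 0"
    using dependent[of V] by blast
  define s where "s = (LEAST i. i \<le> D \<and> c i \<noteq> 0)"
  have s: "s \<le> D" "c s \<noteq> 0" using LeastI_ex[OF c(1)] by (auto simp: s_def)
  have less_s: "c i = 0" if "i < s" for i
    using not_less_Least[of i "\<lambda>i. i \<le> D \<and> c i \<noteq> 0"] that s(1) unfolding s_def[symmetric] by auto
  define a where "a = (\<Sum>i\<in>{s<..D}. sc (c i) * prod_list (take (i - s) (drop (D - i) xs)))"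
  have sumI: "sum f J \<in> I" if "\<And>i. i \<in> J \<Longrightarrow> f i \<in> I" for f and J :: "nat set"
    using that by (induction J rule: infinite_finite_induct) (auto intro: I)
  have aI: "a \<in> I"
    unfolding a_def
  proof (intro sumI I(4) prod_in)
    fix i assume i: "i \<in> {s<..D}"
    show "set (take (i - s) (drop (D - i) xs)) \<subseteq> I"
      using xs by (auto dest!: in_set_takeD in_set_dropD)
    show "take (i - s) (drop (D - i) xs) \<noteq> []" using i xs by auto
  qed
  have "(\<Sum>i\<le>D. sc (c i) * V i) = (\<Sum>i\<in>{s..D}. sc (c i) * V i)"
  proof (rule sum.mono_neutral_right)
    show "\<forall>i\<in>{..D} - {s..D}. sc (c i) * V i = 0"
      using less_s by auto
  qed auto
  also have "{s..D} = insert s {s<..D}" using s(1) by auto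
  also have "(\<Sum>i\<in>insert s {s<..D}. sc (c i) * V i) = sc (c s) * V s + (\<Sum>i\<in>{s<..D}. sc (c i) * V i)"
    by simp
  also have "(\<Sum>i\<in>{s<..D}. sc (c i) * V i) = a * V s"
    unfolding a_def sum_distrib_right
  proof (intro sum.cong refl)
    fix i assume "i \<in> {s<..D}"
    then have "V i = prod_list (take (i - s) (drop (D - i) xs)) * V s" by (intro factor) auto
    then show "sc (c i) * V i = sc (c i) * prod_list (take (i - s) (drop (D - i) xs)) * V s"
      by (metis mult.assoc)
  qed
  finally have eq: "sc (c s) * V s = - (a * V s)" using c(2) by (simp add: eq_neg_iff_add_eq_0)
  define b where "b = sc (- inverse (c s)) * a"
  have "V s = sc (inverse (c s)) * (sc (c s) * V s)"
    using s(2) by (simp add: mult.assoc[symmetric] sc_mult[symmetric])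
  also have "\<dots> = b * V s" unfolding eq b_def by (simp add: sc_minus mult.assoc)
  finally have "V s = b * V s" .
  then have "V s = b ^ n * V s" for n
    by (induction n) (simp_all add: mult.assoc)
  moreover have "b ^ d = 0" unfolding b_def using aI by (intro nil I(4))
  ultimately have "V s = 0" by (metis mult_zero_left)
  then show False using V0 s(1) by blast
qed

text \<open>If elements \<open>r n\<close> of \<open>R\<close> had distances to the divisible part that tend to infinity, then scaling almost
  shortest representatives to norm \<open>1\<close> would yield a convergent subsequence. All scalar multiples of
  its limit \<open>l\<close> are limits of elements of \<open>R\<close>, so \<open>l\<close> lies in the divisible part, and correcting the
  representatives by multiples of \<open>l\<close> makes them shorter than was possible.\<close>

lemma bounded_modulo_divisible_part:
  assumes R: "is_order R" and closed: "\<And>X x. (\<And>n. X n \<in> R) \<Longrightarrow> converges X x \<Longrightarrow> x \<in> R"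
  shows "\<exists>C\<ge>1. \<forall>r\<in>R. \<exists>i\<in>divisible_part R. nm (r - i) \<le> C"
proof (rule ccontr)
  let ?I = "divisible_part R"
  note RD = orderD[OF R]
  have I_in: "i \<in> R" "i \<in> A" if "i \<in> ?I" for i using that RD(1) by (auto simp: divisible_part_def)
  assume "\<not> ?thesis"
  then have "\<exists>r\<in>R. \<forall>i\<in>?I. real (Suc n) < nm (r - i)" for n
    by (metis not_le of_nat_1 of_nat_le_iff Suc_le_mono One_nat_def le0)
  then obtain r where r: "\<And>n. r n \<in> R" "\<And>n i. i \<in> ?I \<Longrightarrow> real (Suc n) < nm (r n - i)" by metis
  \<comment> \<open>The factor \<open>2\<close> replaces a shortest representative, whose existence is not known.\<close>
  have "\<exists>i\<in>?I. \<forall>j\<in>?I. nm (r n - i) < 2 * nm (r n - j)" for n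
  proof -
    let ?S = "(\<lambda>i. nm (r n - i)) ` ?I"
    have ne: "?S \<noteq> {}" using divisible_part_closed(5)[OF R] by auto
    have bdd: "bdd_below ?S" by (rule bdd_belowI[of _ 0]) auto
    have "real (Suc n) \<le> Inf ?S" using ne r(2) by (intro cInf_greatest) (auto intro: less_imp_le)
    then have pos: "0 < Inf ?S" using of_nat_0_less_iff[of "Suc n"] by (metis less_le_trans zero_less_Suc)
    then have "Inf ?S < 2 * Inf ?S" by simp
    then obtain i where i: "i \<in> ?I" "nm (r n - i) < 2 * Inf ?S"
      using cInf_less_iff[OF ne bdd] by auto
    have "Inf ?S \<le> nm (r n - j)" if "j \<in> ?I" for j using that bdd by (intro cInf_lower) auto
    then show ?thesis using i by (smt (verit))
  qed
  then obtain i where i: "\<And>n. i n \<in> ?I" "\<And>n j. j \<in> ?I \<Longrightarrow> nm (r n - i n) < 2 * nm (r n - j)" by metis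
  have rA: "r n - i n \<in> A" for n using r(1) i(1) I_in RD(1) by auto
  have "\<exists>c. v c = nm (r n - i n)" for n using nm_value[OF rA] .
  then obtain c where c: "\<And>n. v (c n) = nm (r n - i n)" by metis
  have c_ge: "real (Suc n) < v (c n)" for n using r(2)[OF i(1)] c by simp
  have c0: "c n \<noteq> 0" for n using c_ge[of n] v_0 by (metis less_asym of_nat_0_less_iff zero_less_Suc)
  define z where "z n = sc (inverse (c n)) * (r n - i n)" for n
  have zA: "z n \<in> A" for n using rA by (auto simp: z_def)
  have "nm (z n) = inverse (v (c n)) * v (c n)" for n
    unfolding z_def using nm_sc[OF rA] c by (simp add: v_inverse)
  then have "nm (z n) = 1" for n using c0 by (simp add: eq_0_iff)
  then obtain l s where l: "l \<in> A" "strict_mono (s :: nat \<Rightarrow> nat)" "(\<lambda>n. nm (z (s n) - l)) \<longlonglongrightarrow> 0"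
    using bounded_subsequence[of z 1] zA by auto
  have conv: "converges (\<lambda>n. z (s n)) l" using l zA by (simp add: converges_def)
  have in_R: "sc b * l \<in> R" for b
  proof -
    obtain N where N: "v b \<le> real N" using real_arch_simple by blast
    have "sc b * z (s (n + N)) \<in> R" for n
    proof -
      have "n + N \<le> s (n + N)" using l(2) by (rule seq_suble)
      then have "v b \<le> v (c (s (n + N)))" using c_ge[of "s (n + N)"] N by linarith
      then have "v (b * inverse (c (s (n + N)))) \<le> 1"
        using v_pos[OF c0] by (simp add: v_divide flip: divide_inverse)
      then have "sc (b * inverse (c (s (n + N)))) * (r (s (n + N)) - i (s (n + N))) \<in> R"
        using r(1) i(1) I_in by (intro RD(5) RD(8)) auto
      then show ?thesis by (simp add: z_def sc_mult mult.assoc)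
    qed
    moreover have "converges (\<lambda>n. sc b * z (s (n + N))) (sc b * l)"
    proof (intro converges_mult converges_const)
      show "converges (\<lambda>n. z (s (n + N))) l"
        using conv LIMSEQ_ignore_initial_segment[of _ 0 N] by (auto simp: converges_def)
    qed auto
    ultimately show ?thesis by (rule closed)
  qed
  from in_R[of 1] in_R have lI: "l \<in> ?I" by (auto simp: divisible_part_def)
  obtain n where n: "nm (z (s n) - l) < 1 / 2" using converges_eventually_close[OF conv, of "1 / 2"] by auto
  let ?n = "s n"
  have "r ?n - (i ?n + sc (c ?n) * l) = sc (c ?n) * (z ?n - l)"
    unfolding z_def right_diff_distrib mult.assoc[symmetric] sc_mult[symmetric]
    using c0 by simp
  then have "nm (r ?n - (i ?n + sc (c ?n) * l)) = v (c ?n) * nm (z ?n - l)"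
    using nm_sc[of "z ?n - l" "c ?n"] zA l(1) by auto
  moreover have "i ?n + sc (c ?n) * l \<in> ?I"
    using i(1) lI by (intro divisible_part_closed[OF R])
  ultimately have "v (c ?n) < 2 * (v (c ?n) * nm (z ?n - l))" using i(2)[of "i ?n + sc (c ?n) * l" ?n] c by simp
  moreover have "v (c ?n) * nm (z ?n - l) \<le> v (c ?n) * (1 / 2)"
    using n nonneg by (intro mult_left_mono) auto
  ultimately show False by simp
qed

section \<open>Growth of powers along a flag\<close>

text \<open>The elements killed by all products of \<open>s\<close> elements of \<open>I\<close>. For nilpotent \<open>I\<close> this is a finite flag in \<open>A\<close>
  that \<open>I\<close> moves strictly downwards.\<close>

primrec flag :: "'r set \<Rightarrow> nat \<Rightarrow> 'r set" where
  "flag I 0 = {0}"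
| "flag I (Suc s) = {Z \<in> A. \<forall>a\<in>I. a * Z \<in> flag I s}"

lemma flag_in: "Z \<in> flag I s \<Longrightarrow> Z \<in> A"
  by (cases s) auto

lemma flag_top:
  assumes "I \<subseteq> A" "Z \<in> A" "\<And>xs. set xs \<subseteq> I \<Longrightarrow> length xs = s \<Longrightarrow> prod_list xs * Z = 0"
  shows "Z \<in> flag I s"
  using assms(2,3)
proof (induction s arbitrary: Z)
  case 0
  then show ?case using "0.prems"(2)[of "[]"] by simp
next
  case (Suc s)
  have "a * Z \<in> flag I s" if a: "a \<in> I" for a
  proof (rule Suc.IH)
    show "a * Z \<in> A" using a Suc.prems assms(1) by auto
    fix xs assume "set xs \<subseteq> I" "length xs = s"
    then show "prod_list xs * (a * Z) = 0"
      using Suc.prems(2)[of "xs @ [a]"] a by (simp add: mult.assoc)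
  qed
  then show ?case using Suc.prems by simp
qed

lemma flag_add:
  "Y \<in> flag I s \<Longrightarrow> Z \<in> flag I s \<Longrightarrow> Y + Z \<in> flag I s"
  by (induction s arbitrary: Y Z) (auto simp: distrib_left)

lemma flag_mono: "I \<subseteq> A \<Longrightarrow> Z \<in> flag I s \<Longrightarrow> Z \<in> flag I (Suc s)"
proof (induction s arbitrary: Z)
  case (Suc s)
  then show ?case using flag_in by auto
qed auto

lemma flag_ideal: "I \<subseteq> A \<Longrightarrow> a \<in> I \<Longrightarrow> Z \<in> flag I s \<Longrightarrow> a * Z \<in> flag I s"
  using flag_mono[of I Z s] by simp

lemma flag_invariant:
  assumes "g \<in> A" "\<And>a. a \<in> I \<Longrightarrow> \<exists>b\<in>I. a * g = g * b" "Z \<in> flag I s"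
  shows "g * Z \<in> flag I s"
  using assms(3)
proof (induction s arbitrary: Z)
  case (Suc s)
  have "a * (g * Z) \<in> flag I s" if a: "a \<in> I" for a
  proof -
    obtain b where b: "b \<in> I" "a * g = g * b" using assms(2)[OF a] by blast
    then have "a * (g * Z) = g * (b * Z)" by (metis mult.assoc)
    then show ?thesis using Suc b by simp
  qed
  then show ?case using Suc.prems assms(1) by auto
qed simp

text \<open>If \<open>b\<close> preserves the flag and \<open>j\<close> lowers it, the powers of \<open>b + j\<close> grow at most like those of \<open>\<beta> \<ge> nm b\<close> up to a
  constant factor, however large \<open>j\<close> is: in the expansion of \<open>(b + j) ^ m * Z\<close> a
  non-zero term contains the factor \<open>j\<close> fewer than \<open>s\<close> times.\<close>

lemma flag_growth:
  assumes b: "b \<in> A" "nm b \<le> \<beta>" "\<And>s Z. Z \<in> flag I s \<Longrightarrow> b * Z \<in> flag I s"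
    and j: "j \<in> A" "\<And>s Z. Z \<in> flag I (Suc s) \<Longrightarrow> j * Z \<in> flag I s" and \<beta>: "0 < \<beta>"
  shows "\<exists>c>0. \<forall>Z\<in>flag I s. \<forall>m. nm ((b + j) ^ m * Z) \<le> c * \<beta> ^ m * nm Z"
proof (induction s)
  case 0
  then show ?case by (intro exI[of _ 1]) auto
next
  case (Suc s)
  then obtain c where c: "0 < c" "\<And>Z m. Z \<in> flag I s \<Longrightarrow> nm ((b + j) ^ m * Z) \<le> c * \<beta> ^ m * nm Z" by blast
  define c' where "c' = max 1 (c * nm j / \<beta>)"
  have c': "1 \<le> c'" "c * nm j \<le> c' * \<beta>"
  proof -
    show "1 \<le> c'" by (simp add: c'_def)
    have "c * nm j / \<beta> \<le> c'" by (simp add: c'_def)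
    then show "c * nm j \<le> c' * \<beta>" using \<beta> by (simp add: field_simps)
  qed
  have "nm ((b + j) ^ m * Z) \<le> c' * \<beta> ^ m * nm Z" if "Z \<in> flag I (Suc s)" for m Z
    using that
  proof (induction m arbitrary: Z)
    case 0
    have "1 * nm Z \<le> c' * nm Z" using c'(1) by (intro mult_right_mono) auto
    then show ?case by simp
  next
    case (Suc m)
    let ?y = "b + j"
    have Z: "Z \<in> A" using Suc.prems by (rule flag_in)
    have y: "?y ^ m \<in> A" using b j by auto
    have "nm (?y ^ m * (b * Z)) \<le> c' * \<beta> ^ m * nm (b * Z)" using b(3)[OF Suc.prems] by (rule Suc.IH)
    also have "\<dots> \<le> c' * \<beta> ^ m * (\<beta> * nm Z)"
    proof (intro mult_left_mono)
      have "nm (b * Z) \<le> nm b * nm Z" using b Z by (intro nm_mult)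
      also have "\<dots> \<le> \<beta> * nm Z" using b by (intro mult_right_mono) auto
      finally show "nm (b * Z) \<le> \<beta> * nm Z" .
    qed (use c' \<beta> in auto)
    finally have 1: "nm (?y ^ m * (b * Z)) \<le> c' * \<beta> ^ Suc m * nm Z" by (simp add: mult_ac)
    have "nm (?y ^ m * (j * Z)) \<le> c * \<beta> ^ m * nm (j * Z)" using j(2)[OF Suc.prems] by (rule c(2))
    also have "\<dots> \<le> c * \<beta> ^ m * (nm j * nm Z)"
      using c \<beta> j Z by (intro mult_left_mono nm_mult) auto
    also have "\<dots> = (c * nm j) * (\<beta> ^ m * nm Z)" by simp
    also have "\<dots> \<le> (c' * \<beta>) * (\<beta> ^ m * nm Z)"
      using c'(2) \<beta> by (intro mult_right_mono) auto
    finally have 2: "nm (?y ^ m * (j * Z)) \<le> c' * \<beta> ^ Suc m * nm Z" by (simp add: mult_ac)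
    have eq: "?y ^ Suc m * Z = ?y ^ m * (b * Z) + ?y ^ m * (j * Z)"
      by (simp add: power_Suc2 mult.assoc distrib_right distrib_left del: power_Suc)
    have "nm (?y ^ Suc m * Z) \<le> max (nm (?y ^ m * (b * Z))) (nm (?y ^ m * (j * Z)))"
      unfolding eq using y b j Z by (intro nm_add) auto
    then show ?case using 1 2 by linarith
  qed
  then show ?case using c'(1) by (intro exI[of _ c']) auto
qed

section \<open>Congruences modulo powers of the uniformizer\<close>

definition congr :: "'r set \<Rightarrow> 'f \<Rightarrow> 'r \<Rightarrow> 'r \<Rightarrow> bool" where
  "congr R c x y \<longleftrightarrow> (\<exists>r\<in>R. x - y = sc c * r)"

lemma congr_refl: "is_order R \<Longrightarrow> congr R c x x"
  unfolding congr_def using orderD(7)[of R] by force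

lemma congr_trans: "is_order R \<Longrightarrow> congr R c x y \<Longrightarrow> congr R c y z \<Longrightarrow> congr R c x z"
  unfolding congr_def using orderD(3)[of R]
  by (metis diff_add_cancel add_diff_eq distrib_left add.commute add_diff_cancel_right')

lemma congr_mult:
  assumes R: "is_order R" and "x \<in> R" "y \<in> R" "x' \<in> R" "y' \<in> R" "congr R c x x'" "congr R c y y'"
  shows "congr R c (x * y) (x' * y')"
proof -
  obtain r s where rs: "r \<in> R" "s \<in> R" "x - x' = sc c * r" "y - y' = sc c * s"
    using assms by (auto simp: congr_def)
  have "x * y - x' * y' = (x - x') * y + x' * (y - y')" by (simp add: algebra_simps)
  also have "\<dots> = sc c * (r * y + x' * s)"
    unfolding rs by (simp add: distrib_left mult.assoc sc_left_commute)
  finally show ?thesis unfolding congr_def using assms rs orderD(3,4)[OF R] by auto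
qed

lemma congr_power:
  assumes R: "is_order R" and "x \<in> R" "y \<in> R" "congr R c x y"
  shows "congr R c (x ^ n) (y ^ n)"
  by (induction n) (use assms in \<open>auto intro: congr_refl congr_mult orderD(9)[OF R]\<close>)

lemma congr_1_power:
  assumes "is_order R" "x \<in> R" "congr R c x 1"
  shows "congr R c (x ^ n) 1"
  using congr_power[OF assms(1,2) orderD(2)[OF assms(1)] assms(3), of n] by simp

lemma congr_limit:
  assumes "\<And>n. congr R c (X n) y" "converges X x" "c \<noteq> 0" "y \<in> A" "R \<subseteq> A"
    and closed: "\<And>X x. (\<And>n. X n \<in> R) \<Longrightarrow> converges X x \<Longrightarrow> x \<in> R"
  shows "congr R c x y"
proof -
  have unit: "sc (inverse c) * (sc c * z) = z" "sc c * (sc (inverse c) * z) = z" for z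
    using assms(3) by (simp_all add: mult.assoc[symmetric] sc_mult[symmetric])
  have "sc (inverse c) * (X n - y) \<in> R" for n
    using assms(1)[of n] unit by (auto simp: congr_def)
  moreover have "converges (\<lambda>n. sc (inverse c) * (X n - y)) (sc (inverse c) * (x - y))"
    using assms(2,4) by (intro converges_mult converges_const converges_diff) auto
  ultimately have "sc (inverse c) * (x - y) \<in> R" by (rule closed)
  then show ?thesis unfolding congr_def using unit by metis
qed

text \<open>With \<open>z = x ^ p ^ a - 1\<close> one has \<open>(1 + z) ^ p - 1 = z * (p + z * w)\<close>, and \<open>p\<close> as well as \<open>z\<close> is divisible by \<open>\<pi>\<close>.\<close>

lemma congr_prime_power:
  assumes R: "is_order R" and p: "v (of_nat p) \<le> v \<pi>" and \<pi>: "0 < v \<pi>" "v \<pi> < 1"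
    and x: "x \<in> R" "congr R \<pi> x 1"
  shows "congr R (\<pi> ^ Suc a) (x ^ (p ^ a)) 1"
proof (induction a)
  case (Suc a)
  note RD = orderD[OF R]
  have \<pi>0: "\<pi> \<noteq> 0" using \<pi> by auto
  let ?x = "x ^ (p ^ a)"
  have xR: "?x \<in> R" using x RD by auto
  obtain r where r: "r \<in> R" "?x - 1 = sc (\<pi> ^ Suc a) * r" using Suc by (auto simp: congr_def)
  have "v (\<pi> ^ a) \<le> 1" using \<pi> by (simp add: v_power power_le_one nonneg)
  then have r': "sc (\<pi> ^ a) * r \<in> R" (is "?r \<in> R") using r by (intro RD)
  then have z: "?x - 1 = sc \<pi> * ?r" using r by (simp add: sc_mult mult.assoc)
  have "\<exists>w\<in>R. \<exists>t\<in>R. ?x ^ n = 1 + (?x - 1) * t \<and> t = of_nat n + sc \<pi> * w" for n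
  proof (induction n)
    case 0
    then show ?case using RD(7) by (intro bexI[of _ 0]) auto
  next
    case (Suc n)
    then obtain w t where wt: "w \<in> R" "t \<in> R" "?x ^ n = 1 + (?x - 1) * t" "t = of_nat n + sc \<pi> * w" by blast
    have "?x ^ Suc n = ?x ^ n + (?x - 1) * ?x ^ n" by (simp add: algebra_simps)
    also have "\<dots> = 1 + (?x - 1) * t + (?x - 1) * ?x ^ n" using wt(3) by simp
    also have "\<dots> = 1 + (?x - 1) * (t + ?x ^ n)" by (simp add: distrib_left add.assoc)
    finally have 1: "?x ^ Suc n = 1 + (?x - 1) * (t + ?x ^ n)" .
    have "t + ?x ^ n = of_nat (Suc n) + sc \<pi> * (w + ?r * t)"
      unfolding wt(3) z using wt(4) by (simp add: distrib_left mult.assoc)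
    moreover have "w + ?r * t \<in> R" by (rule RD(3)[OF wt(1) RD(4)[OF r' wt(2)]])
    moreover have "t + ?x ^ n \<in> R" by (rule RD(3)[OF wt(2) RD(9)[OF xR]])
    ultimately show ?case using 1 by blast
  qed
  then obtain w t where wt: "w \<in> R" "?x ^ p = 1 + (?x - 1) * t" "t = of_nat p + sc \<pi> * w" by blast
  have "v (of_nat p / \<pi>) \<le> 1" using p \<pi> by (simp add: v_divide)
  then have pR: "sc (of_nat p / \<pi>) \<in> R" by (rule RD)
  have "sc (of_nat p) = sc \<pi> * sc (of_nat p / \<pi>)" using \<pi>0 by (simp flip: sc_mult)
  then have t: "t = sc \<pi> * (sc (of_nat p / \<pi>) + w)" using wt(3) by (simp add: sc_of_nat distrib_left)
  have "?x ^ p - 1 = sc (\<pi> ^ Suc a) * r * t" using wt(2) r(2) by simp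
  also have "\<dots> = sc (\<pi> ^ Suc (Suc a)) * (r * (sc (of_nat p / \<pi>) + w))"
  proof -
    have "sc (\<pi> ^ Suc a) * r * (sc \<pi> * u) = sc (\<pi> ^ Suc a) * (sc \<pi> * (r * u))" for u
      by (simp only: mult.assoc sc_left_commute[of r])
    moreover have "sc (\<pi> ^ Suc (Suc a)) = sc (\<pi> ^ Suc a) * sc \<pi>"
      by (simp only: power_Suc2[of \<pi> "Suc a"] sc_mult)
    ultimately show ?thesis unfolding t by (simp only: mult.assoc)
  qed
  finally show ?case
    unfolding congr_def power_Suc2[of p] power_mult
    using pR wt(1) r(1) RD(3,4) by auto
qed (use x in simp)

end

section \<open>Groups with dense power maps\<close>

text \<open>One removes common factors with \<open>k\<close> from \<open>e\<close> as long as there are any.\<close>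

lemma coprime_part_exponent:
  fixes e k :: nat
  assumes "0 < e"
  shows "\<exists>e' m. coprime e' k \<and> 0 < e' \<and> e dvd k ^ m * e'"
  using assms
proof (induction e rule: less_induct)
  case (less e)
  show ?case
  proof (cases "coprime e k")
    case True
    then show ?thesis using less.prems by (intro exI[of _ e] exI[of _ 0]) auto
  next
    case False
    define g where "g = gcd e k"
    have g: "g \<noteq> 1" "g dvd e" "g dvd k"
      using False unfolding g_def coprime_iff_gcd_eq_1 by (blast intro: gcd_dvd1 gcd_dvd2)+
    then obtain f where f: "e = g * f" by blast
    have "0 < g" "0 < f" using less.prems by (auto simp: f)
    moreover from this have "1 * f < g * f" using g(1) by (intro mult_strict_right_mono) auto
    ultimately have "f < e" "0 < f" by (simp_all add: f)
    then obtain e' m where *: "coprime e' k" "0 < e'" "f dvd k ^ m * e'"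
      using less.IH \<open>0 < f\<close> by blast
    have "g * f dvd k * (k ^ m * e')" using * g by (intro mult_dvd_mono) auto
    then have "e dvd k ^ Suc m * e'" by (simp add: f mult.assoc)
    then show ?thesis using * by blast
  qed
qed

text \<open>If \<open>p = 0\<close>, then \<open>x ^ p - 1\<close> is divisible by the square of \<open>z = x - 1\<close>, so that its
  nilpotency index is smaller than that of \<open>z\<close> unless \<open>z = 0\<close>.\<close>

lemma unipotent_torsion:
  fixes x :: "'a::ring_1"
  assumes "of_nat p = (0::'a)" "(x - 1) ^ m = 0"
  shows "x ^ p ^ m = 1"
  using assms(2)
proof (induction m arbitrary: x)
  case 0
  then have "(1::'a) = 0" by simp
  then show ?case by (metis mult_1 mult_zero_left)
next
  case (Suc m)
  define z where "z = x - 1"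
  have "\<exists>w. w * z = z * w \<and> x ^ n = 1 + of_nat n * z + z * z * w" for n
  proof (induction n)
    case 0
    then show ?case by (intro exI[of _ 0]) simp
  next
    case (Suc n)
    then obtain w where w: "w * z = z * w" "x ^ n = 1 + of_nat n * z + z * z * w" by blast
    have comm: "of_nat n * z = z * of_nat n" "z * of_nat n * z = z * z * of_nat n"
      by (metis mult_of_nat_commute) (metis mult_of_nat_commute mult.assoc)
    have "x ^ Suc n = x ^ n * (1 + z)" by (simp add: power_commutes z_def)
    also have "\<dots> = 1 + of_nat (Suc n) * z + (z * of_nat n * z + z * z * w + z * z * (w * z))"
      unfolding w(2) by (simp add: distrib_left distrib_right mult.assoc comm add_ac)
    also have "\<dots> = 1 + of_nat (Suc n) * z + z * z * (of_nat n + w + w * z)"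
      unfolding comm by (simp add: distrib_left mult.assoc)
    finally have "x ^ Suc n = 1 + of_nat (Suc n) * z + z * z * (of_nat n + w + w * z)" .
    moreover have "(of_nat n + w + w * z) * z = z * (of_nat n + w + w * z)"
      using w(1) comm(1) by (simp add: distrib_left distrib_right mult.assoc)
    ultimately show ?case by blast
  qed
  then obtain w where w: "w * z = z * w" "x ^ p = 1 + of_nat p * z + z * z * w" by blast
  have powers: "(z * z * w) ^ j = z ^ (2 * j) * w ^ j" for j
  proof (induction j)
    case (Suc j)
    have "w ^ j * z = z * w ^ j" using w(1) by (rule power_commuting_commutes)
    then have comm: "w ^ j * (z * z) = z * z * w ^ j" by (metis mult.assoc)
    have "(z * z * w) ^ Suc j = z ^ (2 * j) * (w ^ j * (z * z)) * w"
      unfolding power_Suc2 Suc.IH by (simp only: mult.assoc)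
    also have "\<dots> = z ^ (2 * Suc j) * w ^ Suc j"
      unfolding comm by (simp add: power_Suc2 mult.assoc del: power_Suc)
    finally show ?case .
  qed simp
  show ?case
  proof (cases "m = 0")
    case True
    then show ?thesis using Suc.prems by simp
  next
    case False
    then have "2 * m = Suc m + (m - 1)" by simp
    then have "z ^ (2 * m) = z ^ Suc m * z ^ (m - 1)" by (metis power_add)
    then have "(x ^ p - 1) ^ m = 0"
      using Suc.prems w(2) assms(1) powers[of m] by (simp add: z_def[symmetric])
    then show ?thesis using Suc.IH by (simp add: power_mult)
  qed
qed

lemma power_mult_normal:
  fixes x :: "'a::monoid_mult"
  assumes "\<And>h. h \<in> H \<Longrightarrow> \<exists>h'\<in>H. h * x = x * h'"
    and "1 \<in> H" "\<And>y z. y \<in> H \<Longrightarrow> z \<in> H \<Longrightarrow> y * z \<in> H" and "h \<in> H"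
  shows "\<exists>h'\<in>H. (x * h) ^ n = x ^ n * h'"
proof (induction n)
  case 0
  then show ?case using assms(2) by auto
next
  case (Suc n)
  then obtain h' where h': "h' \<in> H" "(x * h) ^ n = x ^ n * h'" by blast
  obtain h'' where h'': "h'' \<in> H" "h' * x = x * h''" using assms(1)[OF h'(1)] by blast
  have "(x * h) ^ Suc n = x ^ n * (h' * x) * h"
    using h'(2) by (simp add: power_Suc2 mult.assoc del: power_Suc)
  also have "\<dots> = x ^ Suc n * (h'' * h)"
    unfolding h''(2) by (simp add: power_Suc2 mult.assoc del: power_Suc)
  finally show ?case using assms(3)[OF h''(1) assms(4)] by blast
qed

context valued_algebra
begin

text \<open>Write \<open>g\<close> as a limit of elements \<open>x ^ k ^ m * y\<close> with \<open>y \<in> H\<close>, approximate \<open>x\<close> by \<open>z ^ k * w\<close> with \<open>w \<in> H\<close>, and collect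
  the factors from \<open>H\<close> on the right.\<close>

lemma dense_powers_iterate:
  assumes G: "G \<subseteq> A" "\<And>x y. x \<in> G \<Longrightarrow> y \<in> G \<Longrightarrow> x * y \<in> G" "1 \<in> G"
    and H: "H \<subseteq> G" "1 \<in> H" "\<And>x y. x \<in> H \<Longrightarrow> y \<in> H \<Longrightarrow> x * y \<in> H"
    and normal: "\<And>x h. x \<in> G \<Longrightarrow> h \<in> H \<Longrightarrow> \<exists>h'\<in>H. h * x = x * h'"
    and dense: "\<And>g. g \<in> G \<Longrightarrow> \<exists>X Y. (\<forall>n. X n \<in> G \<and> Y n \<in> H) \<and> converges (\<lambda>n. X n ^ k * Y n) g"
    and g: "g \<in> G"
  shows "\<exists>X Y. (\<forall>n. X n \<in> G \<and> Y n \<in> H) \<and> converges (\<lambda>n. X n ^ k ^ m * Y n) g"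
  using g
proof (induction m arbitrary: g)
  case 0
  then show ?case using converges_const[of g] G(1) H(2)
    by (intro exI[of _ "\<lambda>_. g"] exI[of _ "\<lambda>_. 1"]) auto
next
  case (Suc m)
  have pow: "\<exists>h'\<in>H. (x * h) ^ n = x ^ n * h'" if "x \<in> G" "h \<in> H" for x h n
    by (rule power_mult_normal[OF normal[OF that(1)] H(2,3) that(2)])
  define S where "S = {x ^ k ^ Suc m * h | x h. x \<in> G \<and> h \<in> H}"
  obtain X Y where XY: "\<And>n. X n \<in> G" "\<And>n. Y n \<in> H" "converges (\<lambda>n. X n ^ k ^ m * Y n) g"
    using Suc.IH[OF Suc.prems] by blast
  have "X n ^ k ^ m * Y n \<in> seq_closure S" for n
  proof -
    obtain Z W where ZW: "\<And>j. Z j \<in> G" "\<And>j. W j \<in> H" "converges (\<lambda>j. Z j ^ k * W j) (X n)"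
      using dense[OF XY(1)[of n]] by blast
    have ZG: "Z j ^ i \<in> G" for i j using ZW(1) G(2,3) by (induction i) auto
    have "(Z j ^ k * W j) ^ k ^ m * Y n \<in> S" for j
    proof -
      obtain h where h: "h \<in> H" "(Z j ^ k * W j) ^ k ^ m = (Z j ^ k) ^ k ^ m * h"
        using pow[OF ZG[of j k] ZW(2)] by blast
      then have "(Z j ^ k * W j) ^ k ^ m * Y n = Z j ^ k ^ Suc m * (h * Y n)"
        by (simp add: power_mult mult.assoc)
      then show ?thesis unfolding S_def using ZW(1) H(3)[OF h(1) XY(2)] by blast
    qed
    moreover have "converges (\<lambda>j. (Z j ^ k * W j) ^ k ^ m * Y n) (X n ^ k ^ m * Y n)"
      using ZW(3) XY(2)[of n] G(1) H(1) by (intro converges_mult converges_power converges_const) auto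
    ultimately show ?thesis
      unfolding seq_closure_def by (intro CollectI exI[of _ "\<lambda>j. (Z j ^ k * W j) ^ k ^ m * Y n"] conjI allI)
  qed
  then have "g \<in> seq_closure S" using XY(3) by (rule seq_closure_closed)
  then obtain U where U: "\<And>n. U n \<in> S" "converges U g" by (auto simp: seq_closure_def)
  have "\<exists>x h. x \<in> G \<and> h \<in> H \<and> U n = x ^ k ^ Suc m * h" for n using U(1)[of n] by (auto simp: S_def)
  then obtain x h where xh: "\<And>n. x n \<in> G" "\<And>n. h n \<in> H" "\<And>n. U n = x n ^ k ^ Suc m * h n" by metis
  have "U = (\<lambda>n. x n ^ k ^ Suc m * h n)" using xh(3) by blast
  then show ?case using U(2) xh(1,2) by blast
qed

end

text \<open>Density is stated for all exponents \<open>k ^ m\<close> at once. The group \<open>H\<close> plays its role twice: its own elements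
  are limits of powers in \<open>H\<close>, and those of \<open>G\<close> are limits of powers up to factors in \<open>H\<close>.\<close>

locale dense_powers = valued_algebra v sc A nm chi d D
  for v :: "'f::field \<Rightarrow> real" and sc :: "'f \<Rightarrow> 'r::ring_1" and A nm chi d D +
  fixes G H :: "'r set" and k :: nat
  assumes G_in: "G \<subseteq> A" and G_1: "1 \<in> G" and G_mult: "x \<in> G \<Longrightarrow> y \<in> G \<Longrightarrow> x * y \<in> G"
    and G_inv: "x \<in> G \<Longrightarrow> \<exists>y\<in>G. x * y = 1 \<and> y * x = 1"
    and H_sub: "H \<subseteq> G" and H_1: "1 \<in> H" and H_mult: "x \<in> H \<Longrightarrow> y \<in> H \<Longrightarrow> x * y \<in> H"
    and H_inv: "x \<in> H \<Longrightarrow> \<exists>y\<in>H. x * y = 1 \<and> y * x = 1"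
    and H_normal: "x \<in> G \<Longrightarrow> h \<in> H \<Longrightarrow> \<exists>h'\<in>H. h * x = x * h'"
    and H_closed: "(\<And>n. X n \<in> H) \<Longrightarrow> converges X x \<Longrightarrow> x \<in> G \<Longrightarrow> x \<in> H"
    and k_ge_2: "2 \<le> k"
    and H_dense: "h \<in> H \<Longrightarrow> \<exists>X. (\<forall>n. X n \<in> H) \<and> converges (\<lambda>n. X n ^ k ^ m) h"
    and G_dense: "g \<in> G \<Longrightarrow> \<exists>X Y. (\<forall>n. X n \<in> G \<and> Y n \<in> H) \<and> converges (\<lambda>n. X n ^ k ^ m * Y n) g"
begin

lemma in_A [intro]: "g \<in> G \<Longrightarrow> g \<in> A" "h \<in> H \<Longrightarrow> h \<in> A" "h \<in> H \<Longrightarrow> h \<in> G"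
  using G_in H_sub by auto

lemma G_power: "g \<in> G \<Longrightarrow> g ^ n \<in> G"
  by (induction n) (auto simp: G_1 G_mult)

lemma power_of_product:
  assumes "x \<in> G" "h \<in> H"
  shows "\<exists>h'\<in>H. (x * h) ^ n = x ^ n * h'"
  by (rule power_mult_normal[OF H_normal[OF assms(1)] H_1 H_mult assms(2)])

lemma k_power_unbounded:
  assumes "1 < (q::real)"
  shows "\<exists>m. C < q ^ (k ^ m)"
proof -
  obtain n where n: "C < q ^ n" using real_arch_pow[OF assms] by blast
  have "n < 2 ^ n" by simp
  also have "2 ^ n \<le> k ^ n" using k_ge_2 by (intro power_mono) auto
  finally have "q ^ n \<le> q ^ (k ^ n)" using assms by (intro power_increasing) auto
  then show ?thesis using n by (intro exI[of _ n]) linarith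
qed

lemma converges_subsequence_bound:
  assumes "converges X x" "\<And>n. nm (X n - x) < max 1 (nm x) \<Longrightarrow> integral_elem (X n)"
  shows "integral_elem x"
proof -
  have "eventually (\<lambda>n. nm (X n - x) < max 1 (nm x)) sequentially"
    using assms(1) by (intro order_tendstoD(2)[of _ 0]) (auto simp: converges_def)
  then obtain N where N: "\<And>n. N \<le> n \<Longrightarrow> nm (X n - x) < max 1 (nm x)"
    by (auto simp: eventually_sequentially)
  have "converges (\<lambda>n. X (n + N)) x"
    using assms(1) LIMSEQ_ignore_initial_segment[of _ 0 N] by (auto simp: converges_def)
  then show ?thesis
  proof (rule integral_limit)
    show "integral_elem (X (n + N))" for n by (intro assms(2) N) simp
  qed
qed

lemma nm_close_le:
  assumes "y \<in> A" "x \<in> A" "nm (y - x) < max 1 (nm x)"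
  shows "nm y \<le> max 1 (nm x)"
proof -
  have "nm (x + (y - x)) \<le> max (nm x) (nm (y - x))" using assms by (intro nm_add) auto
  then show ?thesis using assms(3) by simp
qed

text \<open>The powers \<open>X n ^ k ^ m\<close> that approximate \<open>h\<close> are eventually not larger than \<open>max 1 (nm h)\<close>. For \<open>m\<close> large in terms
  of this bound, \<open>ex_power_bound\<close> shows that the elements \<open>X n\<close> are integral.\<close>

lemma integral_H:
  assumes h: "h \<in> H"
  shows "integral_elem h"
proof -
  obtain q where q: "1 < q" "\<And>C K x. x \<in> A \<Longrightarrow> 0 < K \<Longrightarrow> 1 \<le> C \<Longrightarrow> C ^ d < q ^ K \<Longrightarrow>
    (\<And>i. v (chi (x ^ K) i) \<le> C ^ i) \<Longrightarrow> integral_elem x"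
    using ex_power_bound by blast
  let ?C = "max 1 (nm h)"
  obtain m where m: "?C ^ d < q ^ (k ^ m)" using k_power_unbounded[OF q(1)] by blast
  obtain X where X: "\<And>n. X n \<in> H" "converges (\<lambda>n. X n ^ k ^ m) h" using H_dense[OF h] by blast
  show ?thesis
  proof (rule converges_subsequence_bound[OF X(2)])
    fix n assume "nm (X n ^ k ^ m - h) < ?C"
    then have le: "nm (X n ^ k ^ m) \<le> ?C" using X(1) h by (intro nm_close_le) auto
    have "integral_elem (X n)"
    proof (rule q(2)[OF _ _ _ m])
      show "v (chi (X n ^ k ^ m) i) \<le> ?C ^ i" for i
      proof -
        have "v (chi (X n ^ k ^ m) i) \<le> nm (X n ^ k ^ m) ^ i" using X(1) by (intro chi_le) auto
        also have "\<dots> \<le> ?C ^ i" using le by (intro power_mono) auto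
        finally show ?thesis .
      qed
    qed (use X(1) k_ge_2 in auto)
    then show "integral_elem (X n ^ k ^ m)" by (rule integral_power)
  qed
qed

text \<open>The closure is taken because \<open>bounded_modulo_divisible_part\<close> requires a closed order.\<close>

definition closed_span_H where "closed_span_H = seq_closure (ospan H)"

lemma order_closed_span_H: "is_order closed_span_H"
  unfolding closed_span_H_def using in_A H_1 H_mult by (intro order_seq_closure order_ospan) auto

lemma integral_closed_span_H: "r \<in> closed_span_H \<Longrightarrow> integral_elem r"
  unfolding closed_span_H_def using integral_ospan[OF H_mult integral_H] integral_seq_closure by blast

lemma ospan_H_conj:
  assumes "g \<in> G" "r \<in> ospan H"
  shows "\<exists>s\<in>ospan H. r * g = g * s"
  using assms(2)
proof (induction r rule: ospan.induct)
  case (step x h c)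
  then obtain s where s: "s \<in> ospan H" "x * g = g * s" by blast
  obtain h' where h': "h' \<in> H" "h * g = g * h'" using H_normal[OF assms(1) step.hyps(2)] by blast
  have "(x + sc c * h) * g = g * (s + sc c * h')"
    using s h' by (simp add: distrib_left distrib_right mult.assoc sc_left_commute[of g])
  moreover have "s + sc c * h' \<in> ospan H" using s h' step by (intro ospan.step) auto
  ultimately show ?case by blast
qed (auto intro: bexI[OF _ ospan.zero])

lemma closed_span_H_conj:
  assumes g: "g \<in> G" and r: "r \<in> closed_span_H"
  shows "\<exists>s\<in>closed_span_H. r * g = g * s"
proof -
  obtain g' where g': "g' \<in> G" "g * g' = 1" "g' * g = 1" using G_inv[OF g] by blast
  obtain X where X: "\<And>n. X n \<in> ospan H" "converges X r"
    using r by (auto simp: closed_span_H_def seq_closure_def)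
  have "g' * X n * g \<in> ospan H" for n
  proof -
    obtain s where "s \<in> ospan H" "X n * g = g * s" using ospan_H_conj[OF g X(1)] by blast
    then show ?thesis using g' by (metis mult.assoc mult_1)
  qed
  moreover have "converges (\<lambda>n. g' * X n * g) (g' * r * g)"
    using X(2) g g' by (intro converges_mult converges_const) auto
  ultimately have "g' * r * g \<in> closed_span_H"
    unfolding closed_span_H_def seq_closure_def by (intro CollectI exI[of _ "\<lambda>n. g' * X n * g"] conjI allI)
  moreover have "r * g = g * (g' * r * g)" using g'(2) by (metis mult.assoc mult_1)
  ultimately show ?thesis by blast
qed

definition nil_ideal where "nil_ideal = divisible_part closed_span_H"

lemma closed_span_H_closed: "(\<And>n. X n \<in> closed_span_H) \<Longrightarrow> converges X x \<Longrightarrow> x \<in> closed_span_H"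
  unfolding closed_span_H_def by (rule seq_closure_closed)

lemma nil_ideal_conj:
  assumes g: "g \<in> G" and a: "a \<in> nil_ideal"
  shows "\<exists>b\<in>nil_ideal. a * g = g * b"
proof -
  obtain g' where g': "g' \<in> G" "g * g' = 1" "g' * g = 1" using G_inv[OF g] by blast
  have conj_in: "g' * r * g \<in> closed_span_H" if "r \<in> closed_span_H" for r
  proof -
    obtain s where "s \<in> closed_span_H" "r * g = g * s" using closed_span_H_conj[OF g \<open>r \<in> closed_span_H\<close>] by blast
    then show ?thesis using g' by (metis mult.assoc mult_1)
  qed
  have "sc c * (g' * a * g) \<in> closed_span_H" for c
  proof -
    have "sc c * a \<in> closed_span_H" using a by (simp add: nil_ideal_def divisible_part_def)
    then have "g' * (sc c * a) * g \<in> closed_span_H" by (rule conj_in)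
    then show ?thesis by (simp add: sc_left_commute[of g'] mult.assoc)
  qed
  moreover have "g' * a * g \<in> closed_span_H" using a by (intro conj_in) (simp add: nil_ideal_def divisible_part_def)
  ultimately have "g' * a * g \<in> nil_ideal" by (simp add: nil_ideal_def divisible_part_def)
  moreover have "a * g = g * (g' * a * g)" using g'(2) by (metis mult.assoc mult_1)
  ultimately show ?thesis by blast
qed

lemma nil_ideal_in_A: "nil_ideal \<subseteq> A"
  using orderD(1)[OF order_closed_span_H] by (auto simp: nil_ideal_def divisible_part_def)

text \<open>All scalar multiples of an element of \<open>nil_ideal\<close> are integral. So this is a nil algebra, hence a
  nilpotent one, and its flag ends with \<open>A\<close>.\<close>

lemma flag_nil_ideal_top: "1 \<in> flag nil_ideal D"
proof (rule flag_top[OF nil_ideal_in_A])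
  note I = divisible_part_closed[OF order_closed_span_H, folded nil_ideal_def]
  fix xs assume xs: "set xs \<subseteq> nil_ideal" "length xs = D"
  have "prod_list xs = 0"
  proof (rule nil_algebra_nilpotent[OF nil_ideal_in_A I(1) _ I(4,5) _ xs])
    show "a * b \<in> nil_ideal" if "a \<in> nil_ideal" "b \<in> nil_ideal" for a b
      using I(2)[OF that(1)] that(2) by (simp add: nil_ideal_def divisible_part_def)
    show "a ^ d = 0" if "a \<in> nil_ideal" for a
    proof (rule nilpotent_if_multiples_integral)
      show "integral_elem (sc c * a)" for c
        using integral_closed_span_H \<open>a \<in> nil_ideal\<close> by (simp add: nil_ideal_def divisible_part_def)
    qed
  qed
  then show "prod_list xs * 1 = 0" by simp
qed auto

text \<open>Decompose \<open>h = (h - a) + a\<close> with \<open>h - a\<close> bounded by \<open>C\<close> and \<open>a\<close> in the nilpotent ideal. Both the group and the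
  bounded part preserve the flag, so \<open>flag_growth\<close> bounds the powers of \<open>g * h\<close> by a constant multiple of
  \<open>(nm g * C) ^ m\<close>. In the resulting bound for \<open>chi\<close> the constant, which depends on \<open>h\<close>, disappears
  for \<open>m \<rightarrow> \<infinity>\<close>.\<close>

lemma chi_coset_bound:
  "\<exists>C\<ge>1. \<forall>g\<in>G. \<forall>h\<in>H. \<forall>i. v (chi (g * h) i) \<le> (nm g * C) ^ i"
proof -
  obtain C where C: "1 \<le> C" "\<And>r. r \<in> closed_span_H \<Longrightarrow> \<exists>i\<in>nil_ideal. nm (r - i) \<le> C"
  proof -
    have "\<exists>C\<ge>1. \<forall>r\<in>closed_span_H. \<exists>i\<in>divisible_part closed_span_H. nm (r - i) \<le> C"
      by (rule bounded_modulo_divisible_part[OF order_closed_span_H]) (rule closed_span_H_closed)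
    then show ?thesis using that unfolding nil_ideal_def by blast
  qed
  have "v (chi (g * h) i) \<le> (nm g * C) ^ i" if g: "g \<in> G" and h: "h \<in> H" for g h i
  proof -
    have "H \<subseteq> closed_span_H" unfolding closed_span_H_def
      using seq_closure_subset[of "ospan H"] ospan_in[of H] in_A(2) ospan_base[of _ H] by blast
    then obtain a where a: "a \<in> nil_ideal" "nm (h - a) \<le> C" using C(2) h by blast
    then have aA: "a \<in> A" using nil_ideal_in_A by auto
    define \<beta> where "\<beta> = nm g * C"
    obtain g' where g': "g' \<in> G" "g * g' = 1" using G_inv[OF g] by blast
    have "g \<noteq> 0" using g' nm_1 nm_0 by (metis mult_zero_left zero_neq_one)
    then have "0 < nm g" using nm_eq_0[of g] g nm_nonneg[of g] by (auto simp: less_le)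
    then have \<beta>: "0 < \<beta>" using C(1) by (simp add: \<beta>_def)
    let ?y = "g * h"
    have y: "?y = g * (h - a) + g * a" by (simp add: algebra_simps)
    have "\<exists>c>0. \<forall>Z\<in>flag nil_ideal D. \<forall>m. nm ((g * (h - a) + g * a) ^ m * Z) \<le> c * \<beta> ^ m * nm Z"
    proof (rule flag_growth[OF _ _ _ _ _ \<beta>])
      show "g * (h - a) \<in> A" "g * a \<in> A" using g h aA by auto
      have "nm (g * (h - a)) \<le> nm g * nm (h - a)" using g h aA by (intro nm_mult) auto
      also have "\<dots> \<le> \<beta>" unfolding \<beta>_def using a by (intro mult_left_mono) auto
      finally show "nm (g * (h - a)) \<le> \<beta>" .
      have inv: "x * Z \<in> flag nil_ideal s" if "x \<in> G" "Z \<in> flag nil_ideal s" for x Z s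
        using that nil_ideal_conj by (intro flag_invariant) auto
      show "g * a * Z \<in> flag nil_ideal s" if "Z \<in> flag nil_ideal (Suc s)" for s Z
        using that a(1) g by (auto simp: mult.assoc intro: inv)
      show "g * (h - a) * Z \<in> flag nil_ideal s" if Z: "Z \<in> flag nil_ideal s" for s Z
      proof -
        have "h * Z + (sc (-1) * a) * Z \<in> flag nil_ideal s"
          using divisible_part_closed(4)[OF order_closed_span_H] a(1) Z h
          by (intro flag_add inv flag_ideal nil_ideal_in_A) (auto simp: nil_ideal_def)
        then have "g * (h * Z + (sc (-1) * a) * Z) \<in> flag nil_ideal s" using g by (intro inv)
        then show ?thesis by (simp add: sc_minus algebra_simps)
      qed
    qed
    then obtain c where c: "0 < c" "\<And>m. nm (?y ^ m) \<le> c * \<beta> ^ m"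
      using flag_nil_ideal_top unfolding y[symmetric] by fastforce
    have yA: "?y \<in> A" using g h by auto
    have pow: "v (chi ?y i) ^ m \<le> (c * \<beta> ^ m) ^ i" if "0 < m" for m
    proof (rule chi_power[OF yA that])
      show "v (chi (?y ^ m) j) \<le> (c * \<beta> ^ m) ^ j" for j
      proof -
        have "v (chi (?y ^ m) j) \<le> nm (?y ^ m) ^ j" using yA by (intro chi_le) auto
        also have "\<dots> \<le> (c * \<beta> ^ m) ^ j" using c by (intro power_mono) auto
        finally show ?thesis .
      qed
    qed (use c \<beta> in auto)
    show "v (chi ?y i) \<le> (nm g * C) ^ i"
    proof (rule ccontr)
      assume "\<not> ?thesis"
      then have less: "\<beta> ^ i < v (chi ?y i)" by (simp add: \<beta>_def)
      define t where "t = v (chi ?y i) / \<beta> ^ i"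
      have t: "1 < t" using less \<beta> by (simp add: t_def)
      obtain m where m: "c ^ i < t ^ m" using real_arch_pow[OF t] by blast
      have m': "t ^ Suc m \<le> c ^ i"
      proof -
        have "t ^ Suc m = v (chi ?y i) ^ Suc m / (\<beta> ^ i) ^ Suc m" by (simp add: t_def power_divide)
        also have "\<dots> \<le> (c * \<beta> ^ Suc m) ^ i / (\<beta> ^ i) ^ Suc m"
          using pow[of "Suc m"] \<beta> by (intro divide_right_mono) auto
        also have "(c * \<beta> ^ Suc m) ^ i = c ^ i * (\<beta> ^ i) ^ Suc m"
          by (simp only: power_mult_distrib flip: power_mult) (simp add: mult.commute)
        finally show ?thesis using \<beta> by simp
      qed
      have "t ^ m \<le> t ^ Suc m" using t by (intro power_increasing) auto
      then show False using m m' by linarith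
    qed
  qed
  then show ?thesis using C(1) by blast
qed

text \<open>As for \<open>H\<close>, with \<open>chi_coset_bound\<close> in place of the estimate by the norm. It is used twice: first \<open>X n ^ k ^ m\<close> is the
  product of a bounded element \<open>?a\<close> and an element of \<open>H\<close>, so \<open>X n\<close> is integral; then the powers of \<open>?a\<close> are products of
  powers of \<open>X n\<close>, which are bounded, and elements of \<open>H\<close>.\<close>

lemma integral_G:
  assumes g: "g \<in> G"
  shows "integral_elem g"
proof -
  obtain q where q: "1 < q" "\<And>C K x. x \<in> A \<Longrightarrow> 0 < K \<Longrightarrow> 1 \<le> C \<Longrightarrow> C ^ d < q ^ K \<Longrightarrow>
    (\<And>i. v (chi (x ^ K) i) \<le> C ^ i) \<Longrightarrow> integral_elem x"
    using ex_power_bound by blast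
  obtain C where C: "1 \<le> C" "\<And>g h i. g \<in> G \<Longrightarrow> h \<in> H \<Longrightarrow> v (chi (g * h) i) \<le> (nm g * C) ^ i"
    using chi_coset_bound by blast
  let ?B = "max 1 (nm g) * C"
  have B: "1 \<le> ?B" using C(1) mult_mono[of 1 "max 1 (nm g)" 1 C] by simp
  obtain m where m: "?B ^ d < q ^ (k ^ m)" using k_power_unbounded[OF q(1)] by blast
  obtain X Y where XY: "\<And>n. X n \<in> G" "\<And>n. Y n \<in> H" "converges (\<lambda>n. X n ^ k ^ m * Y n) g"
    using G_dense[OF g] by blast
  show ?thesis
  proof (rule converges_subsequence_bound[OF XY(3)])
    fix n
    let ?a = "X n ^ k ^ m * Y n"
    have aG: "?a \<in> G" using XY by (intro G_mult G_power) auto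
    assume "nm (?a - g) < max 1 (nm g)"
    then have le: "nm ?a \<le> max 1 (nm g)" using aG g by (intro nm_close_le) auto
    have "integral_elem (X n)"
    proof (rule q(2)[OF _ _ B m])
      obtain h where h: "h \<in> H" "Y n * h = 1" using H_inv[OF XY(2)] by blast
      then have eq: "X n ^ k ^ m = ?a * h" by (simp add: mult.assoc)
      show "v (chi (X n ^ k ^ m) i) \<le> ?B ^ i" for i
      proof -
        have "v (chi (X n ^ k ^ m) i) \<le> (nm ?a * C) ^ i"
          using C(2)[OF aG h(1), of i] by (simp only: eq[symmetric])
        also have "\<dots> \<le> ?B ^ i" using le C(1) by (intro power_mono mult_right_mono) auto
        finally show ?thesis .
      qed
    qed (use XY(1) k_ge_2 in auto)
    then obtain c where c: "1 \<le> c" "\<And>j. nm (X n ^ j) \<le> c" using integral_powers_bounded by blast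
    show "integral_elem ?a"
    proof (rule integral_if_chi_powers_bounded[of _ "c * C"])
      show "1 \<le> c * C" using c(1) C(1) mult_mono[of 1 c 1 C] by simp
      fix j i
      obtain h where h: "h \<in> H" "?a ^ j = (X n ^ k ^ m) ^ j * h"
        using power_of_product[OF G_power[OF XY(1)] XY(2)] by blast
      have "v (chi (?a ^ j) i) \<le> (nm ((X n ^ k ^ m) ^ j) * C) ^ i"
        unfolding h(2) using XY(1) h(1) by (intro C(2) G_power)
      also have "\<dots> \<le> (c * C) ^ i"
        using c(2) C(1) by (intro power_mono mult_right_mono) (auto simp flip: power_mult)
      finally show "v (chi (?a ^ j) i) \<le> (c * C) ^ i" .
    qed (use aG in auto)
  qed
qed

definition closed_span_G where "closed_span_G = seq_closure (ospan G)"

lemma order_closed_span_G: "is_order closed_span_G"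
  unfolding closed_span_G_def using G_in G_1 G_mult by (intro order_seq_closure order_ospan) auto

lemma integral_closed_span_G: "r \<in> closed_span_G \<Longrightarrow> integral_elem r"
  unfolding closed_span_G_def using integral_ospan[OF G_mult integral_G] integral_seq_closure by blast

lemma G_closed_span_G: "g \<in> G \<Longrightarrow> g \<in> closed_span_G"
  unfolding closed_span_G_def using seq_closure_subset[of "ospan G"] ospan_in[OF G_in] ospan_base[of g G] by blast

lemma closed_span_G_closed: "(\<And>n. X n \<in> closed_span_G) \<Longrightarrow> converges X x \<Longrightarrow> x \<in> closed_span_G"
  unfolding closed_span_G_def by (rule seq_closure_closed)

text \<open>Modulo \<open>\<pi>\<close>, a power of \<open>g\<close> is one of finitely many combinations of \<open>1, g, \<dots>, g ^ (d - 1)\<close>, and their number does not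
  depend on \<open>g\<close>. So two of the first powers agree modulo \<open>\<pi>\<close>, and their quotient is a power of \<open>g\<close>
  congruent to \<open>1\<close>. The factorial makes the exponent uniform.\<close>

lemma uniform_exponent:
  assumes \<pi>: "0 < v \<pi>" "v \<pi> < 1"
  shows "\<exists>e>0. \<forall>g\<in>G. congr closed_span_G \<pi> (g ^ e) 1"
proof -
  note RD = orderD[OF order_closed_span_G]
  have \<pi>0: "\<pi> \<noteq> 0" using \<pi> by auto
  obtain Res where Res: "finite Res" "\<And>a. v a \<le> 1 \<Longrightarrow> \<exists>b\<in>Res. v (a - b) \<le> v \<pi>"
    using finite_residues[OF \<pi>(1)] by blast
  define red where "red a = (SOME b. b \<in> Res \<and> v (a - b) \<le> v \<pi>)" for a
  have red: "red a \<in> Res" "v (a - red a) \<le> v \<pi>" if "v a \<le> 1" for a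
    using someI_ex[of "\<lambda>b. b \<in> Res \<and> v (a - b) \<le> v \<pi>"] Res(2)[OF that] unfolding red_def by blast+
  let ?F = "PiE {..<d} (\<lambda>_. Res)"
  have fin: "finite ?F" using Res(1) by (intro finite_PiE) auto
  define e :: nat where "e = fact (Suc (card ?F))"
  have "congr closed_span_G \<pi> (g ^ e) 1" if g: "g \<in> G" for g
  proof -
    have "\<forall>j. \<exists>c. (\<forall>l. v (c l) \<le> 1) \<and> g ^ j = (\<Sum>l<d. sc (c l) * g ^ l)"
      using integral_power_eq[OF integral_G[OF g]] by blast
    then obtain c where c: "\<And>j l. v (c j l) \<le> 1" "\<And>j. g ^ j = (\<Sum>l<d. sc (c j l) * g ^ l)" by metis
    define F where "F j = (\<lambda>l\<in>{..<d}. red (c j l))" for j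
    have "F ` {..card ?F} \<subseteq> ?F"
    proof
      fix y assume "y \<in> F ` {..card ?F}"
      then obtain j where "y = F j" by blast
      then show "y \<in> ?F" unfolding F_def by (auto intro: red(1) c(1))
    qed
    then have "card (F ` {..card ?F}) < card {..card ?F}" using card_mono[OF fin] by (simp add: le_imp_less_Suc)
    then have "\<not> inj_on F {..card ?F}" by (rule pigeonhole)
    then obtain i j where ij: "i < j" "j \<le> card ?F" "F i = F j"
      unfolding inj_on_def by (metis atMost_iff linorder_neqE_nat)
    have close: "v ((c j l - c i l) / \<pi>) \<le> 1" if "l < d" for l
    proof -
      have "red (c i l) = red (c j l)" using ij(3) that by (metis F_def lessThan_iff restrict_apply')
      then have eq: "c j l - c i l = (c j l - red (c j l)) - (c i l - red (c i l))" by simp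
      have "v (c j l - c i l) \<le> v \<pi>"
        unfolding eq using v_diff[of "c j l - red (c j l)" "c i l - red (c i l)"] red(2)[OF c(1), of j l] red(2)[OF c(1), of i l]
        by linarith
      then show ?thesis using \<pi> by (simp add: v_divide)
    qed
    define r where "r = (\<Sum>l<d. sc ((c j l - c i l) / \<pi>) * g ^ l)"
    have "(\<Sum>l\<in>L. sc ((c j l - c i l) / \<pi>) * g ^ l) \<in> closed_span_G" if "L \<subseteq> {..<d}" for L
      using that
    proof (induction L rule: infinite_finite_induct)
      case (insert l L)
      then have "sc ((c j l - c i l) / \<pi>) * g ^ l \<in> closed_span_G"
        using close[of l] by (intro RD(5) G_closed_span_G G_power g) auto
      then show ?case using insert by (auto intro: RD(3))
    qed (auto simp: RD)
    then have rR: "r \<in> closed_span_G" by (simp add: r_def)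
    have "g ^ j - g ^ i = (\<Sum>l<d. sc (c j l) * g ^ l) - (\<Sum>l<d. sc (c i l) * g ^ l)"
      using c(2) by metis
    also have "\<dots> = sc \<pi> * r"
      unfolding r_def sum_distrib_left mult.assoc[symmetric] sc_mult[symmetric] sum_subtractf[symmetric]
      using \<pi>0 by (simp add: left_diff_distrib sc_diff)
    finally have diff: "g ^ j - g ^ i = sc \<pi> * r" .
    obtain g' where g': "g' \<in> G" "g ^ i * g' = 1" "g' * g ^ i = 1" using G_inv[OF G_power[OF g]] by blast
    have "g ^ j = g ^ i * g ^ (j - i)" using ij(1) by (simp flip: power_add)
    then have "g ^ (j - i) - 1 = g' * (g ^ j - g ^ i)"
      using g'(3) by (simp add: right_diff_distrib mult.assoc[symmetric])
    also have "\<dots> = sc \<pi> * (g' * r)" unfolding diff by (rule sc_left_commute)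
    finally have 1: "congr closed_span_G \<pi> (g ^ (j - i)) 1"
      unfolding congr_def using RD(4)[OF G_closed_span_G[OF g'(1)] rR] by blast
    have "j - i dvd e" unfolding e_def using ij by (intro dvd_fact) auto
    then obtain n where "e = (j - i) * n" by auto
    then show ?thesis using congr_1_power[OF order_closed_span_G _ 1, of n] G_closed_span_G[OF G_power[OF g]]
      by (simp add: power_mult)
  qed
  then show ?thesis by (intro exI[of _ e]) (auto simp: e_def)
qed

text \<open>A \<open>k ^ m\<close>-th power has exponent \<open>M\<close> modulo \<open>c\<close>. Hence so does every element of \<open>H\<close>. If \<open>g\<close> is close to \<open>x ^ k ^ m * y\<close>
  with \<open>y \<in> H\<close>, then modulo \<open>c\<close> the \<open>M\<close>-th power of this product lies in \<open>H\<close>, and its \<open>M * M\<close>-th power is \<open>1\<close>.\<close>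

lemma uniform_exponent_transfer:
  assumes e: "\<And>x. x \<in> G \<Longrightarrow> congr closed_span_G c (x ^ e) 1" "e dvd k ^ m * M" and c: "c \<noteq> 0" and g: "g \<in> G"
  shows "congr closed_span_G c (g ^ (M * M)) 1"
proof -
  note RD = orderD[OF order_closed_span_G]
  have kM: "congr closed_span_G c ((x ^ k ^ m) ^ M) 1" if x: "x \<in> G" for x
  proof -
    obtain n where n: "k ^ m * M = e * n" using e(2) by auto
    then show ?thesis
      using congr_1_power[OF order_closed_span_G _ e(1)[OF x], of n] G_closed_span_G[OF G_power[OF x]] by (simp flip: power_mult)
  qed
  have hM: "congr closed_span_G c (h ^ M) 1" if "h \<in> H" for h
  proof -
    obtain X where X: "\<And>n. X n \<in> H" "converges (\<lambda>n. X n ^ k ^ m) h" using H_dense[OF \<open>h \<in> H\<close>] by blast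
    show ?thesis
    proof (rule congr_limit[OF _ converges_power[OF X(2)] c])
      show "congr closed_span_G c ((X n ^ k ^ m) ^ M) 1" for n using X(1) by (intro kM) auto
    qed (use closed_span_G_closed RD(1) in auto)
  qed
  obtain X Y where XY: "\<And>n. X n \<in> G" "\<And>n. Y n \<in> H" "converges (\<lambda>n. X n ^ k ^ m * Y n) g"
    using G_dense[OF g] by blast
  show ?thesis
  proof (rule congr_limit[OF _ converges_power[OF XY(3)] c])
    fix n
    let ?x = "X n ^ k ^ m"
    obtain h where h: "h \<in> H" "(?x * Y n) ^ M = ?x ^ M * h"
      using power_of_product[OF G_power[OF XY(1)] XY(2)] by blast
    have in': "?x ^ M \<in> closed_span_G" "h \<in> closed_span_G" "1 \<in> closed_span_G"
      using XY(1) h(1) by (auto intro: G_closed_span_G G_power RD)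
    have "congr closed_span_G c (?x ^ M * h) (1 * h)"
      using in' kM[OF XY(1)] by (intro congr_mult order_closed_span_G congr_refl) auto
    then have "congr closed_span_G c ((?x ^ M * h) ^ M) (h ^ M)"
      using in' RD(4) congr_power[OF order_closed_span_G _ _ , of "?x ^ M * h" "1 * h" c M] by simp
    then have "congr closed_span_G c ((?x ^ M * h) ^ M) 1" using hM[OF h(1)] congr_trans[OF order_closed_span_G] by blast
    then show "congr closed_span_G c ((?x * Y n) ^ (M * M)) 1" by (simp add: power_mult h(2))
  qed (use closed_span_G_closed RD(1) in auto)
qed

lemma bounded_powers: "g \<in> G \<Longrightarrow> \<exists>C. \<forall>j. nm (g ^ j) \<le> C"
  using integral_powers_bounded[OF integral_G] by blast

text \<open>By \<open>uniform_exponent_transfer\<close>, \<open>g ^ (M * M) = 1 + \<pi> r\<close> with \<open>r\<close> integral. The order spanned by the powers of \<open>r\<close> is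
  bounded, and there the successive \<open>p\<close>-th powers of \<open>1 + \<pi> r\<close> are congruent to \<open>1\<close> modulo higher and higher powers
  of \<open>\<pi>\<close>.\<close>

theorem coprime_exponent_if_residue_char_coprime:
  assumes p: "prime p" "v (of_nat p) < 1" "\<not> p dvd k"
  shows "\<exists>M>0. coprime M k \<and> (\<forall>g\<in>G. (\<lambda>a. nm (g ^ (M * p ^ a) - 1)) \<longlonglongrightarrow> 0)"
proof -
  obtain \<pi> where \<pi>: "0 < v \<pi>" "v \<pi> < 1" "\<And>a. v a < 1 \<Longrightarrow> v a \<le> v \<pi>"
    using ex_uniformizer by blast
  obtain e where e: "0 < e" "\<And>g. g \<in> G \<Longrightarrow> congr closed_span_G \<pi> (g ^ e) 1"
    using uniform_exponent[OF \<pi>(1,2)] by blast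
  obtain M m where M: "coprime M k" "0 < M" "e dvd k ^ m * M" using coprime_part_exponent[OF e(1)] by blast
  have "(\<lambda>a. nm (g ^ (M * M * p ^ a) - 1)) \<longlonglongrightarrow> 0" if g: "g \<in> G" for g
  proof -
    have "congr closed_span_G \<pi> (g ^ (M * M)) 1" using \<pi>(1) g by (intro uniform_exponent_transfer[OF e(2) M(3)]) auto
    then obtain r where r: "r \<in> closed_span_G" "g ^ (M * M) - 1 = sc \<pi> * r" by (auto simp: congr_def)
    define S where "S = range (\<lambda>n. r ^ n)"
    obtain C where C: "1 \<le> C" "\<And>n. nm (r ^ n) \<le> C" using integral_powers_bounded[OF integral_closed_span_G[OF r(1)]] by blast
    have rA: "r \<in> A" using r(1) orderD(1)[OF order_closed_span_G] by blast
    have SA: "S \<subseteq> A" using rA by (auto simp: S_def)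
    have ord: "is_order (ospan S)"
    proof (rule order_ospan[OF SA])
      show "1 \<in> S" unfolding S_def by (rule range_eqI[of _ _ 0]) simp
      show "s * t \<in> S" if "s \<in> S" "t \<in> S" for s t
        using that unfolding S_def by (auto simp flip: power_add)
    qed
    have rS: "r \<in> ospan S" unfolding S_def by (intro ospan_base range_eqI[of _ _ 1]) simp
    let ?x = "g ^ (M * M)"
    have x: "?x = 1 + sc \<pi> * r" using r(2) by (simp add: algebra_simps)
    have xS: "?x \<in> ospan S" unfolding x using rS \<pi>(2) by (intro orderD[OF ord]) auto
    have bound: "nm (?x ^ (p ^ a) - 1) \<le> v \<pi> ^ a * C" for a
    proof -
      have "congr (ospan S) (\<pi> ^ Suc a) (?x ^ (p ^ a)) 1"
      proof (rule congr_prime_power[OF ord])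
        show "v (of_nat p) \<le> v \<pi>" using \<pi>(3) p(2) .
        show "congr (ospan S) \<pi> ?x 1" unfolding congr_def using rS r(2) by (rule bexI[rotated])
      qed fact+
      then obtain s where s: "s \<in> ospan S" "?x ^ (p ^ a) - 1 = sc (\<pi> ^ Suc a) * s" by (auto simp: congr_def)
      have "nm (?x ^ (p ^ a) - 1) = v (\<pi> ^ Suc a) * nm s"
        unfolding s(2) by (rule nm_sc[OF ospan_in[OF SA s(1)]])
      also have "\<dots> \<le> v \<pi> ^ a * C"
      proof (rule mult_mono)
        show "v (\<pi> ^ Suc a) \<le> v \<pi> ^ a" unfolding v_power using \<pi>(1,2) by (intro power_decreasing) auto
        have bS: "nm s \<le> C" if "s \<in> S" for s using that C(2) by (auto simp: S_def)
        show "nm s \<le> C"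
        proof (rule nm_ospan_le[OF SA bS _ s(1)])
          show "0 \<le> C" using C(1) by linarith
        qed
        show "0 \<le> v \<pi> ^ a" using \<pi>(1) by simp
      qed (rule nm_nonneg)
      finally show ?thesis .
    qed
    have "(\<lambda>a. v \<pi> ^ a * C) \<longlonglongrightarrow> 0 * C"
      using \<pi>(1,2) by (intro tendsto_mult tendsto_const LIMSEQ_realpow_zero less_imp_le)
    then have lim: "(\<lambda>a. v \<pi> ^ a * C) \<longlonglongrightarrow> 0" by simp
    show ?thesis unfolding power_mult[of g "M * M"]
    proof (rule tendsto_sandwich[OF _ _ tendsto_const lim])
      show "\<forall>\<^sub>F a in sequentially. 0 \<le> nm (?x ^ p ^ a - 1)" by (intro always_eventually allI nm_nonneg)
      show "\<forall>\<^sub>F a in sequentially. nm (?x ^ p ^ a - 1) \<le> v \<pi> ^ a * C"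
        by (intro always_eventually allI bound)
    qed
  qed
  then show ?thesis using M by (intro exI[of _ "M * M"]) auto
qed

text \<open>If \<open>e\<close> is an exponent modulo \<open>\<pi>\<close>, then \<open>e * p ^ a\<close> is one modulo \<open>\<pi> ^ Suc a\<close>. As \<open>p\<close> divides \<open>k\<close>, its part prime to \<open>k\<close> is
  the same for all \<open>a\<close>. So \<open>g ^ (M * M) - 1\<close> is divisible by all powers of \<open>\<pi>\<close> in an order of integral elements, and all its multiples by
  scalars are integral.\<close>

theorem coprime_exponent_unipotent:
  assumes p: "prime p" "v (of_nat p) < 1" "p dvd k"
  shows "\<exists>M>0. coprime M k \<and> (\<forall>g\<in>G. (g ^ M - 1) ^ d = 0)"
proof -
  obtain \<pi> where \<pi>: "0 < v \<pi>" "v \<pi> < 1" "\<And>a. v a < 1 \<Longrightarrow> v a \<le> v \<pi>"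
    using ex_uniformizer by blast
  have \<pi>0: "\<pi> \<noteq> 0" using \<pi> by auto
  obtain e where e: "0 < e" "\<And>g. g \<in> G \<Longrightarrow> congr closed_span_G \<pi> (g ^ e) 1"
    using uniform_exponent[OF \<pi>(1,2)] by blast
  obtain M m where M: "coprime M k" "0 < M" "e dvd k ^ m * M" using coprime_part_exponent[OF e(1)] by blast
  have "(g ^ (M * M) - 1) ^ d = 0" if g: "g \<in> G" for g
  proof (rule nilpotent_if_multiples_integral)
    fix c
    have congr: "congr closed_span_G (\<pi> ^ Suc a) (g ^ (M * M)) 1" for a
    proof (rule uniform_exponent_transfer[OF _ _ _ g])
      show "\<pi> ^ Suc a \<noteq> 0" using \<pi>0 by simp
      show "congr closed_span_G (\<pi> ^ Suc a) (x ^ (e * p ^ a)) 1" if "x \<in> G" for x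
        unfolding power_mult using \<pi> p(2) e(2)[OF that] G_closed_span_G[OF G_power[OF that]]
        by (intro congr_prime_power[OF order_closed_span_G]) auto
      have "e * p ^ a dvd (k ^ m * M) * k ^ a" using M(3) p(3) by (intro mult_dvd_mono dvd_power_same)
      then show "e * p ^ a dvd k ^ (m + a) * M" by (simp add: power_add mult_ac)
    qed
    have "\<exists>a. v c * v \<pi> ^ a \<le> 1"
    proof (cases "c = 0")
      case False
      then obtain a where "v \<pi> ^ a < 1 / v c" using real_arch_pow_inv[OF _ \<pi>(2), of "1 / v c"] v_pos by auto
      then show ?thesis using v_pos[OF False] by (intro exI[of _ a]) (simp add: field_simps less_imp_le)
    qed simp
    then obtain a where a: "v c * v \<pi> ^ a \<le> 1" by blast
    obtain r where r: "r \<in> closed_span_G" "g ^ (M * M) - 1 = sc (\<pi> ^ Suc a) * r"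
      using congr by (auto simp: congr_def)
    have "v (c * \<pi> ^ Suc a) = v c * v \<pi> ^ a * v \<pi>" by (simp add: mult v_power)
    also have "\<dots> \<le> 1 * 1" using a \<pi>(1,2) by (intro mult_mono[OF a]) auto
    finally have "v (c * \<pi> ^ Suc a) \<le> 1" by simp
    then have "sc (c * \<pi> ^ Suc a) * r \<in> closed_span_G" using r(1) by (rule orderD(5)[OF order_closed_span_G])
    then show "integral_elem (sc c * (g ^ (M * M) - 1))"
      unfolding r(2) by (intro integral_closed_span_G) (simp add: sc_mult mult.assoc)
  qed
  then show ?thesis using M by (intro exI[of _ "M * M"]) auto
qed

text \<open>A unipotent element has \<open>p\<close>-power order in characteristic \<open>p\<close>. So \<open>M * p ^ d\<close> is an exponent of \<open>G\<close>, and the factor \<open>p ^ d\<close>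
  is removed in the same way as in \<open>uniform_exponent_transfer\<close>, this time without congruences.\<close>

theorem coprime_exponent_if_char:
  assumes p: "prime p" "of_nat p = (0::'f)" "p dvd k"
  shows "\<exists>M>0. coprime M k \<and> (\<forall>g\<in>G. g ^ M = 1)"
proof -
  have p0: "(of_nat p :: 'r) = 0" using p(2) sc_of_nat[of p] by (metis sc_0)
  have "v (of_nat p) < 1" using p(2) by simp
  then obtain M where M: "0 < M" "coprime M k" "\<And>g. g \<in> G \<Longrightarrow> (g ^ M - 1) ^ d = 0"
    using coprime_exponent_unipotent[OF p(1) _ p(3)] by blast
  have tors: "(g ^ M) ^ p ^ d = 1" if "g \<in> G" for g
    using p0 M(3)[OF that] by (rule unipotent_torsion)
  have pk: "p ^ d dvd k ^ d" using p(3) by (rule dvd_power_same)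
  have kM: "(x ^ k ^ d) ^ M = 1" if "x \<in> G" for x
  proof -
    obtain n where "k ^ d = p ^ d * n" using pk by auto
    then have "(x ^ k ^ d) ^ M = ((x ^ M) ^ p ^ d) ^ n" by (simp add: mult_ac flip: power_mult)
    then show ?thesis using tors[OF that] by simp
  qed
  have hM: "h ^ M = 1" if "h \<in> H" for h
  proof -
    obtain X where X: "\<And>n. X n \<in> H" "converges (\<lambda>n. X n ^ k ^ d) h" using H_dense[OF \<open>h \<in> H\<close>] by blast
    have "converges (\<lambda>n. (X n ^ k ^ d) ^ M) (h ^ M)" by (rule converges_power[OF X(2)])
    then have "converges (\<lambda>n. 1) (h ^ M)" using kM X(1) in_A by simp
    then show ?thesis using converges_unique converges_const[OF one_in] by blast
  qed
  have "g ^ (M * M) = 1" if g: "g \<in> G" for g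
  proof -
    obtain X Y where XY: "\<And>n. X n \<in> G" "\<And>n. Y n \<in> H" "converges (\<lambda>n. X n ^ k ^ d * Y n) g"
      using G_dense[OF g] by blast
    have "(X n ^ k ^ d * Y n) ^ M \<in> H" for n
      using power_of_product[OF G_power[OF XY(1)] XY(2)] kM[OF XY(1)] by (metis mult_1)
    then have "g ^ M \<in> H"
      using converges_power[OF XY(3)] G_power[OF g] by (rule H_closed)
    then show ?thesis using hM by (simp add: power_mult)
  qed
  then show ?thesis using M by (intro exI[of _ "M * M"]) auto
qed

end

section \<open>A ring containing all matrix rings\<close>

text \<open>Gaussian elimination: a pivot in the last column removes one unknown and one equation.\<close>

lemma homogeneous_system_solution:
  fixes f :: "nat \<Rightarrow> nat \<Rightarrow> 'f::field"
  shows "\<exists>c. (\<exists>i\<le>n. c i \<noteq> 0) \<and> (\<forall>r<n. (\<Sum>i\<le>n. c i * f r i) = 0)"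
proof (induction n arbitrary: f)
  case 0
  then show ?case by (intro exI[of _ "\<lambda>_. 1"]) auto
next
  case (Suc n)
  show ?case
  proof (cases "\<forall>r\<le>n. f r (Suc n) = 0")
    case True
    then show ?thesis by (intro exI[of _ "\<lambda>i. if i = Suc n then 1 else 0"]) (auto simp: less_Suc_eq_le)
  next
    case False
    then obtain s where s: "s \<le> n" "f s (Suc n) \<noteq> 0" by blast
    define \<sigma> where "\<sigma> r = (if r = s then n else r)" for r
    define q where "q r = f r (Suc n) / f s (Suc n)" for r
    obtain c where c: "\<exists>i\<le>n. c i \<noteq> 0" "\<And>r. r < n \<Longrightarrow> (\<Sum>i\<le>n. c i * (f (\<sigma> r) i - q (\<sigma> r) * f s i)) = 0"
      using Suc.IH[of "\<lambda>r i. f (\<sigma> r) i - q (\<sigma> r) * f s i"] by blast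
    define S where "S = (\<Sum>i\<le>n. c i * f s i)"
    define c' where "c' i = (if i = Suc n then - S / f s (Suc n) else c i)" for i
    have c'_sum: "(\<Sum>i\<le>Suc n. c' i * f r i) = (\<Sum>i\<le>n. c i * f r i) - q r * S" for r
    proof -
      have "(\<Sum>i\<le>n. c' i * f r i) = (\<Sum>i\<le>n. c i * f r i)" by (intro sum.cong) (auto simp: c'_def)
      then show ?thesis by (simp add: c'_def q_def)
    qed
    have "(\<Sum>i\<le>Suc n. c' i * f r i) = 0" if "r < Suc n" for r
    proof (cases "r = s")
      case True
      then show ?thesis using s(2) by (simp only: c'_sum) (simp add: q_def S_def)
    next
      case False
      then obtain t where t: "t < n" "r = \<sigma> t"
        using \<open>r < Suc n\<close> s(1) by (cases "r = n") (auto simp: \<sigma>_def intro: that[of s] that[of r])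
      have "(\<Sum>i\<le>n. c i * (f r i - q r * f s i)) = 0" using c(2)[OF t(1)] t(2) by simp
      moreover have "(\<Sum>i\<le>n. c i * (f r i - q r * f s i)) = (\<Sum>i\<le>n. c i * f r i) - q r * S"
        by (simp add: S_def right_diff_distrib sum_subtractf sum_distrib_left mult_ac)
      ultimately show ?thesis by (simp only: c'_sum)
    qed
    moreover have "\<exists>i\<le>Suc n. c' i \<noteq> 0"
    proof -
      obtain i where "i \<le> n" "c i \<noteq> 0" using c(1) by blast
      then show ?thesis by (intro exI[of _ i]) (auto simp: c'_def)
    qed
    ultimately show ?thesis by blast
  qed
qed

text \<open>The size of the matrices arises within the proof as the dimension of a space of functions, so it cannot
  be an index type. To compute nevertheless in a type of class \<open>ring_1\<close>, matrices of all
  sizes are embedded into the ring of endomorphisms of the module of sequences: an \<open>N \<times> N\<close> matrix acts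
  simultaneously on all blocks of \<open>N\<close> consecutive entries. This embedding preserves the unit.\<close>

typedef (overloaded) 'c lin = "{f :: (nat \<Rightarrow> 'c::comm_ring_1) \<Rightarrow> (nat \<Rightarrow> 'c).
    (\<forall>x y. f (\<lambda>i. x i + y i) = (\<lambda>i. f x i + f y i)) \<and> (\<forall>c x. f (\<lambda>i. c * x i) = (\<lambda>i. c * f x i))}"
  morphisms app Lin
  by (rule exI[of _ "\<lambda>x i. 0"]) auto

setup_lifting type_definition_lin

lemma app_add: "app a (\<lambda>i. x i + y i) = (\<lambda>i. app a x i + app a y i)"
  and app_scale: "app a (\<lambda>i. c * x i) = (\<lambda>i. c * app a x i)"
  using app[of a] by auto

lemma lin_eqI: "(\<And>x i. app a x i = app b x i) \<Longrightarrow> a = b"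
  by (metis app_inject ext)

instantiation lin :: (comm_ring_1) ring_1
begin

lift_definition zero_lin :: "'a lin" is "\<lambda>x i. 0" by simp
lift_definition one_lin :: "'a lin" is "\<lambda>x. x" by simp
lift_definition plus_lin :: "'a lin \<Rightarrow> 'a lin \<Rightarrow> 'a lin" is "\<lambda>f g x i. f x i + g x i"
  by (simp add: algebra_simps)
lift_definition minus_lin :: "'a lin \<Rightarrow> 'a lin \<Rightarrow> 'a lin" is "\<lambda>f g x i. f x i - g x i"
  by (simp add: algebra_simps)
lift_definition uminus_lin :: "'a lin \<Rightarrow> 'a lin" is "\<lambda>f x i. - f x i"
  by (simp add: algebra_simps)
lift_definition times_lin :: "'a lin \<Rightarrow> 'a lin \<Rightarrow> 'a lin" is "\<lambda>f g x. f (g x)"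
  by simp

instance
proof
  fix a b c :: "'a lin"
  show "a * b * c = a * (b * c)" by transfer simp
  show "1 * a = a" "a * 1 = a" by (transfer; simp)+
  show "a + b + c = a + (b + c)" "a + b = b + a" "0 + a = a" "- a + a = 0" "a - b = a + - b"
    by (transfer; simp add: algebra_simps)+
  show "(a + b) * c = a * c + b * c" by transfer simp
  show "a * (b + c) = a * b + a * c" by transfer (auto simp: fun_eq_iff)
  show "(0::'a lin) \<noteq> 1" by transfer (metis zero_neq_one)
qed

end

lemma app_simps [simp]:
  "app 0 x i = 0" "app 1 x = x" "app (a + b) x i = app a x i + app b x i"
  "app (a - b) x i = app a x i - app b x i" "app (a * b) x = app a (app b x)"
  by (transfer; simp)+

lift_definition scalar :: "'c::comm_ring_1 \<Rightarrow> 'c lin" is "\<lambda>c x i. c * x i"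
  by (auto simp: algebra_simps)

lemma app_scalar [simp]: "app (scalar c) x i = c * x i"
  by transfer simp

lemma scalar_commute: "scalar c * a = a * scalar c"
proof (rule lin_eqI)
  fix x i
  have "app (scalar c) x = (\<lambda>i. c * x i)" by auto
  then show "app (scalar c * a) x i = app (a * scalar c) x i" by (simp add: app_scale)
qed

lift_definition blocks :: "nat \<Rightarrow> 'c mat \<Rightarrow> 'c::comm_ring_1 lin" is
  "\<lambda>N M x k. \<Sum>j<N. M $$ (k mod N, j) * x (k div N * N + j)"
  by (auto simp: distrib_left sum.distrib sum_distrib_left mult_ac)

lemma app_blocks: "app (blocks N M) x k = (\<Sum>j<N. M $$ (k mod N, j) * x (k div N * N + j))"
  by (simp add: blocks.rep_eq)

text \<open>The leading \<open>N \<times> N\<close> block, which determines an element of the image of \<open>blocks N\<close>.\<close>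

definition unblock :: "nat \<Rightarrow> 'c::comm_ring_1 lin \<Rightarrow> 'c mat" where
  "unblock N a = Matrix.mat N N (\<lambda>(i, j). app a (\<lambda>l. if l = j then 1 else 0) i)"

lemma unblock_carrier [simp]: "unblock N a \<in> carrier_mat N N"
  and dim_unblock [simp]: "dim_row (unblock N a) = N" "dim_col (unblock N a) = N"
  by (simp_all add: unblock_def)

lemma unblock_blocks:
  assumes "M \<in> carrier_mat N N"
  shows "unblock N (blocks N M) = M"
proof (rule eq_matI)
  fix i j assume "i < dim_row M" "j < dim_col M"
  then have ij: "i < N" "j < N" using assms by auto
  then have "unblock N (blocks N M) $$ (i, j) = (\<Sum>l<N. M $$ (i, l) * (if l = j then 1 else 0))"
    by (simp add: unblock_def app_blocks)
  also have "\<dots> = (\<Sum>l<N. if l = j then M $$ (i, l) else 0)" by (intro sum.cong) auto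
  also have "\<dots> = M $$ (i, j)" using ij by simp
  finally show "unblock N (blocks N M) $$ (i, j) = M $$ (i, j)" .
qed (use assms in auto)

locale matrix_size =
  fixes N :: nat
  assumes N_pos: "0 < N"
begin

definition mats :: "'c::comm_ring_1 lin set" where
  "mats = blocks N ` carrier_mat N N"

lemma blocks_in: "M \<in> carrier_mat N N \<Longrightarrow> blocks N M \<in> mats"
  by (simp add: mats_def)

lemma blocks_unblock: "a \<in> mats \<Longrightarrow> blocks N (unblock N a) = a"
  by (auto simp: mats_def unblock_blocks)

lemma mats_eqI: "a \<in> mats \<Longrightarrow> b \<in> mats \<Longrightarrow> unblock N a = unblock N b \<Longrightarrow> a = b"
  by (metis blocks_unblock)

lemma blocks_add: "P \<in> carrier_mat N N \<Longrightarrow> Q \<in> carrier_mat N N \<Longrightarrow> blocks N (P + Q) = blocks N P + blocks N Q"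
  using N_pos by (intro lin_eqI) (simp add: app_blocks distrib_right sum.distrib)

lemma blocks_one: "blocks N (1\<^sub>m N) = 1"
proof (rule lin_eqI)
  fix x :: "nat \<Rightarrow> 'a" and k
  have "app (blocks N (1\<^sub>m N)) x k = (\<Sum>j<N. if j = k mod N then x (k div N * N + j) else 0)"
    unfolding app_blocks using N_pos by (intro sum.cong) auto
  also have "\<dots> = x k" using N_pos by (simp add: sum.delta)
  finally show "app (blocks N (1\<^sub>m N)) x k = app 1 x k" by simp
qed

lemma blocks_mult:
  assumes "P \<in> carrier_mat N N" "Q \<in> carrier_mat N N"
  shows "blocks N (P * Q) = blocks N P * blocks N Q"
proof (rule lin_eqI)
  fix x k
  let ?r = "k mod N" and ?b = "k div N * N"
  have r: "?r < N" using N_pos by simp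
  have "app (blocks N P * blocks N Q) x k =
      (\<Sum>j<N. P $$ (?r, j) * (\<Sum>l<N. Q $$ (j, l) * x (?b + l)))"
    by (simp add: app_blocks)
  also have "\<dots> = (\<Sum>j<N. \<Sum>l<N. P $$ (?r, j) * Q $$ (j, l) * x (?b + l))"
    by (simp add: sum_distrib_left mult.assoc)
  also have "\<dots> = (\<Sum>l<N. \<Sum>j<N. P $$ (?r, j) * Q $$ (j, l) * x (?b + l))" by (rule sum.swap)
  also have "\<dots> = (\<Sum>l<N. (P * Q) $$ (?r, l) * x (?b + l))"
    using assms r by (intro sum.cong) (auto simp: scalar_prod_def sum_distrib_right atLeast0LessThan)
  finally show "app (blocks N (P * Q)) x k = app (blocks N P * blocks N Q) x k" by (simp add: app_blocks)
qed

lemma blocks_scale: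
  "M \<in> carrier_mat N N \<Longrightarrow> blocks N (c \<cdot>\<^sub>m M) = scalar c * blocks N M"
  using N_pos by (intro lin_eqI) (simp add: app_blocks sum_distrib_left mult.assoc)

lemma mats_one [simp, intro]: "1 \<in> mats"
  using blocks_in[of "1\<^sub>m N"] by (simp add: blocks_one)

lemma mats_add [intro]: "a \<in> mats \<Longrightarrow> b \<in> mats \<Longrightarrow> a + b \<in> mats"
  unfolding mats_def by (auto simp flip: blocks_add)

lemma mats_mult [intro]: "a \<in> mats \<Longrightarrow> b \<in> mats \<Longrightarrow> a * b \<in> mats"
  unfolding mats_def by (auto simp flip: blocks_mult)

lemma mats_scale [intro]: "a \<in> mats \<Longrightarrow> scalar c * a \<in> mats"
  unfolding mats_def by (auto simp flip: blocks_scale)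

lemma mats_scalar [intro]: "scalar c \<in> mats"
  using mats_scale[of 1 c] by simp

lemma scalar_ring:
  "scalar 0 = 0" "scalar 1 = 1" "scalar (a + b) = scalar a + scalar b" "scalar (a * b) = scalar a * scalar b"
  "scalar (- a) = - scalar a"
proof -
  show "scalar 0 = 0" "scalar 1 = 1" "scalar (a + b) = scalar a + scalar b" "scalar (a * b) = scalar a * scalar b"
    by (auto intro!: lin_eqI simp: algebra_simps)
  then have "scalar (- a) + scalar a = 0"
    by (auto intro!: lin_eqI)
  then show "scalar (- a) = - scalar a" by (simp add: eq_neg_iff_add_eq_0)
qed

lemma mats_zero [simp, intro]: "0 \<in> mats"
  using mats_scalar[of 0] by (simp add: scalar_ring)

lemma mats_minus [intro]: "a \<in> mats \<Longrightarrow> - a \<in> mats"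
  using mats_scale[of a "-1"] by (simp add: scalar_ring)

lemma mats_diff [intro]: "a \<in> mats \<Longrightarrow> b \<in> mats \<Longrightarrow> a - b \<in> mats"
  using mats_add[of a "- b"] by auto

lemma mats_power [intro]: "a \<in> mats \<Longrightarrow> a ^ n \<in> mats"
  by (induction n) auto

lemma mats_sum [intro]: "(\<And>i. i \<in> I \<Longrightarrow> f i \<in> mats) \<Longrightarrow> sum f I \<in> mats"
  by (induction I rule: infinite_finite_induct) auto

lemma unblock_index: "i < N \<Longrightarrow> j < N \<Longrightarrow> unblock N a $$ (i, j) = app a (\<lambda>l. if l = j then 1 else 0) i"
  by (simp add: unblock_def)

lemma unblock_simps:
  "i < N \<Longrightarrow> j < N \<Longrightarrow> unblock N (a + b) $$ (i, j) = unblock N a $$ (i, j) + unblock N b $$ (i, j)"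
  "i < N \<Longrightarrow> j < N \<Longrightarrow> unblock N (a - b) $$ (i, j) = unblock N a $$ (i, j) - unblock N b $$ (i, j)"
  "i < N \<Longrightarrow> j < N \<Longrightarrow> unblock N 0 $$ (i, j) = 0"
  "i < N \<Longrightarrow> j < N \<Longrightarrow> unblock N 1 $$ (i, j) = (if i = j then 1 else 0)"
  "i < N \<Longrightarrow> j < N \<Longrightarrow> unblock N (scalar c * a) $$ (i, j) = c * unblock N a $$ (i, j)"
  "i < N \<Longrightarrow> j < N \<Longrightarrow> unblock N (scalar c) $$ (i, j) = (if i = j then c else 0)"
  by (simp_all add: unblock_index)

lemma unblock_mult: "a \<in> mats \<Longrightarrow> b \<in> mats \<Longrightarrow> unblock N (a * b) = unblock N a * unblock N b"
  using blocks_mult[of "unblock N a" "unblock N b"]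
    unblock_blocks[OF mult_carrier_mat[OF unblock_carrier[of N a] unblock_carrier[of N b]]]
  by (simp add: blocks_unblock)

lemma unblock_mult_index:
  "a \<in> mats \<Longrightarrow> b \<in> mats \<Longrightarrow> i < N \<Longrightarrow> j < N \<Longrightarrow>
    unblock N (a * b) $$ (i, j) = (\<Sum>l<N. unblock N a $$ (i, l) * unblock N b $$ (l, j))"
  by (simp add: unblock_mult scalar_prod_def atLeast0LessThan)

lemma unblock_sum_index:
  "i < N \<Longrightarrow> j < N \<Longrightarrow> unblock N (sum f I) $$ (i, j) = (\<Sum>k\<in>I. unblock N (f k) $$ (i, j))"
  by (induction I rule: infinite_finite_induct) (auto simp: unblock_simps)

definition dt :: "'c::comm_ring_1 lin \<Rightarrow> 'c" where
  "dt a = Determinant.det (unblock N a)"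

lemma dt_mult: "a \<in> mats \<Longrightarrow> b \<in> mats \<Longrightarrow> dt (a * b) = dt a * dt b"
  unfolding dt_def by (simp add: unblock_mult det_mult[of _ N])

lemma unblock_one: "unblock N 1 = 1\<^sub>m N"
  by (rule eq_matI) (auto simp: unblock_simps)

lemma dt_one: "dt 1 = 1"
  by (simp add: dt_def unblock_one)

section \<open>Reversed characteristic polynomials\<close>

definition lift :: "'c::comm_ring_1 lin \<Rightarrow> 'c poly lin" where
  "lift a = blocks N (map_mat (\<lambda>c. [:c:]) (unblock N a))"

lemma lift_in [simp, intro]: "lift a \<in> mats"
  unfolding lift_def by (intro blocks_in) simp

lemma unblock_lift: "i < N \<Longrightarrow> j < N \<Longrightarrow> unblock N (lift a) $$ (i, j) = [:unblock N a $$ (i, j):]"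
  unfolding lift_def by (subst unblock_blocks) auto

lemma const_poly_sum: "[:sum f I:] = (\<Sum>i\<in>I. [:f i:])"
proof (induction I rule: infinite_finite_induct)
  case (insert i I)
  have "[:f i + sum f I:] = [:f i:] + [:sum f I:]" by simp
  then show ?case using insert by (simp del: add_pCons)
qed auto

lemma lift_mult: "a \<in> mats \<Longrightarrow> b \<in> mats \<Longrightarrow> lift (a * b) = lift a * lift b"
  by (intro mats_eqI mats_mult lift_in eq_matI)
    (auto simp: unblock_lift unblock_mult_index const_poly_sum mult.commute simp del: index_mult_mat)

lemma lift_one: "lift 1 = 1"
  by (intro mats_eqI lift_in mats_one eq_matI) (auto simp: unblock_lift unblock_simps)

definition revchar :: "'c::comm_ring_1 lin \<Rightarrow> 'c poly" where
  "revchar a = dt (1 - scalar [:0, 1:] * lift a)"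

end

context nonarch_local_field
begin

lemma v_sum_less:
  assumes "\<And>i. i \<in> I \<Longrightarrow> v (f i) < C" "0 < C"
  shows "v (sum f I) < C"
  using assms
proof (induction I rule: infinite_finite_induct)
  case (insert x I)
  then have "v (f x) < C" "v (sum f I) < C" by auto
  then show ?case
    using ultrametric[of "f x" "sum f I"] insert.hyps by simp
qed auto

text \<open>The first index at which the weighted coefficients are largest; this is what makes the
  leading term in the proof of Gauss's lemma unique.\<close>

lemma ex_first_max_coeff:
  fixes p :: "'f poly"
  assumes "0 < r"
  shows "\<exists>i. (\<forall>j. v (coeff p j) / r ^ j \<le> v (coeff p i) / r ^ i) \<and>
    (\<forall>j<i. v (coeff p j) / r ^ j < v (coeff p i) / r ^ i)"
proof -
  let ?w = "\<lambda>i. v (coeff p i) / r ^ i"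
  define m where "m = Max (?w ` {..degree p})"
  have m_in: "m \<in> ?w ` {..degree p}" unfolding m_def by (intro Max_in) auto
  have le: "?w j \<le> m" for j
  proof (cases "j \<le> degree p")
    case True
    then show ?thesis unfolding m_def by (intro Max_ge) auto
  next
    case False
    then have "coeff p j = 0" by (simp add: coeff_eq_0)
    moreover have "0 \<le> m" using m_in nonneg assms by auto
    ultimately show ?thesis by simp
  qed
  obtain i0 where "?w i0 = m" using m_in by auto
  then have i: "?w (LEAST i. ?w i = m) = m" by (rule LeastI)
  have "?w j < m" if "j < (LEAST i. ?w i = m)" for j
    using not_less_Least[OF that] le[of j] by simp
  then show ?thesis using i le by (intro exI[of _ "LEAST i. ?w i = m"]) simp
qed

text \<open>Gauss's lemma for the norm \<open>max v (coeff p i) / r ^ i\<close>: this norm is multiplicative, it is at least \<open>1\<close> for both factors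
  because of their constant terms, and at most \<open>1\<close> for the product.\<close>

lemma gauss_factor_bound:
  fixes d q :: "'f poly"
  assumes "coeff d 0 = 1" "coeff q 0 = 1" "0 < r" "\<And>m. v (coeff (d * q) m) \<le> r ^ m"
  shows "v (coeff d i) \<le> r ^ i"
proof -
  define w where "w p i = v (coeff p i) / r ^ i" for p i
  have vw: "v (coeff p i) = w p i * r ^ i" for p i using assms(3) by (simp add: w_def)
  have w_nonneg: "0 \<le> w p i" for p i using assms(3) nonneg by (simp add: w_def)
  obtain i0 where i0: "\<And>j. w d j \<le> w d i0" "\<And>j. j < i0 \<Longrightarrow> w d j < w d i0"
    using ex_first_max_coeff[OF assms(3), of d] unfolding w_def by blast
  obtain j0 where j0: "\<And>j. w q j \<le> w q j0" "\<And>j. j < j0 \<Longrightarrow> w q j < w q j0"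
    using ex_first_max_coeff[OF assms(3), of q] unfolding w_def by blast
  have ge1: "1 \<le> w d i0" "1 \<le> w q j0" using i0(1)[of 0] j0(1)[of 0] assms by (simp_all add: w_def)
  let ?t = "\<lambda>l. coeff d l * coeff q (i0 + j0 - l)"
  let ?M = "w d i0 * w q j0 * r ^ (i0 + j0)"
  have M: "0 < ?M" using ge1 assms(3) by simp
  have t: "v (?t l) = w d l * w q (i0 + j0 - l) * r ^ (i0 + j0)" if "l \<le> i0 + j0" for l
  proof -
    have "r ^ l * r ^ (i0 + j0 - l) = r ^ (i0 + j0)" using that by (simp flip: power_add)
    then show ?thesis by (simp add: mult vw mult_ac)
  qed
  have "v (\<Sum>l\<in>{..i0 + j0} - {i0}. ?t l) < ?M"
  proof (rule v_sum_less[OF _ M])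
    fix l assume l: "l \<in> {..i0 + j0} - {i0}"
    have "w d l * w q (i0 + j0 - l) < w d i0 * w q j0"
    proof (cases "l < i0")
      case True
      have "w d l * w q (i0 + j0 - l) \<le> w d l * w q j0" using j0(1) w_nonneg by (intro mult_left_mono)
      also have "\<dots> < w d i0 * w q j0" using i0(2)[OF True] ge1 by (intro mult_strict_right_mono) auto
      finally show ?thesis .
    next
      case False
      then have "i0 + j0 - l < j0" using l by auto
      have "w d l * w q (i0 + j0 - l) \<le> w d i0 * w q (i0 + j0 - l)" using i0(1) w_nonneg by (intro mult_right_mono)
      also have "\<dots> < w d i0 * w q j0"
        using j0(2)[OF \<open>i0 + j0 - l < j0\<close>] ge1 by (intro mult_strict_left_mono) auto
      finally show ?thesis .
    qed
    then show "v (?t l) < ?M" using l assms(3) by (subst t) auto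
  qed
  moreover have "v (?t i0) = ?M" by (subst t) auto
  moreover have "coeff (d * q) (i0 + j0) = ?t i0 + (\<Sum>l\<in>{..i0 + j0} - {i0}. ?t l)"
    unfolding coeff_mult by (intro sum.remove) auto
  ultimately have "v (coeff (d * q) (i0 + j0)) = ?M"
    using v_eq_if_close[of "?t i0" "coeff (d * q) (i0 + j0)"] by simp
  then have "w d i0 * w q j0 * r ^ (i0 + j0) \<le> 1 * r ^ (i0 + j0)" using assms(4)[of "i0 + j0"] by simp
  then have "w d i0 * w q j0 \<le> 1" using assms(3) by (simp only: mult_le_cancel_right) auto
  moreover have "w d i0 * 1 \<le> w d i0 * w q j0" using ge1 by (intro mult_left_mono) auto
  ultimately have "w d i \<le> 1" using i0(1)[of i] by linarith
  then show ?thesis using assms(3) by (simp add: w_def)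
qed

end

context matrix_size
begin

text \<open>The determinant is a polynomial in the entries with integer coefficients.\<close>

lemma dt_rel:
  assumes R: "R 0 0" "R 1 1" "\<And>x y x' y'. R x x' \<Longrightarrow> R y y' \<Longrightarrow> R (x + y) (x' + y')"
      "\<And>x y x' y'. R x x' \<Longrightarrow> R y y' \<Longrightarrow> R (x * y) (x' * y')" "\<And>x x'. R x x' \<Longrightarrow> R (- x) (- x')"
    and entries: "\<And>i j. i < N \<Longrightarrow> j < N \<Longrightarrow> R (unblock N a $$ (i, j)) (unblock N b $$ (i, j))"
  shows "R (dt a) (dt b)"
proof -
  have sum: "R (sum f I) (sum g I)" if "\<And>i. i \<in> I \<Longrightarrow> R (f i) (g i)" for f g and I :: "(nat \<Rightarrow> nat) set"
    using that by (induction I rule: infinite_finite_induct) (auto intro: R)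
  have prod: "R (prod f I) (prod g I)" if "\<And>i. i \<in> I \<Longrightarrow> R (f i) (g i)" for f g and I :: "nat set"
    using that by (induction I rule: infinite_finite_induct) (auto intro: R)
  have "R (signof p * (\<Prod>i = 0..<N. unblock N a $$ (i, p i))) (signof p * (\<Prod>i = 0..<N. unblock N b $$ (i, p i)))"
    if "p permutes {0..<N}" for p
  proof -
    have "R (\<Prod>i = 0..<N. unblock N a $$ (i, p i)) (\<Prod>i = 0..<N. unblock N b $$ (i, p i))"
      using entries permutes_in_image[OF that] by (intro prod) auto
    then show ?thesis by (auto simp: sign_def intro: R)
  qed
  then show ?thesis unfolding dt_def Determinant.det_def by (auto intro!: sum)
qed

lemma dt_hom:
  assumes "comm_ring_hom h" "\<And>i j. i < N \<Longrightarrow> j < N \<Longrightarrow> h (unblock N a $$ (i, j)) = unblock N b $$ (i, j)"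
  shows "h (dt a) = dt b"
proof -
  interpret comm_ring_hom h by fact
  have "map_mat h (unblock N a) = unblock N b"
    by (rule eq_matI) (use assms(2) in auto)
  then show ?thesis unfolding dt_def by (metis hom_det)
qed

lemma unblock_char_matrix:
  "i < N \<Longrightarrow> j < N \<Longrightarrow> unblock N (1 - scalar p * lift a) $$ (i, j) =
    (if i = j then 1 else 0) - p * [:unblock N a $$ (i, j):]"
  by (simp add: unblock_simps unblock_lift)

lemma coeff_0_revchar: "coeff (revchar a) 0 = 1"
proof -
  have "comm_ring_hom (\<lambda>p :: 'a poly. coeff p 0)"
    by unfold_locales (simp_all add: coeff_mult_0)
  then have "coeff (revchar a) 0 = dt 1"
    unfolding revchar_def by (rule dt_hom) (auto simp: unblock_char_matrix unblock_simps)
  then show ?thesis by (simp add: dt_one)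
qed

lemma degree_revchar: "degree (revchar a) \<le> N"
proof -
  have "degree (unblock N (1 - scalar [:0, 1:] * lift a) $$ (i, j)) \<le> 1" if "i < N" "j < N" for i j
    using that by (auto simp: unblock_char_matrix intro!: degree_diff_le)
  then have "degree (revchar a) \<le> 1 * N"
    unfolding revchar_def dt_def by (intro degree_det_le) auto
  then show ?thesis by simp
qed

lemma dt_substituted:
  "dt (1 - scalar q * lift a) = pcompose (revchar a) q"
proof -
  have "comm_ring_hom (\<lambda>p :: 'a poly. pcompose p q)"
    by unfold_locales (simp_all add: pcompose_add pcompose_mult pcompose_1 pcompose_uminus)
  then show ?thesis unfolding revchar_def
    by (intro dt_hom[symmetric]) (auto simp: unblock_char_matrix pcompose_add pcompose_diff pcompose_1 pcompose_pCons)
qed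

lemma coeff_revchar_scale: 
  assumes "a \<in> mats"
  shows "coeff (revchar (scalar c * a)) i = c ^ i * coeff (revchar a) i"
proof -
  have "revchar (scalar c * a) = dt (1 - scalar [:0, c:] * lift a)"
    unfolding revchar_def dt_def
    by (intro arg_cong[of _ _ Determinant.det] eq_matI) (auto simp: unblock_char_matrix unblock_simps unblock_lift)
  then show ?thesis by (simp add: dt_substituted coeff_pcompose_linear)
qed

lemma one_minus_power:
  fixes y :: "'r::ring_1"
  shows "(1 - y) * (\<Sum>i<n. y ^ i) = 1 - y ^ n"
proof (induction n)
  case (Suc n)
  have "(1 - y) * (\<Sum>i<Suc n. y ^ i) = (1 - y) * (\<Sum>i<n. y ^ i) + (1 - y) * y ^ n"
    by (simp add: distrib_left)
  also have "\<dots> = 1 - y ^ Suc n" unfolding Suc.IH by (simp add: left_diff_distrib)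
  finally show ?case .
qed simp

lemma scalar_lift_power:
  "a \<in> mats \<Longrightarrow> (scalar p * lift a) ^ n = scalar (p ^ n) * lift (a ^ n)"
proof (induction n)
  case (Suc n)
  have "(scalar p * lift a) ^ Suc n = scalar p * lift a * (scalar (p ^ n) * lift (a ^ n))"
    using Suc by simp
  also have "\<dots> = scalar p * (lift a * scalar (p ^ n)) * lift (a ^ n)" by (simp only: mult.assoc)
  also have "lift a * scalar (p ^ n) = scalar (p ^ n) * lift a" by (rule scalar_commute[symmetric])
  also have "scalar p * (scalar (p ^ n) * lift a) * lift (a ^ n) = scalar (p ^ Suc n) * lift (a ^ Suc n)"
    using Suc.prems by (simp add: scalar_ring lift_mult mats_power mult.assoc)
  finally show ?case .
qed (simp add: scalar_ring lift_one)

text \<open>The factorization of \<open>1 - (t x) ^ n\<close> with the factor \<open>1 - t x\<close>, under the determinant.\<close>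

lemma revchar_power_factor:
  assumes "a \<in> mats"
  shows "\<exists>q. pcompose (revchar (a ^ n)) (monom 1 n) = revchar a * q"
proof -
  let ?y = "scalar [:0, 1:] * lift a"
  have "dt (1 - ?y) * dt (\<Sum>i<n. ?y ^ i) = dt ((1 - ?y) * (\<Sum>i<n. ?y ^ i))"
    by (intro dt_mult[symmetric]) auto
  also have "\<dots> = dt (1 - scalar (monom 1 n) * lift (a ^ n))"
    by (simp only: one_minus_power) (simp only: scalar_lift_power[OF assms] monom_altdef smult_1_left)
  also have "\<dots> = pcompose (revchar (a ^ n)) (monom 1 n)" by (rule dt_substituted)
  finally show ?thesis unfolding revchar_def by metis
qed

text \<open>Comparing coefficients in \<open>(1 - t a) * adj (1 - t a) = det (1 - t a)\<close> determines the coefficients of the adjugate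
  recursively: that of \<open>t ^ m\<close> is the sum of the terms \<open>chi i * a ^ (m - i)\<close>. The adjugate has degree less than \<open>N\<close>, so that of \<open>t ^ N\<close> vanishes.\<close>

lemma cayley_hamilton_mats:
  assumes a: "a \<in> mats"
  shows "(\<Sum>i\<le>N. scalar (coeff (revchar a) i) * a ^ (N - i)) = 0"
proof -
  define P where "P = unblock N (1 - scalar [:0, 1:] * lift a)"
  define B where "B = adj_mat P"
  have P: "P \<in> carrier_mat N N" by (simp add: P_def)
  have B: "B \<in> carrier_mat N N" "P * B = Determinant.det P \<cdot>\<^sub>m 1\<^sub>m N"
    using adj_mat[OF P] by (simp_all add: B_def)
  have detP: "Determinant.det P = revchar a" by (simp add: P_def revchar_def dt_def)
  have P_index: "P $$ (i, l) = (if i = l then 1 else 0) - [:0, unblock N a $$ (i, l):]" if "i < N" "l < N" for i l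
    using that by (simp add: P_def unblock_char_matrix)
  have entry: "B $$ (i, j) - (\<Sum>l<N. [:0, unblock N a $$ (i, l):] * B $$ (l, j)) = (if i = j then revchar a else 0)"
    if ij: "i < N" "j < N" for i j
  proof -
    have "(P * B) $$ (i, j) = (\<Sum>l<N. P $$ (i, l) * B $$ (l, j))"
      using ij P B(1) by (simp add: scalar_prod_def atLeast0LessThan)
    also have "\<dots> = (\<Sum>l<N. (if l = i then B $$ (i, j) else 0) - [:0, unblock N a $$ (i, l):] * B $$ (l, j))"
      using ij by (intro sum.cong) (auto simp: P_index left_diff_distrib)
    also have "\<dots> = B $$ (i, j) - (\<Sum>l<N. [:0, unblock N a $$ (i, l):] * B $$ (l, j))"
      using ij by (simp add: sum_subtractf del: mult_pCons_left)
    finally show ?thesis using ij B(2) by (cases "i = j") (simp_all add: detP del: mult_pCons_left)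
  qed
  define C where "C m = blocks N (Matrix.mat N N (\<lambda>(i, j). coeff (B $$ (i, j)) m))" for m
  have C_in: "C m \<in> mats" for m unfolding C_def by (intro blocks_in) simp
  have C_index: "unblock N (C m) $$ (i, j) = coeff (B $$ (i, j)) m" if "i < N" "j < N" for m i j
    unfolding C_def using that by (subst unblock_blocks) auto
  have C_eq: "C m = (\<Sum>i\<le>m. scalar (coeff (revchar a) i) * a ^ (m - i))" for m
  proof (induction m)
    case 0
    have "C 0 = scalar (coeff (revchar a) 0)"
    proof (intro mats_eqI C_in mats_scalar eq_matI)
      fix i j assume "i < dim_row (unblock N (scalar (coeff (revchar a) 0)))"
        "j < dim_col (unblock N (scalar (coeff (revchar a) 0)))"
      then have ij: "i < N" "j < N" by simp_all
      have "coeff (B $$ (i, j)) 0 = coeff (if i = j then revchar a else 0) 0"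
        unfolding entry[OF ij, symmetric] by (simp add: coeff_sum)
      then show "unblock N (C 0) $$ (i, j) = unblock N (scalar (coeff (revchar a) 0)) $$ (i, j)"
        using ij by (simp add: C_index unblock_simps)
    qed auto
    then show ?case by simp
  next
    case (Suc m)
    have "C (Suc m) = a * C m + scalar (coeff (revchar a) (Suc m))"
    proof (intro mats_eqI C_in mats_add mats_mult a mats_scalar eq_matI)
      fix i j assume "i < dim_row (unblock N (a * C m + scalar (coeff (revchar a) (Suc m))))"
        "j < dim_col (unblock N (a * C m + scalar (coeff (revchar a) (Suc m))))"
      then have ij: "i < N" "j < N" by simp_all
      have "coeff (B $$ (i, j)) (Suc m) - (\<Sum>l<N. unblock N a $$ (i, l) * coeff (B $$ (l, j)) m)
          = coeff (if i = j then revchar a else 0) (Suc m)"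
        unfolding entry[OF ij, symmetric] by (simp add: coeff_sum)
      then show "unblock N (C (Suc m)) $$ (i, j) =
          unblock N (a * C m + scalar (coeff (revchar a) (Suc m))) $$ (i, j)"
        using ij a C_in by (simp add: C_index unblock_simps unblock_mult_index diff_eq_eq add.commute del: index_mult_mat)
    qed auto
    also have "a * C m = (\<Sum>i\<le>m. scalar (coeff (revchar a) i) * a ^ (Suc m - i))"
      unfolding Suc.IH sum_distrib_left
    proof (intro sum.cong refl)
      fix i assume "i \<in> {..m}"
      then have "Suc m - i = Suc (m - i)" by auto
      then show "a * (scalar (coeff (revchar a) i) * a ^ (m - i)) = scalar (coeff (revchar a) i) * a ^ (Suc m - i)"
        using scalar_commute[of "coeff (revchar a) i" a] by (simp add: mult.assoc[symmetric])
    qed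
    finally show ?case by simp
  qed
  have "degree (B $$ (i, j)) < N" if ij: "i < N" "j < N" for i j
  proof -
    have "degree (P $$ (i, j)) \<le> 1" if "i < N" "j < N" for i j
      using that by (auto simp: P_index intro!: degree_diff_le)
    then have "degree (Determinant.det (mat_delete P j i)) \<le> 1 * (N - 1)"
      using P ij by (intro degree_det_le) (auto simp: mat_delete_def)
    moreover have "B $$ (i, j) = (-1) ^ (j + i) * Determinant.det (mat_delete P j i)"
      using ij P by (simp add: B_def adj_mat_def cofactor_def)
    moreover have "degree ((-1) ^ (j + i) * q) = degree q" for q :: "'a poly"
      by (cases "even (j + i)") auto
    ultimately show ?thesis using N_pos by simp
  qed
  then have "C N = 0"
    by (intro mats_eqI C_in mats_zero eq_matI) (auto simp: C_index unblock_simps coeff_eq_0)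
  then show ?thesis using C_eq by simp
qed

end

locale valued_matrices = nonarch_local_field v + matrix_size N
  for v :: "'f::field \<Rightarrow> real" and N
begin

definition nm :: "'f lin \<Rightarrow> real" where
  "nm a = Max ((\<lambda>(i, j). v (unblock N a $$ (i, j))) ` ({..<N} \<times> {..<N}))"

lemma nm_ge: "i < N \<Longrightarrow> j < N \<Longrightarrow> v (unblock N a $$ (i, j)) \<le> nm a"
  unfolding nm_def by (intro Max_ge) auto

lemma nm_le_iff: "nm a \<le> C \<longleftrightarrow> (\<forall>i<N. \<forall>j<N. v (unblock N a $$ (i, j)) \<le> C)"
  unfolding nm_def using N_pos by (subst Max_le_iff) auto

lemma nm_attained: "\<exists>i<N. \<exists>j<N. nm a = v (unblock N a $$ (i, j))"
proof -
  have "nm a \<in> (\<lambda>(i, j). v (unblock N a $$ (i, j))) ` ({..<N} \<times> {..<N})"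
    unfolding nm_def using N_pos by (intro Max_in) auto
  then show ?thesis by auto
qed

lemma nm_nonneg': "0 \<le> nm a"
  using nm_attained[of a] nonneg by auto

lemma coeff_revchar_le: "v (coeff (revchar a) i) \<le> nm a ^ i"
proof -
  let ?R = "\<lambda>p (q::'f poly). \<forall>i. v (coeff p i) \<le> nm a ^ i"
  have "?R (revchar a) (revchar a)"
    unfolding revchar_def
  proof (rule dt_rel[where R = ?R])
    show "?R 0 0" using nm_nonneg' by simp
    show "?R 1 1" using nm_nonneg' by (simp add: coeff_1)
    show "?R (x + y) (x' + y')" if "?R x x'" "?R y y'" for x y x' y'
      using that ultrametric max.boundedI order_trans by (metis coeff_add)
    show "?R (- x) (- x')" if "?R x x'" for x x' using that by simp
    show "?R (x * y) (x' * y')" if xy: "?R x x'" "?R y y'" for x y x' y'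
    proof
      fix i
      show "v (coeff (x * y) i) \<le> nm a ^ i" unfolding coeff_mult
      proof (rule v_sum_le)
        fix l assume l: "l \<in> {..i}"
        have "v (coeff x l * coeff y (i - l)) \<le> nm a ^ l * nm a ^ (i - l)"
          unfolding mult using xy nonneg nm_nonneg' by (intro mult_mono) auto
        also have "\<dots> = nm a ^ i" using l by (simp flip: power_add)
        finally show "v (coeff x l * coeff y (i - l)) \<le> nm a ^ i" .
      qed (use nm_nonneg' in simp)
    qed
    show "?R (unblock N (1 - scalar [:0, 1:] * lift a) $$ (i, j)) (unblock N (1 - scalar [:0, 1:] * lift a) $$ (i, j))"
      if "i < N" "j < N" for i j
      using that nm_ge[OF that] nm_nonneg'
      by (auto simp: unblock_char_matrix coeff_pCons coeff_1 split: nat.split)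
  qed
  then show ?thesis by blast
qed

lemma coeff_revchar_diff_le:
  assumes C: "1 \<le> C" "nm a \<le> C" "nm b \<le> C"
  shows "v (coeff (revchar a) i - coeff (revchar b) i) \<le> nm (a - b) * C ^ i"
proof -
  let ?e = "nm (a - b)"
  let ?R = "\<lambda>p q. \<forall>i. v (coeff p i) \<le> C ^ i \<and> v (coeff q i) \<le> C ^ i \<and> v (coeff p i - coeff q i) \<le> ?e * C ^ i"
  have C0: "0 \<le> C" using C by simp
  have e: "0 \<le> ?e" by (rule nm_nonneg')
  have prod_le: "v (\<Sum>l\<le>i. f l) \<le> c * C ^ i" if "\<And>l. l \<le> i \<Longrightarrow> v (f l) \<le> c * (C ^ l * C ^ (i - l))" "0 \<le> c" for f i c
  proof (rule v_sum_le)
    fix l assume l: "l \<in> {..i}"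
    then have "C ^ l * C ^ (i - l) = C ^ i" by (simp flip: power_add)
    then show "v (f l) \<le> c * C ^ i" using that(1)[of l] l by simp
  qed (use that C in simp)
  have "?R (revchar a) (revchar b)"
    unfolding revchar_def
  proof (rule dt_rel[where R = ?R])
    show "?R 0 0" using C e by simp
    show "?R 1 1" using C e by (simp add: coeff_1)
    show "?R (- x) (- x')" if "?R x x'" for x x'
      using that by (simp add: v_minus_commute)
    show "?R (x + y) (x' + y')" if xy: "?R x x'" "?R y y'" for x y x' y'
    proof (intro allI conjI)
      fix i
      show "v (coeff (x + y) i) \<le> C ^ i" "v (coeff (x' + y') i) \<le> C ^ i"
        using xy ultrametric[of "coeff x i" "coeff y i"] ultrametric[of "coeff x' i" "coeff y' i"]
        by (auto intro: order_trans)
      have eq: "coeff (x + y) i - coeff (x' + y') i = (coeff x i - coeff x' i) + (coeff y i - coeff y' i)" by simp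
      show "v (coeff (x + y) i - coeff (x' + y') i) \<le> ?e * C ^ i"
        unfolding eq using xy by (intro order_trans[OF ultrametric]) auto
    qed
    show "?R (x * y) (x' * y')" if xy: "?R x x'" "?R y y'" for x y x' y'
    proof (intro allI conjI)
      fix i
      have "v (coeff (x * y) i) \<le> 1 * C ^ i"
        unfolding coeff_mult using xy C nonneg by (intro prod_le) (auto simp: mult intro!: mult_mono)
      then show "v (coeff (x * y) i) \<le> C ^ i" by simp
      have "v (coeff (x' * y') i) \<le> 1 * C ^ i"
        unfolding coeff_mult using xy C nonneg by (intro prod_le) (auto simp: mult intro!: mult_mono)
      then show "v (coeff (x' * y') i) \<le> C ^ i" by simp
      have eq: "coeff (x * y) i - coeff (x' * y') i =
        (\<Sum>l\<le>i. (coeff x l - coeff x' l) * coeff y (i - l) + coeff x' l * (coeff y (i - l) - coeff y' (i - l)))"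
        unfolding coeff_mult sum_subtractf[symmetric] by (simp add: algebra_simps)
      show "v (coeff (x * y) i - coeff (x' * y') i) \<le> ?e * C ^ i"
        unfolding eq
      proof (rule prod_le[OF _ e])
        fix l
        have "v ((coeff x l - coeff x' l) * coeff y (i - l)) \<le> (?e * C ^ l) * C ^ (i - l)"
          unfolding mult using xy nonneg e C by (intro mult_mono) auto
        moreover have "v (coeff x' l * (coeff y (i - l) - coeff y' (i - l))) \<le> C ^ l * (?e * C ^ (i - l))"
          unfolding mult using xy nonneg e C by (intro mult_mono) auto
        ultimately show "v ((coeff x l - coeff x' l) * coeff y (i - l) + coeff x' l * (coeff y (i - l) - coeff y' (i - l)))
            \<le> ?e * (C ^ l * C ^ (i - l))"
          by (intro order_trans[OF ultrametric]) (simp add: mult_ac)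
      qed
    qed
    show "?R (unblock N (1 - scalar [:0, 1:] * lift a) $$ (i, j)) (unblock N (1 - scalar [:0, 1:] * lift b) $$ (i, j))"
      if ij: "i < N" "j < N" for i j
    proof -
      have "v (unblock N a $$ (i, j)) \<le> C" "v (unblock N b $$ (i, j)) \<le> C"
        using nm_ge[OF ij] C order_trans by blast+
      moreover have "v (unblock N a $$ (i, j) - unblock N b $$ (i, j)) \<le> ?e * C"
      proof -
        have "v (unblock N a $$ (i, j) - unblock N b $$ (i, j)) \<le> ?e * 1"
          using nm_ge[OF ij, of "a - b"] ij by (simp add: unblock_simps)
        also have "\<dots> \<le> ?e * C" using C e by (intro mult_left_mono)
        finally show ?thesis .
      qed
      ultimately show ?thesis using ij C0 e
        by (auto simp: unblock_char_matrix coeff_pCons coeff_1 v_minus_commute split: nat.split)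
    qed
  qed
  then show ?thesis by blast
qed

text \<open>The reversed characteristic polynomial of \<open>a\<close> divides that of \<open>a ^ K\<close> with \<open>t ^ K\<close> substituted for \<open>t\<close>. Gauss's lemma with
  the radius \<open>root K C\<close> carries the bound over to this factor.\<close>

lemma coeff_revchar_power_le:
  assumes a: "a \<in> mats" and K: "0 < K" and C: "0 < C" "\<And>i. v (coeff (revchar (a ^ K)) i) \<le> C ^ i"
  shows "v (coeff (revchar a) i) ^ K \<le> C ^ i"
proof -
  obtain q where q: "pcompose (revchar (a ^ K)) (monom 1 K) = revchar a * q"
    using revchar_power_factor[OF a] by blast
  define r where "r = root K C"
  have r: "0 < r" "r ^ K = C" using K C(1) by (simp_all add: r_def)
  have coeff: "v (coeff (revchar a * q) m) \<le> r ^ m" for m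
  proof -
    have "coeff (pcompose (revchar (a ^ K)) (monom 1 K)) m =
        (if m mod K = 0 then coeff (revchar (a ^ K)) (m div K) else 0)"
      using coeff_pcompose_monom[of "m mod K" K "revchar (a ^ K)" "m div K"] K by simp
    moreover have "v (coeff (revchar (a ^ K)) (m div K)) \<le> r ^ m" if "m mod K = 0"
    proof -
      have "m = K * (m div K)" using that by auto
      then have "r ^ m = C ^ (m div K)" by (metis power_mult r(2))
      then show ?thesis using C(2) by simp
    qed
    ultimately show ?thesis unfolding q[symmetric] using r(1) by auto
  qed
  have "coeff q 0 = 1"
  proof -
    have "coeff (revchar a * q) 0 = coeff (revchar (a ^ K)) 0"
      unfolding q[symmetric] using coeff_pcompose_monom[of 0 K "revchar (a ^ K)" 0] K by simp
    then show ?thesis by (simp add: coeff_mult_0 coeff_0_revchar)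
  qed
  then have "v (coeff (revchar a) i) \<le> r ^ i"
    by (rule gauss_factor_bound[OF coeff_0_revchar _ r(1) coeff])
  then have "v (coeff (revchar a) i) ^ K \<le> (r ^ i) ^ K" using nonneg by (intro power_mono)
  also have "\<dots> = C ^ i" using r(2) by (metis power_mult mult.commute)
  finally show ?thesis .
qed

end

section \<open>Amitsur's formula\<close>

text \<open>Let a set \<open>M\<close> of matrices be closed under products. Amitsur expresses \<open>det (1 - t (a + b + \<dots>))\<close> for \<open>a, b, \<dots> \<in> M\<close> by
  the polynomials \<open>det (1 - t ^ n w)\<close> for products \<open>w\<close> of length \<open>n\<close> of these letters. Here the formula is unrolled
  step by step. A letter of weight \<open>m\<close> is a matrix multiplied by \<open>t ^ m\<close>. Eliminating one letter \<open>a\<close> replaces every other letter \<open>b\<close>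
  by the letters \<open>b, a b, a a b, \<dots>\<close> of increasing weight. Modulo a fixed power of \<open>t\<close> this
  process ends, because all letters of the smallest weight disappear in finitely many
  steps.\<close>

context matrix_size
begin

lemma coeff_dt_cong:
  assumes "\<And>i j l. i < N \<Longrightarrow> j < N \<Longrightarrow> l \<le> T \<Longrightarrow>
      coeff (unblock N a $$ (i, j)) l = coeff (unblock N b $$ (i, j)) l"
    and "l \<le> T"
  shows "coeff (dt a) l = coeff (dt b) l"
proof -
  let ?R = "\<lambda>p q. \<forall>l\<le>T. coeff p l = coeff q l"
  have "?R (dt a) (dt b)"
  proof (rule dt_rel[where R = ?R])
    show "?R (x * y) (x' * y')" if "?R x x'" "?R y y'" for x y x' y' :: "'a poly"
      unfolding coeff_mult using that by (intro allI impI sum.cong) auto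
  qed (use assms(1) in auto)
  then show ?thesis using assms(2) by blast
qed

definition weighted :: "(nat \<times> 'c::comm_ring_1 lin) list \<Rightarrow> 'c poly lin" where
  "weighted L = (\<Sum>(e, a)\<leftarrow>L. scalar (monom 1 e) * lift a)"

lemma weighted_simps [simp]:
  "weighted [] = 0" "weighted ((e, a) # L) = scalar (monom 1 e) * lift a + weighted L"
  "weighted (L @ L') = weighted L + weighted L'"
  by (simp_all add: weighted_def)

lemma weighted_in: "weighted L \<in> mats"
  by (induction L) (auto simp: weighted_def)

lemma weighted_filter: "weighted (filter P L) + weighted (filter (\<lambda>x. \<not> P x) L) = weighted L"
  by (induction L) (auto simp: weighted_def algebra_simps)

lemma weighted_mult:
  assumes "a \<in> mats" "\<And>e b. (e, b) \<in> set L \<Longrightarrow> b \<in> mats"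
  shows "scalar (monom 1 m) * lift a * weighted L = weighted (map (\<lambda>(e, b). (m + e, a * b)) L)"
  using assms(2)
proof (induction L)
  case (Cons x L)
  obtain e b where x: "x = (e, b)" by (cases x)
  then have b: "b \<in> mats" using Cons.prems by auto
  have "scalar (monom 1 m) * lift a * (scalar (monom 1 e) * lift b)
      = scalar (monom 1 m) * (lift a * scalar (monom 1 e)) * lift b" by (simp only: mult.assoc)
  also have "lift a * scalar (monom 1 e) = scalar (monom 1 e) * lift a" by (rule scalar_commute[symmetric])
  also have "scalar (monom 1 m) * (scalar (monom 1 e) * lift a) * lift b
      = scalar (monom 1 m * monom 1 e) * (lift a * lift b)" by (simp only: mult.assoc scalar_ring)
  also have "\<dots> = scalar (monom 1 (m + e)) * lift (a * b)"
    using assms(1) b by (simp add: mult_monom lift_mult)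
  finally have head: "scalar (monom 1 m) * lift a * (scalar (monom 1 e) * lift b)
      = scalar (monom 1 (m + e)) * lift (a * b)" .
  have "scalar (monom 1 m) * lift a * weighted L = weighted (map (\<lambda>(e, b). (m + e, a * b)) L)"
    using Cons.prems by (intro Cons.IH) auto
  then show ?case by (simp add: x distrib_left head)
qed simp

lemma weighted_large_coeff:
  assumes "\<And>e b. (e, b) \<in> set L \<Longrightarrow> T < e" "l \<le> T" "i < N" "j < N"
  shows "coeff (unblock N (weighted L) $$ (i, j)) l = 0"
  using assms(1)
proof (induction L)
  case (Cons x L)
  obtain e b where x: "x = (e, b)" by (cases x)
  then have "T < e" using Cons.prems by auto
  moreover have "coeff (unblock N (weighted L) $$ (i, j)) l = 0"
    using Cons.prems by (intro Cons.IH) auto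
  ultimately show ?case
    using x assms(2-4) by (simp add: unblock_simps unblock_lift coeff_monom_mult)
qed (use assms in \<open>simp add: unblock_simps\<close>)

text \<open>With \<open>y\<close> the letter to be eliminated and \<open>W\<close> the sum of the others,
  \<open>(1 - y) * (1 - (1 + y + y ^ 2 + \<dots>) * W) = 1 - y - W\<close>, where the series may be truncated after \<open>y ^ T\<close>.\<close>

lemma eliminate_letter:
  assumes a: "a \<in> mats" and L: "\<And>e b. (e, b) \<in> set L \<Longrightarrow> b \<in> mats" and m: "0 < m" "l \<le> T"
  defines "C \<equiv> concat (map (\<lambda>j. map (\<lambda>(e, b). (m * j + e, a ^ j * b)) L) [1..<Suc T])"
  shows "coeff (dt (1 - weighted ((m, a) # L))) l
    = coeff (pcompose (revchar a) (monom 1 m) * dt (1 - weighted (L @ C))) l"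
proof -
  define y where "y = scalar (monom 1 m) * lift a"
  define W where "W = weighted L"
  have y_in: "y \<in> mats" unfolding y_def by auto
  have W_in: "W \<in> mats" unfolding W_def by (rule weighted_in)
  have y_power: "y ^ j = scalar (monom 1 (m * j)) * lift (a ^ j)" for j
    unfolding y_def using a by (simp add: scalar_lift_power monom_power)
  have "weighted C = (\<Sum>j\<leftarrow>[1..<Suc T]. weighted (map (\<lambda>(e, b). (m * j + e, a ^ j * b)) L))"
    unfolding C_def by (induction T) simp_all
  also have "\<dots> = (\<Sum>j\<leftarrow>[1..<Suc T]. y ^ j * W)"
    unfolding y_power W_def using a L by (simp add: weighted_mult mats_power)
  also have "\<dots> = (\<Sum>j=1..<Suc T. y ^ j * W)" by (simp add: interv_sum_list_conv_sum_set_nat del: upt_Suc)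
  finally have C: "weighted C = (\<Sum>j=1..<Suc T. y ^ j * W)" .
  have "weighted (L @ C) = (\<Sum>j<Suc T. y ^ j * W)"
    by (simp add: C W_def[symmetric] lessThan_atLeast0 sum.atLeast_Suc_lessThan del: sum.op_ivl_Suc)
  then have LC: "weighted (L @ C) = (\<Sum>j<Suc T. y ^ j) * W" by (simp only: sum_distrib_right)
  have "(1 - y) * (1 - weighted (L @ C)) = (1 - y) - ((1 - y) * (\<Sum>j<Suc T. y ^ j)) * W"
    unfolding LC by (simp only: right_diff_distrib mult_1_right mult.assoc)
  also have "\<dots> = 1 - y - (1 - y ^ Suc T) * W" by (simp only: one_minus_power)
  finally have eq: "(1 - y) * (1 - weighted (L @ C)) = 1 - weighted ((m, a) # L) + y ^ Suc T * W"
    by (simp add: W_def y_def left_diff_distrib)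
  have "coeff (dt (1 - weighted ((m, a) # L))) l = coeff (dt (1 - weighted ((m, a) # L) + y ^ Suc T * W)) l"
  proof (rule coeff_dt_cong[OF _ m(2)])
    fix i j l' assume ij: "i < N" "j < N" and l': "l' \<le> T"
    have "T < m * Suc T" using m(1) by (cases m) auto
    then have "coeff (unblock N (y ^ Suc T * W) $$ (i, j)) l' = 0"
      unfolding y_power W_def using a L l' ij
      by (subst weighted_mult) (auto intro!: weighted_large_coeff mats_power)
    then show "coeff (unblock N (1 - weighted ((m, a) # L)) $$ (i, j)) l' =
        coeff (unblock N (1 - weighted ((m, a) # L) + y ^ Suc T * W) $$ (i, j)) l'"
      using ij by (simp add: unblock_simps)
  qed
  also have "dt (1 - weighted ((m, a) # L) + y ^ Suc T * W) = dt (1 - y) * dt (1 - weighted (L @ C))"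
    unfolding eq[symmetric] using y_in by (intro dt_mult mats_diff mats_one weighted_in)
  also have "dt (1 - y) = pcompose (revchar a) (monom 1 m)" unfolding y_def by (rule dt_substituted)
  finally show ?thesis .
qed

end

context valued_matrices
begin

lemma integral_pcompose_monom:
  assumes "0 < m" "\<And>i. v (coeff p i) \<le> 1"
  shows "v (coeff (pcompose p (monom 1 m)) l) \<le> 1"
  using coeff_pcompose_monom[of "l mod m" m p "l div m"] assms by (auto split: if_splits)

lemma coeff_mult_le_1:
  assumes "\<And>l. l \<le> T \<Longrightarrow> v (coeff p l) \<le> 1" "\<And>l. l \<le> T \<Longrightarrow> v (coeff q l) \<le> 1" "l \<le> T"
  shows "v (coeff (p * q) l) \<le> 1"
  unfolding coeff_mult
proof (rule v_sum_le)
  fix i assume "i \<in> {..l}"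
  then show "v (coeff p i * coeff q (l - i)) \<le> 1"
    using assms nonneg by (simp add: mult mult_le_one)
qed simp

text \<open>Descending induction on the smallest weight \<open>m\<close>; for \<open>m > T\<close> no letter contributes. Within the step, the letters
  of weight \<open>m\<close> are eliminated one by one. All letters that arise lie in \<open>M\<close>, and the new ones have larger
  weight.\<close>

lemma integral_weighted:
  assumes M: "M \<subseteq> mats" "\<And>x y. x \<in> M \<Longrightarrow> y \<in> M \<Longrightarrow> x * y \<in> M"
    and int: "\<And>x i. x \<in> M \<Longrightarrow> v (coeff (revchar x) i) \<le> 1"
    and L: "\<And>e b. (e, b) \<in> set L \<Longrightarrow> m \<le> e \<and> b \<in> M" "0 < m" and l: "l \<le> T"
  shows "v (coeff (dt (1 - weighted L)) l) \<le> 1"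
  using L l
proof (induction "Suc T - m" arbitrary: m L l rule: less_induct)
  case less
  show ?case
  proof (cases "T < m")
    case True
    have "coeff (dt (1 - weighted L)) l = coeff (dt 1) l"
    proof (rule coeff_dt_cong)
      fix i j l' assume "i < N" "j < N" "l' \<le> T"
      moreover have "T < e" if "(e, b) \<in> set L" for e b
        using less.prems(1)[OF that] True by simp
      ultimately show "coeff (unblock N (1 - weighted L) $$ (i, j)) l' = coeff (unblock N 1 $$ (i, j)) l'"
        using weighted_large_coeff[of L T l' i j] by (simp add: unblock_simps)
    qed (use less.prems in simp)
    then show ?thesis by (simp add: dt_one coeff_1)
  next
    case False
    have split: "v (coeff (dt (1 - weighted (map (Pair m) A @ B))) l) \<le> 1"
      if "set A \<subseteq> M" "\<And>e b. (e, b) \<in> set B \<Longrightarrow> m < e \<and> b \<in> M" "l \<le> T" for A B l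
      using that
    proof (induction A arbitrary: B l)
      case Nil
      have "v (coeff (dt (1 - weighted B)) l) \<le> 1"
      proof (rule less.hyps)
        show "Suc T - Suc m < Suc T - m" using False by auto
        show "Suc m \<le> e \<and> b \<in> M" if "(e, b) \<in> set B" for e b using Nil.prems(2)[OF that] by simp
      qed (use Nil in auto)
      then show ?case by simp
    next
      case (Cons a A)
      have aM: "a \<in> M" using Cons.prems by simp
      let ?L = "map (Pair m) A @ B"
      let ?C = "concat (map (\<lambda>j. map (\<lambda>(e, b). (m * j + e, a ^ j * b)) ?L) [1..<Suc T])"
      have L_in: "m \<le> e \<and> b \<in> M" if "(e, b) \<in> set ?L" for e b
        using that Cons.prems(1) Cons.prems(2)[of e b] by auto
      have pow: "a ^ j * b \<in> M" if "b \<in> M" for j b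
        using that by (induction j) (auto simp: mult.assoc intro: M(2)[OF aM])
      have C_in: "m < e \<and> b \<in> M" if "(e, b) \<in> set ?C" for e b
      proof -
        obtain j where j: "j \<in> {1..<Suc T}" "(e, b) \<in> (\<lambda>(e, b). (m * j + e, a ^ j * b)) ` set ?L"
          using \<open>(e, b) \<in> set ?C\<close> by (simp only: set_concat set_map set_upt image_image UN_iff) (elim bexE)
        then obtain e' b' where *: "(e', b') \<in> set ?L" "j \<in> {1..<Suc T}" "e = m * j + e'" "b = a ^ j * b'"
          by (elim imageE) (simp split: prod.splits)
        have "0 < m * j" using *(2) less.prems(2) by simp
        then have "m < e" using L_in[OF *(1)] *(3) by linarith
        then show ?thesis using L_in[OF *(1)] *(4) pow by blast
      qed
      have eq: "coeff (dt (1 - weighted ((m, a) # ?L))) l'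
          = coeff (pcompose (revchar a) (monom 1 m) * dt (1 - weighted (?L @ ?C))) l'" if "l' \<le> T" for l'
        using L_in M(1) aM less.prems(2) that by (intro eliminate_letter) blast+
      have "v (coeff (dt (1 - weighted (?L @ ?C))) l') \<le> 1" if "l' \<le> T" for l'
      proof -
        have "v (coeff (dt (1 - weighted (map (Pair m) A @ (B @ ?C)))) l') \<le> 1"
        proof (rule Cons.IH)
          show "m < e \<and> b \<in> M" if "(e, b) \<in> set (B @ ?C)" for e b
            using that Cons.prems(2)[of e b] C_in[of e b] unfolding set_append Un_iff by blast
        qed (use Cons.prems that in auto)
        then show ?thesis by (simp only: append_assoc)
      qed
      then have "v (coeff (pcompose (revchar a) (monom 1 m) * dt (1 - weighted (?L @ ?C))) l) \<le> 1"
        using int[OF aM] less.prems(2) Cons.prems(3) by (intro coeff_mult_le_1[of T] integral_pcompose_monom)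
      then show ?case using eq[OF Cons.prems(3)] by simp
    qed
    let ?A = "filter (\<lambda>x. fst x = m) L" and ?B = "filter (\<lambda>x. \<not> fst x = m) L"
    have A: "map (Pair m) (map snd ?A) = ?A" by (induction L) auto
    have "v (coeff (dt (1 - weighted (map (Pair m) (map snd ?A) @ ?B))) l) \<le> 1"
    proof (rule split)
      show "m < e \<and> b \<in> M" if "(e, b) \<in> set ?B" for e b
        using that less.prems(1)[of e b] by auto
    qed (use less.prems in fastforce)+
    then show ?thesis unfolding A by (simp add: weighted_filter)
  qed
qed

lemma integral_sum_list:
  assumes "M \<subseteq> mats" "\<And>x y. x \<in> M \<Longrightarrow> y \<in> M \<Longrightarrow> x * y \<in> M"
    "\<And>x i. x \<in> M \<Longrightarrow> v (coeff (revchar x) i) \<le> 1" "set xs \<subseteq> M"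
  shows "v (coeff (revchar (sum_list xs)) i) \<le> 1"
proof -
  have xs: "set xs \<subseteq> mats" using assms by blast
  then have "lift (sum_list xs) = sum_list (map lift xs) \<and> sum_list xs \<in> mats"
  proof (induction xs)
    case Nil
    have "lift 0 = 0" by (intro mats_eqI lift_in mats_zero eq_matI) (auto simp: unblock_lift unblock_simps)
    then show ?case by simp
  next
    case (Cons x xs)
    have "lift (x + y) = lift x + lift y" for y
      by (intro mats_eqI lift_in mats_add eq_matI) (auto simp: unblock_lift unblock_simps)
    then show ?case using Cons by auto
  qed
  then have "scalar [:0, 1:] * lift (sum_list xs) = weighted (map (Pair 1) xs)"
    by (simp add: weighted_def sum_list_const_mult o_def monom_altdef)
  then have "revchar (sum_list xs) = dt (1 - weighted (map (Pair 1) xs))"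
    by (simp add: revchar_def)
  moreover have "v (coeff (dt (1 - weighted (map (Pair 1) xs))) i) \<le> 1"
    using assms(4) by (intro integral_weighted[OF assms(1-3), of _ 1 _ i]) auto
  ultimately show ?thesis by simp
qed

lemma nm_mult_le:
  assumes "a \<in> mats" "b \<in> mats"
  shows "nm (a * b) \<le> nm a * nm b"
  unfolding nm_le_iff
proof (intro allI impI)
  fix i j assume ij: "i < N" "j < N"
  show "v (unblock N (a * b) $$ (i, j)) \<le> nm a * nm b"
    unfolding unblock_mult_index[OF assms ij]
  proof (rule v_sum_le)
    fix l assume l: "l \<in> {..<N}"
    show "v (unblock N a $$ (i, l) * unblock N b $$ (l, j)) \<le> nm a * nm b"
      unfolding mult using l ij nonneg nm_nonneg' by (intro mult_mono nm_ge) auto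
  qed (simp add: nm_nonneg')
qed

lemma ex_entries:
  fixes f :: "nat \<Rightarrow> nat \<Rightarrow> 'f"
  shows "\<exists>a\<in>mats. \<forall>i<N. \<forall>j<N. unblock N a $$ (i, j) = f i j"
  by (intro bexI[of _ "blocks N (Matrix.mat N N (\<lambda>(i, j). f i j))"] blocks_in)
    (auto simp: unblock_blocks)

lemma nm_tendsto_0_if_entries:
  assumes "\<And>i j. i < N \<Longrightarrow> j < N \<Longrightarrow> null_diff (\<lambda>n. unblock N (X n) $$ (i, j)) (unblock N a $$ (i, j))"
  shows "(\<lambda>n. nm (X n - a)) \<longlonglongrightarrow> 0"
proof (rule tendsto_sandwich[OF _ _ tendsto_const])
  let ?I = "{..<N} \<times> {..<N}"
  let ?d = "\<lambda>n x. v (unblock N (X n) $$ x - unblock N a $$ x)"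
  show "\<forall>\<^sub>F n in sequentially. 0 \<le> nm (X n - a)" by (simp add: nm_nonneg')
  show "\<forall>\<^sub>F n in sequentially. nm (X n - a) \<le> (\<Sum>x\<in>?I. ?d n x)"
  proof (intro always_eventually allI)
    fix n
    obtain i j where ij: "i < N" "j < N" "nm (X n - a) = v (unblock N (X n - a) $$ (i, j))"
      using nm_attained by blast
    then have "nm (X n - a) = ?d n (i, j)" by (simp add: unblock_simps)
    also have "\<dots> \<le> (\<Sum>x\<in>?I. ?d n x)"
      using ij nonneg by (intro member_le_sum[of "(i, j)" ?I "?d n"]) auto
    finally show "nm (X n - a) \<le> (\<Sum>x\<in>?I. ?d n x)" .
  qed
  have "(\<lambda>n. \<Sum>x\<in>?I. ?d n x) \<longlonglongrightarrow> (\<Sum>x\<in>?I. 0)"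
    using assms by (intro tendsto_sum) (auto simp: null_diff_def)
  then show "(\<lambda>n. \<Sum>x\<in>?I. ?d n x) \<longlonglongrightarrow> 0" by simp
qed

lemma nm_bounded_subsequence:
  assumes "\<And>n. X n \<in> mats" "\<And>n. nm (X n) \<le> C"
  shows "\<exists>l r. l \<in> mats \<and> strict_mono (r :: nat \<Rightarrow> nat) \<and> (\<lambda>n. nm (X (r n) - l)) \<longlonglongrightarrow> 0"
proof -
  let ?I = "{..<N} \<times> {..<N}"
  obtain l r where lr: "strict_mono (r :: nat \<Rightarrow> nat)"
      "\<forall>x\<in>?I. null_diff (\<lambda>n. unblock N (X (r n)) $$ x) (l x)"
  proof (rule exE[OF bounded_family_subsequence[of ?I "\<lambda>n x. unblock N (X n) $$ x" C]])
    show "v (unblock N (X n) $$ x) \<le> C" if "x \<in> ?I" for n x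
      using that nm_ge[of "fst x" "snd x" "X n"] assms(2)[of n] by auto
  qed auto
  obtain a where a: "a \<in> mats" "\<And>i j. i < N \<Longrightarrow> j < N \<Longrightarrow> unblock N a $$ (i, j) = l (i, j)"
    using ex_entries[of "\<lambda>i j. l (i, j)"] by blast
  have "(\<lambda>n. nm (X (r n) - a)) \<longlonglongrightarrow> 0"
    using lr(2) by (intro nm_tendsto_0_if_entries) (auto simp: a(2))
  then show ?thesis using lr(1) a(1) by blast
qed

text \<open>An \<open>N \<times> N\<close> matrix is a vector with \<open>N * N\<close> coordinates, indexed by \<open>i * N + j\<close>.\<close>

lemma mats_dependent:
  assumes "\<And>i. Y i \<in> mats"
  shows "\<exists>c. (\<exists>i\<le>N * N. c i \<noteq> 0) \<and> (\<Sum>i\<le>N * N. scalar (c i) * Y (i::nat)) = (0 :: 'f lin)"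
proof -
  obtain c where c: "\<exists>i\<le>N * N. c i \<noteq> 0"
      "\<And>r. r < N * N \<Longrightarrow> (\<Sum>i\<le>N * N. c i * unblock N (Y i) $$ (r div N, r mod N)) = 0"
    using homogeneous_system_solution[of "N * N" "\<lambda>r i. unblock N (Y i) $$ (r div N, r mod N)"] by blast
  have "(\<Sum>i\<le>N * N. scalar (c i) * Y i) = 0"
  proof (intro mats_eqI mats_sum mats_scale assms mats_zero eq_matI)
    fix i j assume "i < dim_row (unblock N (0::'f lin))" "j < dim_col (unblock N (0::'f lin))"
    then have ij: "i < N" "j < N" by simp_all
    have "i * N + j < Suc i * N" using ij by simp
    also have "\<dots> \<le> N * N" using ij by (intro mult_le_mono1) simp
    finally have "i * N + j < N * N" .
    from c(2)[OF this] show "unblock N (\<Sum>i\<le>N * N. scalar (c i) * Y i) $$ (i, j) = unblock N 0 $$ (i, j)"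
      using ij by (simp add: unblock_sum_index unblock_simps)
  qed auto
  then show ?thesis using c(1) by blast
qed

sublocale valued_algebra v scalar mats nm "\<lambda>a i. coeff (revchar a) i" N "N * N"
proof
  fix a b :: "'f lin" and c c' :: 'f
  show "scalar (c + c') = scalar c + scalar c'" "scalar (c * c') = scalar c * scalar c'" "scalar 1 = 1"
    by (simp_all add: scalar_ring)
  show "scalar c * a = a * scalar c" by (rule scalar_commute)
  show "scalar c \<in> mats" ..
  show "0 \<le> nm a" by (rule nm_nonneg')
  show "nm 1 = 1"
  proof (rule antisym)
    show "nm 1 \<le> 1" unfolding nm_le_iff by (auto simp: unblock_simps)
    show "1 \<le> nm 1" using nm_ge[of 0 0 1] N_pos by (simp add: unblock_simps)
  qed
  show "coeff (revchar a) 0 = 1" by (rule coeff_0_revchar)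
  show "v (coeff (revchar a) i) \<le> nm a ^ i" for i by (rule coeff_revchar_le)
  show "coeff (revchar a) i = 0" if "N < i" for i
    using degree_revchar[of a] that by (intro coeff_eq_0) simp
  assume a: "a \<in> mats"
  show "nm a = 0 \<longleftrightarrow> a = 0"
  proof
    assume *: "nm a = 0"
    have "v (unblock N a $$ (i, j)) = 0" if "i < N" "j < N" for i j
      using nm_ge[OF that, of a] nonneg * by (simp add: antisym)
    then show "a = 0" by (intro mats_eqI a mats_zero eq_matI) (auto simp: unblock_simps eq_0_iff)
  next
    assume "a = 0"
    then have "nm a \<le> 0" unfolding nm_le_iff by (auto simp: unblock_simps)
    then show "nm a = 0" using nm_nonneg'[of a] by simp
  qed
  show "nm (scalar c * a) = v c * nm a"
  proof (rule antisym)
    show "nm (scalar c * a) \<le> v c * nm a"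
      unfolding nm_le_iff using nonneg by (auto simp: unblock_simps mult intro!: mult_left_mono nm_ge)
    obtain i j where "i < N" "j < N" "nm a = v (unblock N a $$ (i, j))" using nm_attained by blast
    then show "v c * nm a \<le> nm (scalar c * a)"
      using nm_ge[of i j "scalar c * a"] by (simp add: unblock_simps mult)
  qed
  show "\<exists>c. v c = nm a" using nm_attained[of a] by metis
  show "coeff (revchar (scalar c * a)) i = c ^ i * coeff (revchar a) i" for i
    by (rule coeff_revchar_scale[OF a])
  show "(\<Sum>i\<le>N. scalar (coeff (revchar a) i) * a ^ (N - i)) = 0" by (rule cayley_hamilton_mats[OF a])
  show "v (coeff (revchar a) i) ^ K \<le> C ^ i"
    if "0 < K" "0 < C" "\<And>i. v (coeff (revchar (a ^ K)) i) \<le> C ^ i" for K C i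
    using a that by (rule coeff_revchar_power_le)
  assume b: "b \<in> mats"
  show "a + b \<in> mats" "a * b \<in> mats" using a b by auto
  show "nm (a * b) \<le> nm a * nm b" using a b by (rule nm_mult_le)
  show "nm (a + b) \<le> max (nm a) (nm b)"
    unfolding nm_le_iff
  proof (intro allI impI)
    fix i j assume ij: "i < N" "j < N"
    show "v (unblock N (a + b) $$ (i, j)) \<le> max (nm a) (nm b)"
      using ultrametric[of "unblock N a $$ (i, j)" "unblock N b $$ (i, j)"] nm_ge[OF ij, of a] nm_ge[OF ij, of b]
      using ij by (auto simp: unblock_simps)
  qed
next
  fix X :: "nat \<Rightarrow> 'f lin" and C
  assume "\<And>n. X n \<in> mats" "\<And>n. nm (X n) \<le> C"
  then show "\<exists>l r. l \<in> mats \<and> strict_mono (r :: nat \<Rightarrow> nat) \<and> (\<lambda>n. nm (X (r n) - l)) \<longlonglongrightarrow> 0"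
    by (rule nm_bounded_subsequence)
next
  fix Y :: "nat \<Rightarrow> 'f lin"
  assume "\<And>i. Y i \<in> mats"
  then show "\<exists>c. (\<exists>i\<le>N * N. c i \<noteq> 0) \<and> (\<Sum>i\<le>N * N. scalar (c i) * Y i) = 0"
    by (rule mats_dependent)
next
  fix X :: "nat \<Rightarrow> 'f lin" and x i
  assume X: "\<And>n. X n \<in> mats" "x \<in> mats" "(\<lambda>n. nm (X n - x)) \<longlonglongrightarrow> 0"
  let ?C = "\<lambda>n. 1 + nm x + nm (X n - x)"
  have "v (coeff (revchar (X n)) i - coeff (revchar x) i) \<le> nm (X n - x) * ?C n ^ i" for n
  proof (rule coeff_revchar_diff_le)
    show "1 \<le> ?C n" "nm x \<le> ?C n" using nm_nonneg'[of x] nm_nonneg'[of "X n - x"] by linarith+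
    show "nm (X n) \<le> ?C n"
      unfolding nm_le_iff
    proof (intro allI impI)
      fix i j assume ij: "i < N" "j < N"
      have "v (unblock N (X n) $$ (i, j)) \<le> max (v (unblock N x $$ (i, j))) (v (unblock N (X n - x) $$ (i, j)))"
        using ultrametric[of "unblock N x $$ (i, j)" "unblock N (X n - x) $$ (i, j)"] ij by (simp add: unblock_simps)
      then show "v (unblock N (X n) $$ (i, j)) \<le> ?C n"
        using nm_ge[OF ij, of x] nm_ge[OF ij, of "X n - x"] nm_nonneg'[of x] nm_nonneg'[of "X n - x"] by linarith
    qed
  qed
  moreover have "(\<lambda>n. nm (X n - x) * ?C n ^ i) \<longlonglongrightarrow> 0 * (1 + nm x + 0) ^ i"
    using X(3) by (intro tendsto_intros)
  then have "(\<lambda>n. nm (X n - x) * ?C n ^ i) \<longlonglongrightarrow> 0" by simp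
  ultimately have "null_diff (\<lambda>n. coeff (revchar (X n)) i) (coeff (revchar x) i)"
    by (rule null_diff_le)
  then show "(\<lambda>n. v (coeff (revchar (X n)) i - coeff (revchar x) i)) \<longlonglongrightarrow> 0"
    by (simp add: null_diff_def)
next
  fix M :: "'f lin set" and xs i
  assume "M \<subseteq> mats" "\<And>x y. x \<in> M \<Longrightarrow> y \<in> M \<Longrightarrow> x * y \<in> M"
    "\<And>x i. x \<in> M \<Longrightarrow> v (coeff (revchar x) i) \<le> 1" "set xs \<subseteq> M"
  then show "v (coeff (revchar (sum_list xs)) i) \<le> 1" by (rule integral_sum_list)
qed

end

section \<open>Polynomials at points\<close>

(* The rational points use the structure map id, which the simplifier would expand
   in its eta-long form. *)
declare id_apply [simp del]

definition monomial_value :: "('x::finite \<Rightarrow> 'f::comm_ring_1) \<Rightarrow> ('x \<Rightarrow>\<^sub>0 nat) \<Rightarrow> 'f" where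
  "monomial_value x m = (\<Prod>i\<in>UNIV. x i ^ Poly_Mapping.lookup m i)"

lemma eval_poly_monomials:
  fixes p :: "('x::finite, 'f::comm_ring_1) mpoly"
  shows "eval_poly id x p = (\<Sum>m\<in>Poly_Mapping.keys p. Poly_Mapping.lookup p m * monomial_value x m)"
proof -
  have "(\<Prod>i\<in>Poly_Mapping.keys m. x i ^ Poly_Mapping.lookup m i) = monomial_value x m" for m
    unfolding monomial_value_def by (intro prod.mono_neutral_left) (auto simp: in_keys_iff)
  then show ?thesis by (simp add: Defs.eval_poly_def id_apply)
qed

lemma monomial_value_add: "monomial_value x (m + n) = monomial_value x m * monomial_value x n"
  by (simp add: monomial_value_def lookup_add power_add prod.distrib)

lemma eval_poly_superset:
  fixes p :: "('x::finite, 'f::comm_ring_1) mpoly"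
  assumes "finite K" "Poly_Mapping.keys p \<subseteq> K"
  shows "eval_poly id x p = (\<Sum>m\<in>K. Poly_Mapping.lookup p m * monomial_value x m)"
  unfolding eval_poly_monomials using assms by (intro sum.mono_neutral_left) (auto simp: in_keys_iff)

lemma eval_poly_add:
  fixes p q :: "('x::finite, 'f::comm_ring_1) mpoly"
  shows "eval_poly id x (p + q) = eval_poly id x p + eval_poly id x q"
proof -
  let ?K = "Poly_Mapping.keys p \<union> Poly_Mapping.keys q"
  have "Poly_Mapping.keys (p + q) \<subseteq> ?K" by (rule Poly_Mapping.keys_add)
  then show ?thesis
    by (simp add: eval_poly_superset[of ?K] lookup_add distrib_right sum.distrib)
qed

lemma eval_poly_0 [simp]: "eval_poly \<phi> x 0 = 0"
  by (simp add: Defs.eval_poly_def)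

lemma eval_poly_single:
  fixes x :: "'x::finite \<Rightarrow> 'f::comm_ring_1"
  shows "eval_poly id x (Poly_Mapping.single m c) = c * monomial_value x m"
  by (cases "c = 0") (simp_all add: eval_poly_monomials)

lemma eval_poly_sum:
  fixes f :: "'i \<Rightarrow> ('x::finite, 'f::comm_ring_1) mpoly"
  shows "eval_poly id x (sum f I) = (\<Sum>i\<in>I. eval_poly id x (f i))"
  by (induction I rule: infinite_finite_induct) (simp_all add: eval_poly_add)

lemma poly_mapping_sum_single:
  "(\<Sum>m\<in>Poly_Mapping.keys p. Poly_Mapping.single m (Poly_Mapping.lookup p m)) = p"
proof (rule poly_mapping_eqI)
  fix k
  have "Poly_Mapping.lookup (\<Sum>m\<in>Poly_Mapping.keys p. Poly_Mapping.single m (Poly_Mapping.lookup p m)) k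
      = (\<Sum>m\<in>Poly_Mapping.keys p. if m = k then Poly_Mapping.lookup p m else 0)"
    by (simp add: lookup_sum lookup_single when_def)
  also have "\<dots> = Poly_Mapping.lookup p k" by (simp add: in_keys_iff)
  finally show "Poly_Mapping.lookup (\<Sum>m\<in>Poly_Mapping.keys p. Poly_Mapping.single m (Poly_Mapping.lookup p m)) k
      = Poly_Mapping.lookup p k" .
qed

lemma eval_poly_mult:
  fixes p q :: "('x::finite, 'f::comm_ring_1) mpoly"
  shows "eval_poly id x (p * q) = eval_poly id x p * eval_poly id x q"
proof -
  let ?s = "\<lambda>p m. Poly_Mapping.single m (Poly_Mapping.lookup p m)"
  have "p * q = (\<Sum>m\<in>Poly_Mapping.keys p. ?s p m) * (\<Sum>n\<in>Poly_Mapping.keys q. ?s q n)"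
    by (simp only: poly_mapping_sum_single)
  also have "\<dots> = (\<Sum>m\<in>Poly_Mapping.keys p. \<Sum>n\<in>Poly_Mapping.keys q. ?s p m * ?s q n)"
    by (rule sum_product)
  finally have "eval_poly id x (p * q) = (\<Sum>m\<in>Poly_Mapping.keys p. \<Sum>n\<in>Poly_Mapping.keys q.
      (Poly_Mapping.lookup p m * monomial_value x m) * (Poly_Mapping.lookup q n * monomial_value x n))"
    by (simp add: eval_poly_sum mult_single eval_poly_single monomial_value_add mult_ac)
  then show ?thesis by (simp add: eval_poly_monomials sum_product)
qed

text \<open>Evaluation at a point is a ring homomorphism, so its kernel is an ideal.\<close>

lemma points_ideal_gen:
  fixes E :: "('x::finite, 'f::comm_ring_1) mpoly set"
  assumes "x \<in> points id {0} E" "p \<in> ideal_gen E"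
  shows "eval_poly id x p = 0"
  using assms(2)
proof (rule module.span_induct[OF module_mult])
  show "is_ideal {p. eval_poly id x p = 0}"
    by (rule module.subspaceI[OF module_mult]) (auto simp: eval_poly_add eval_poly_mult)
  show "eval_poly id x p = 0" if "p \<in> E" for p using assms(1) that by (auto simp: points_def)
qed

lemma monomial_value_case_sum:
  fixes x y :: "'x::finite \<Rightarrow> 'f::comm_ring_1"
  shows "monomial_value (case_sum x y) m =
    (\<Prod>i\<in>UNIV. x i ^ Poly_Mapping.lookup m (Inl i)) * (\<Prod>i\<in>UNIV. y i ^ Poly_Mapping.lookup m (Inr i))"
  using prod.Plus[of "UNIV :: 'x set" "UNIV :: 'x set" "\<lambda>j. case_sum x y j ^ Poly_Mapping.lookup m j"]
  by (simp add: monomial_value_def UNIV_Plus_UNIV o_def)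

context nonarch_local_field
begin

lemma null_diff_eval_poly:
  fixes p :: "('x::finite, 'f) mpoly"
  assumes "\<And>i. null_diff (\<lambda>n. X n i) (x i)"
  shows "null_diff (\<lambda>n. eval_poly id (X n) p) (eval_poly id x p)"
  unfolding eval_poly_monomials monomial_value_def
  using assms by (intro null_diff_sum null_diff_mult null_diff_const null_diff_prod null_diff_power)

end

section \<open>Finite-dimensional spaces of functions\<close>

text \<open>A dual system of points and functions of maximal size; its size is bounded since
  the functions in it are linearly independent. If some \<open>h \<in> V\<close> were not the indicated combination at a
  point \<open>x\<close>, the difference could be used to enlarge the system by \<open>x\<close>.\<close>

lemma ex_dual_system:
  fixes V :: "('p \<Rightarrow> 'f::field) set"
  assumes V: "\<And>f g. f \<in> V \<Longrightarrow> g \<in> V \<Longrightarrow> (\<lambda>x. f x + g x) \<in> V" "\<And>c f. f \<in> V \<Longrightarrow> (\<lambda>x. c * f x) \<in> V"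
      "(\<lambda>x. 0) \<in> V"
    and S: "finite S" "\<And>f. f \<in> V \<Longrightarrow> \<exists>c. \<forall>x\<in>X. f x = (\<Sum>b\<in>S. c b * b x)"
  shows "\<exists>(N::nat) p f. (\<forall>a<N. p a \<in> X \<and> f a \<in> V) \<and> (\<forall>a<N. \<forall>b<N. f a (p b) = (if a = b then 1 else 0)) \<and>
    (\<forall>h\<in>V. \<forall>x\<in>X. h x = (\<Sum>a<N. h (p a) * f a x))"
proof -
  define Q where "Q N p f \<longleftrightarrow> (\<forall>a<N. p a \<in> X \<and> f a \<in> V) \<and>
      (\<forall>a<N. \<forall>b<N. f a (p b) = (if a = b then 1 else 0))" for N and p :: "nat \<Rightarrow> 'p" and f
  have bound: "N \<le> card S" if Q: "Q N p f" for N p f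
  proof (rule ccontr)
    assume N: "\<not> N \<le> card S"
    obtain e where e: "bij_betw e {..<card S} S"
      using ex_bij_betw_nat_finite[OF S(1)] by (auto simp: atLeast0LessThan)
    have "\<forall>a. \<exists>c. a < N \<longrightarrow> (\<forall>x\<in>X. f a x = (\<Sum>b\<in>S. c b * b x))"
      using S(2) Q by (auto simp: Q_def)
    then obtain c where c: "\<And>a x. a < N \<Longrightarrow> x \<in> X \<Longrightarrow> f a x = (\<Sum>b\<in>S. c a b * b x)" by metis
    obtain z where z: "\<exists>a\<le>card S. z a \<noteq> 0"
        "\<And>l. l < card S \<Longrightarrow> (\<Sum>a\<le>card S. z a * c a (e l)) = 0"
      using homogeneous_system_solution[of "card S" "\<lambda>l a. c a (e l)"] by blast
    have zc: "(\<Sum>a\<le>card S. z a * c a b) = 0" if "b \<in> S" for b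
    proof -
      have "b \<in> e ` {..<card S}" using e \<open>b \<in> S\<close> by (simp add: bij_betw_imp_surj_on)
      then show ?thesis using z(2) by auto
    qed
    have "(\<Sum>a\<le>card S. z a * f a x) = 0" if x: "x \<in> X" for x
    proof -
      have "(\<Sum>a\<le>card S. z a * f a x) = (\<Sum>a\<le>card S. \<Sum>b\<in>S. z a * c a b * b x)"
        using N by (intro sum.cong) (auto simp: c[OF _ x] sum_distrib_left mult.assoc)
      also have "\<dots> = (\<Sum>b\<in>S. \<Sum>a\<le>card S. z a * c a b * b x)" by (rule sum.swap)
      also have "\<dots> = (\<Sum>b\<in>S. (\<Sum>a\<le>card S. z a * c a b) * b x)" by (simp add: sum_distrib_right)
      finally show ?thesis using zc by simp
    qed
    moreover have "(\<Sum>a\<le>card S. z a * f a (p b)) = z b" if b: "b \<le> card S" for b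
    proof -
      have "(\<Sum>a\<le>card S. z a * f a (p b)) = (\<Sum>a\<le>card S. if a = b then z a else 0)"
        using N Q b by (intro sum.cong) (auto simp: Q_def)
      then show ?thesis using b by simp
    qed
    moreover have "p b \<in> X" if "b \<le> card S" for b using Q N that by (auto simp: Q_def)
    ultimately show False using z(1) by metis
  qed
  have "\<exists>p f. Q 0 p f" by (simp add: Q_def)
  moreover have "\<forall>N. (\<exists>p f. Q N p f) \<longrightarrow> N \<le> card S" using bound by blast
  ultimately have "\<exists>N. (\<exists>p f. Q N p f) \<and> (\<forall>N'. (\<exists>p f. Q N' p f) \<longrightarrow> N' \<le> N)"
    using ex_has_greatest_nat[of "\<lambda>N. \<exists>p f. Q N p f" 0 "\<lambda>N. N" "Suc (card S)"]
    by (simp add: less_Suc_eq_le)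
  then obtain N p f where Q: "Q N p f" and max: "\<And>N' p f. Q N' p f \<Longrightarrow> N' \<le> N" by blast
  have "h x = (\<Sum>a<N. h (p a) * f a x)" if h: "h \<in> V" and x: "x \<in> X" for h x
  proof (rule ccontr)
    assume ne: "h x \<noteq> (\<Sum>a<N. h (p a) * f a x)"
    define r where "r = (\<lambda>x. h x + (-1) * (\<Sum>a<N. h (p a) * f a x))"
    have "(\<lambda>x. \<Sum>a<n. h (p a) * f a x) \<in> V" if "n \<le> N" for n
      using that
    proof (induction n)
      case (Suc n)
      then have "f n \<in> V" using Q by (auto simp: Q_def)
      then have "(\<lambda>x. (\<Sum>a<n. h (p a) * f a x) + h (p n) * f n x) \<in> V"
        using Suc by (intro V(1,2)) auto
      then show ?case by simp
    qed (use V(3) in simp)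
    then have rV: "r \<in> V" unfolding r_def by (intro V(1,2) h) auto
    have rx: "r x \<noteq> 0" using ne by (simp add: r_def)
    have rp: "r (p b) = 0" if "b < N" for b
    proof -
      have "(\<Sum>a<N. h (p a) * f a (p b)) = (\<Sum>a<N. if a = b then h (p a) else 0)"
        using Q that by (intro sum.cong) (auto simp: Q_def)
      then show ?thesis using that by (simp add: r_def)
    qed
    define fN where "fN = (\<lambda>y. inverse (r x) * r y)"
    have fNV: "fN \<in> V" unfolding fN_def by (intro V rV)
    define f' where "f' a = (if a = N then fN else (\<lambda>y. f a y + (- f a x) * fN y))" for a
    define p' where "p' = p(N := x)"
    have "Q (Suc N) p' f'"
      unfolding Q_def
    proof (intro conjI allI impI)
      fix a assume a: "a < Suc N"
      show "p' a \<in> X" using Q a x by (auto simp: p'_def Q_def less_Suc_eq)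
      show "f' a \<in> V"
      proof (cases "a = N")
        case False
        then have "f a \<in> V" using Q a by (auto simp: Q_def)
        then have "(\<lambda>y. f a y + (- f a x) * fN y) \<in> V" by (rule V(1)[OF _ V(2)[OF fNV]])
        then show ?thesis using False by (simp add: f'_def)
      qed (simp add: f'_def fNV)
      fix b assume b: "b < Suc N"
      show "f' a (p' b) = (if a = b then 1 else 0)"
        using Q a b rx rp by (auto simp: f'_def p'_def fN_def Q_def less_Suc_eq)
    qed
    then show False using max by fastforce
  qed
  then have "\<forall>h\<in>V. \<forall>x\<in>X. h x = (\<Sum>a<N. h (p a) * f a x)" by blast
  with Q show ?thesis unfolding Q_def by (intro exI[of _ N] exI[of _ p] exI[of _ f]) simp
qed

section \<open>Matrix embedding of the group of points\<close>

lemma rational_points_simps: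
  "carrier (rational_points G) = points id {0} (gp_eqs G)" "mult (rational_points G) = mult_pt G id"
  "one (rational_points G) = unit_pt G id"
  by (simp_all add: rational_points_def)

lemma (in nonarch_local_field) null_diff_mult_pt:
  fixes G :: "('n::finite, 'f) affine_group"
  assumes "\<And>i. null_diff (\<lambda>n. X n i) (x i)" "\<And>i. null_diff (\<lambda>n. Y n i) (y i)"
  shows "null_diff (\<lambda>n. mult_pt G id (X n) (Y n) i) (mult_pt G id x y i)"
  unfolding mult_pt_def
proof (rule null_diff_eval_poly)
  show "null_diff (\<lambda>n. case_sum (X n) (Y n) j) (case_sum x y j)" for j
    using assms by (cases j) auto
qed

text \<open>Let \<open>V\<close> be spanned by the constants and the functions \<open>x \<mapsto> (x g)\<^sub>i\<close> for \<open>g \<in> X\<close>. It is invariant under right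
  translations, and it is contained in the span of finitely many monomial functions, namely the parts of the
  multiplication polynomials in the variables of the left factor. In the coordinates of a dual system, translation by
  \<open>g\<close> has the matrix \<open>T g\<close> with entries \<open>f b (p a * g)\<close>. The coordinates of \<open>g\<close> are recovered
  linearly from \<open>T g\<close> because the coordinate functions belong to \<open>V\<close>. The constants ensure
  that \<open>N > 0\<close>.\<close>

theorem (in nonarch_local_field) ex_matrix_embedding:
  fixes G :: "('n::finite, 'f) affine_group"
  assumes G: "group_scheme G"
  defines "X \<equiv> carrier (rational_points G)"
  shows "\<exists>(N::nat) T w. 0 < N \<and> (\<forall>g\<in>X. T g \<in> matrix_size.mats N) \<and> T (unit_pt G id) = 1 \<and>
    (\<forall>g\<in>X. \<forall>h\<in>X. T (mult_pt G id g h) = T g * T h) \<and>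
    (\<forall>g\<in>X. \<forall>i. g i = (\<Sum>a<N. \<Sum>b<N. w i a b * unblock N (T g) $$ (a, b))) \<and>
    (\<forall>Y g. (\<forall>n. Y n \<in> X) \<longrightarrow> g \<in> X \<longrightarrow> (\<forall>i. null_diff (\<lambda>n. Y n i) (g i)) \<longrightarrow>
       (\<forall>a<N. \<forall>b<N. null_diff (\<lambda>n. unblock N (T (Y n)) $$ (a, b)) (unblock N (T g) $$ (a, b))))"
proof -
  interpret \<Gamma>: group "rational_points G" by (rule group_rational_points[OF G])
  let ?m = "mult_pt G id" and ?e = "unit_pt G id"
  have m_in: "?m x y \<in> X" if "x \<in> X" "y \<in> X" for x y
    using \<Gamma>.m_closed that by (simp add: X_def rational_points_simps)
  have e_in: "?e \<in> X" using \<Gamma>.one_closed by (simp add: X_def rational_points_simps)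
  have assoc: "?m (?m x y) z = ?m x (?m y z)" if "x \<in> X" "y \<in> X" "z \<in> X" for x y z
    using \<Gamma>.m_assoc that by (simp add: X_def rational_points_simps)
  have unit: "?m ?e x = x" "?m x ?e = x" if "x \<in> X" for x
    using \<Gamma>.l_one \<Gamma>.r_one that by (simp_all add: X_def rational_points_simps)
  define V where "V = {f. \<exists>cs :: ('f \<times> ('n \<Rightarrow> 'f) \<times> 'n) list. \<exists>c. (\<forall>(_, g, _)\<in>set cs. g \<in> X) \<and>
      (\<forall>x\<in>X. f x = c + (\<Sum>(a, g, i)\<leftarrow>cs. a * ?m x g i))}"
  have V_coord: "(\<lambda>x. x i) \<in> V" for i
    unfolding V_def using e_in unit(2) by (intro CollectI exI[of _ "[(1, ?e, i)]"] exI[of _ 0]) auto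
  have V_const: "(\<lambda>x. c) \<in> V" for c
    unfolding V_def by (intro CollectI exI[of _ "[]"] exI[of _ c]) auto
  have V_add: "(\<lambda>x. f x + g x) \<in> V" if fg: "f \<in> V" "g \<in> V" for f g
  proof -
    obtain cs c where 1: "\<forall>(_, g, _)\<in>set cs. g \<in> X" "\<And>x. x \<in> X \<Longrightarrow> f x = c + (\<Sum>(a, g, i)\<leftarrow>cs. a * ?m x g i)"
      using fg(1) unfolding V_def by blast
    obtain ds d where 2: "\<forall>(_, g, _)\<in>set ds. g \<in> X" "\<And>x. x \<in> X \<Longrightarrow> g x = d + (\<Sum>(a, g, i)\<leftarrow>ds. a * ?m x g i)"
      using fg(2) unfolding V_def by blast
    show ?thesis unfolding V_def
      using 1 2 by (intro CollectI exI[of _ "cs @ ds"] exI[of _ "c + d"]) auto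
  qed
  have V_scale: "(\<lambda>x. c * f x) \<in> V" if f: "f \<in> V" for c f
  proof -
    obtain cs d where 1: "\<forall>(_, g, _)\<in>set cs. g \<in> X" "\<And>x. x \<in> X \<Longrightarrow> f x = d + (\<Sum>(a, g, i)\<leftarrow>cs. a * ?m x g i)"
      using f unfolding V_def by blast
    have "c * (\<Sum>(a, g, i)\<leftarrow>cs. a * ?m x g i) = (\<Sum>(a, g, i)\<leftarrow>map (\<lambda>(a, g, i). (c * a, g, i)) cs. a * ?m x g i)" for x
      by (induction cs) (auto simp: distrib_left mult.assoc)
    then show ?thesis unfolding V_def
      using 1 by (intro CollectI exI[of _ "map (\<lambda>(a, g, i). (c * a, g, i)) cs"] exI[of _ "c * d"])
        (auto simp: distrib_left)
  qed
  have V_translate: "(\<lambda>x. f (?m x h)) \<in> V" if f: "f \<in> V" and h: "h \<in> X" for f h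
  proof -
    obtain cs d where 1: "\<forall>(_, g, _)\<in>set cs. g \<in> X" "\<And>x. x \<in> X \<Longrightarrow> f x = d + (\<Sum>(a, g, i)\<leftarrow>cs. a * ?m x g i)"
      using f unfolding V_def by blast
    have "(\<Sum>(a, g, i)\<leftarrow>cs. a * ?m (?m x h) g i) = (\<Sum>(a, g, i)\<leftarrow>map (\<lambda>(a, g, i). (a, ?m h g, i)) cs. a * ?m x g i)"
      if "x \<in> X" for x
      using 1(1) by (induction cs) (auto simp: assoc[OF that h])
    then show ?thesis unfolding V_def
      using 1 h m_in by (intro CollectI exI[of _ "map (\<lambda>(a, g, i). (a, ?m h g, i)) cs"] exI[of _ d]) auto
  qed
  have V_continuous: "null_diff (\<lambda>n. f (Y n)) (f y)"
    if f: "f \<in> V" and Y: "\<And>n. Y n \<in> X" "y \<in> X" "\<And>i. null_diff (\<lambda>n. Y n i) (y i)" for f Y y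
  proof -
    obtain cs d where 1: "\<forall>(_, g, _)\<in>set cs. g \<in> X" "\<And>x. x \<in> X \<Longrightarrow> f x = d + (\<Sum>(a, g, i)\<leftarrow>cs. a * ?m x g i)"
      using f unfolding V_def by blast
    have "null_diff (\<lambda>n. \<Sum>(a, g, i)\<leftarrow>cs. a * ?m (Y n) g i) (\<Sum>(a, g, i)\<leftarrow>cs. a * ?m y g i)"
      by (induction cs)
        (auto intro!: null_diff_add null_diff_mult null_diff_mult_pt null_diff_const Y(3))
    then have "null_diff (\<lambda>n. d + (\<Sum>(a, g, i)\<leftarrow>cs. a * ?m (Y n) g i)) (d + (\<Sum>(a, g, i)\<leftarrow>cs. a * ?m y g i))"
      by (intro null_diff_add null_diff_const)
    then show ?thesis using 1(2)[OF Y(1)] 1(2)[OF Y(2)] by simp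
  qed
  define left where "left m = (\<lambda>x :: 'n \<Rightarrow> 'f. \<Prod>i\<in>UNIV. x i ^ Poly_Mapping.lookup m (Inl i))" for m :: "('n + 'n) \<Rightarrow>\<^sub>0 nat"
  define S where "S = insert (\<lambda>x. 1) (\<Union>i. left ` Poly_Mapping.keys (gp_mult G i))"
  have S_fin: "finite S" by (simp add: S_def)
  define span where "span = {f :: ('n \<Rightarrow> 'f) \<Rightarrow> 'f. \<exists>c. \<forall>x. f x = (\<Sum>b\<in>S. c b * b x)}"
  have span_base: "b \<in> span" if "b \<in> S" for b
  proof -
    have "(\<Sum>b'\<in>S. (if b' = b then 1 else 0) * b' x) = (\<Sum>b'\<in>S. if b' = b then b' x else 0)" for x
      by (intro sum.cong) auto
    then show ?thesis unfolding span_def using S_fin that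
      by (intro CollectI exI[of _ "\<lambda>b'. if b' = b then 1 else 0"]) simp
  qed
  have span_scale: "(\<lambda>x. c * f x) \<in> span" if f: "f \<in> span" for c f
  proof -
    obtain d where "\<And>x. f x = (\<Sum>b\<in>S. d b * b x)" using f unfolding span_def by blast
    then show ?thesis unfolding span_def
      by (intro CollectI exI[of _ "\<lambda>b. c * d b"]) (simp add: sum_distrib_left mult.assoc)
  qed
  have span_add: "(\<lambda>x. f x + g x) \<in> span" if fg: "f \<in> span" "g \<in> span" for f g
  proof -
    obtain c d where "\<And>x. f x = (\<Sum>b\<in>S. c b * b x)" "\<And>x. g x = (\<Sum>b\<in>S. d b * b x)"
      using fg unfolding span_def by blast
    then show ?thesis unfolding span_def
      by (intro CollectI exI[of _ "\<lambda>b. c b + d b"]) (simp add: distrib_right sum.distrib)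
  qed
  have span_0: "(\<lambda>x. 0) \<in> span" unfolding span_def by (intro CollectI exI[of _ "\<lambda>_. 0"]) simp
  have span_sum: "(\<lambda>x. \<Sum>j\<in>J. f j x) \<in> span" if "\<And>j. j \<in> J \<Longrightarrow> f j \<in> span" for f and J :: "(('n + 'n) \<Rightarrow>\<^sub>0 nat) set"
    using that by (induction J rule: infinite_finite_induct) (auto intro: span_0 span_add)
  have span_mult: "(\<lambda>x. ?m x g i) \<in> span" for g i
  proof -
    let ?q = "gp_mult G i"
    let ?r = "\<lambda>m. \<Prod>j\<in>UNIV. g j ^ Poly_Mapping.lookup m (Inr j)"
    have "?m x g i = (\<Sum>m\<in>Poly_Mapping.keys ?q. (Poly_Mapping.lookup ?q m * ?r m) * left m x)" for x
      by (simp add: mult_pt_def eval_poly_monomials monomial_value_case_sum left_def mult_ac)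
    then show ?thesis
      by (simp only:) (intro span_sum span_scale span_base, auto simp: S_def)
  qed
  have V_span: "\<exists>c. \<forall>x\<in>X. f x = (\<Sum>b\<in>S. c b * b x)" if f: "f \<in> V" for f
  proof -
    obtain cs d where 1: "\<forall>(_, g, _)\<in>set cs. g \<in> X" "\<And>x. x \<in> X \<Longrightarrow> f x = d + (\<Sum>(a, g, i)\<leftarrow>cs. a * ?m x g i)"
      using f unfolding V_def by blast
    have "(\<lambda>x. \<Sum>(a, g, i)\<leftarrow>cs. a * ?m x g i) \<in> span"
      by (induction cs) (auto intro: span_0 intro!: span_add span_scale span_mult)
    moreover have "(\<lambda>x. d * 1) \<in> span" by (intro span_scale span_base) (simp add: S_def)
    ultimately have "(\<lambda>x. d * 1 + (\<Sum>(a, g, i)\<leftarrow>cs. a * ?m x g i)) \<in> span" by (intro span_add)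
    then show ?thesis unfolding span_def using 1(2) by auto
  qed
  obtain N :: nat and p f where sys: "(\<forall>a<N. p a \<in> X \<and> f a \<in> V) \<and>
      (\<forall>a<N. \<forall>b<N. f a (p b) = (if a = b then 1 else 0)) \<and>
      (\<forall>h\<in>V. \<forall>x\<in>X. h x = (\<Sum>a<N. h (p a) * f a x))"
  proof -
    have "\<exists>(N::nat) p f. (\<forall>a<N. p a \<in> X \<and> f a \<in> V) \<and>
      (\<forall>a<N. \<forall>b<N. f a (p b) = (if a = b then 1 else 0)) \<and>
      (\<forall>h\<in>V. \<forall>x\<in>X. h x = (\<Sum>a<N. h (p a) * f a x))"
      by (rule ex_dual_system[OF V_add V_scale V_const S_fin V_span])
    then show ?thesis by (elim exE) (rule that)
  qed
  have dual: "p a \<in> X" "f a \<in> V" if "a < N" for a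
    using sys that by auto
  have dual_delta: "f a (p b) = (if a = b then 1 else 0)" if "a < N" "b < N" for a b
    using sys that by simp
  have dual_expand: "h x = (\<Sum>a<N. h (p a) * f a x)" if "h \<in> V" "x \<in> X" for h x
    using sys that by blast
  have N: "0 < N"
  proof (rule ccontr)
    assume "\<not> 0 < N"
    then show False using dual_expand[OF V_const[of 1] e_in] by simp
  qed
  interpret matrix_size N by unfold_locales (rule N)
  define T where "T g = blocks N (Matrix.mat N N (\<lambda>(a, b). f b (?m (p a) g)))" for g
  have T_in: "T g \<in> mats" for g unfolding T_def by (intro blocks_in) simp
  have T_index: "unblock N (T g) $$ (a, b) = f b (?m (p a) g)" if "a < N" "b < N" for g a b
    unfolding T_def using that by (subst unblock_blocks) auto
  have T_one: "T ?e = 1"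
    by (intro mats_eqI T_in mats_one eq_matI) (auto simp: T_index unblock_simps unit dual dual_delta)
  have T_mult: "T (?m g h) = T g * T h" if g: "g \<in> X" and h: "h \<in> X" for g h
  proof (intro mats_eqI mats_mult T_in eq_matI)
    fix a b assume "a < dim_row (unblock N (T g * T h))" "b < dim_col (unblock N (T g * T h))"
    then have ab: "a < N" "b < N" by simp_all
    have "f b (?m (?m (p a) g) h) = (\<Sum>c<N. f b (?m (p c) h) * f c (?m (p a) g))"
      using dual_expand[OF V_translate[OF dual(2)[OF ab(2)] h] m_in[OF dual(1)[OF ab(1)] g]] .
    then show "unblock N (T (?m g h)) $$ (a, b) = unblock N (T g * T h) $$ (a, b)"
      using ab assoc[OF dual(1)[OF ab(1)] g h]
      by (simp add: unblock_mult_index[OF T_in T_in] T_index mult.commute)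
  qed auto
  define w where "w i a b = p b i * f a ?e" for i a b
  have T_coord: "g i = (\<Sum>a<N. \<Sum>b<N. w i a b * unblock N (T g) $$ (a, b))" if g: "g \<in> X" for g i
  proof -
    have "f b g = (\<Sum>a<N. f b (?m (p a) g) * f a ?e)" if b: "b < N" for b
      using dual_expand[OF V_translate[OF dual(2)[OF b] g] e_in] unit(1)[OF g] by simp
    then have "g i = (\<Sum>b<N. p b i * (\<Sum>a<N. f b (?m (p a) g) * f a ?e))"
      using dual_expand[OF V_coord g, of i] by simp
    also have "\<dots> = (\<Sum>b<N. \<Sum>a<N. w i a b * unblock N (T g) $$ (a, b))"
      by (simp add: w_def T_index sum_distrib_left mult_ac)
    also have "\<dots> = (\<Sum>a<N. \<Sum>b<N. w i a b * unblock N (T g) $$ (a, b))" by (rule sum.swap)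
    finally show ?thesis .
  qed
  have T_cont: "null_diff (\<lambda>n. unblock N (T (Y n)) $$ (a, b)) (unblock N (T g) $$ (a, b))"
    if "\<And>n. Y n \<in> X" "g \<in> X" "\<And>i. null_diff (\<lambda>n. Y n i) (g i)" and ab: "a < N" "b < N" for Y g a b
    unfolding T_index[OF ab] using that(1-3) dual(1)[OF ab(1)]
    by (intro V_continuous[OF dual(2)[OF ab(2)]] m_in null_diff_mult_pt null_diff_const)
  show ?thesis
    by (intro exI[of _ N] exI[of _ T] exI[of _ w] conjI allI ballI impI)
      (use N T_in T_one T_mult T_coord T_cont in blast)+
qed

section \<open>Unipotent elements and polynomial curves\<close>

lemma unipotent_power_binomial:
  fixes z :: "'r::ring_1"
  assumes "z ^ N = 0"
  shows "(1 + z) ^ j = (\<Sum>s<N. of_nat (j choose s) * z ^ s)"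
proof (induction j)
  case 0
  have "(\<Sum>s<N. of_nat (0 choose s) * z ^ s) = (\<Sum>s<N. if s = 0 then 1 else 0)"
    by (intro sum.cong) (auto simp: binomial_eq_0)
  also have "\<dots> = 1"
  proof (cases "N = 0")
    case True
    then have "(1::'r) = 0" using assms by simp
    then show ?thesis using True by simp
  qed simp
  finally show ?case by simp
next
  case (Suc j)
  have shift: "z * (\<Sum>s<N. of_nat (j choose s) * z ^ s) = (\<Sum>s<N. of_nat (if s = 0 then 0 else j choose (s - 1)) * z ^ s)"
  proof (cases N)
    case (Suc N')
    have "z * (\<Sum>s<N. of_nat (j choose s) * z ^ s) = (\<Sum>s<N. of_nat (j choose s) * z ^ Suc s)"
      unfolding sum_distrib_left
    proof (intro sum.cong refl)
      fix s
      show "z * (of_nat (j choose s) * z ^ s) = of_nat (j choose s) * z ^ Suc s"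
        by (metis mult.assoc mult_of_nat_commute power_Suc)
    qed
    also have "\<dots> = (\<Sum>s<N'. of_nat (j choose s) * z ^ Suc s)"
      using assms by (simp add: Suc)
    also have "\<dots> = (\<Sum>s<N. of_nat (if s = 0 then 0 else j choose (s - 1)) * z ^ s)"
      unfolding Suc sum.lessThan_Suc_shift by (simp del: power_Suc)
    finally show ?thesis .
  qed simp
  have "(1 + z) ^ Suc j = (1 + z) ^ j + z * (1 + z) ^ j" by (simp add: distrib_right)
  also have "\<dots> = (\<Sum>s<N. of_nat (Suc j choose s) * z ^ s)"
    unfolding Suc.IH shift sum.distrib[symmetric]
  proof (intro sum.cong refl)
    fix s
    show "of_nat (j choose s) * z ^ s + of_nat (if s = 0 then 0 else j choose (s - 1)) * z ^ s
        = of_nat (Suc j choose s) * z ^ s"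
      by (cases s) (simp_all add: distrib_right add.commute)
  qed
  finally show ?case .
qed

lemma times_binomial_Suc: "Suc s * (j choose Suc s) = (j choose s) * (j - s)"
  by (metis binomial_absorb_comp binomial_absorption mult.commute)

definition binomial_poly :: "nat \<Rightarrow> 'f::field poly" where
  "binomial_poly s = Polynomial.smult (inverse (of_nat (fact s))) (\<Prod>l<s. [:- of_nat l, 1:])"

lemma poly_binomial_poly:
  assumes char0: "\<forall>n>0. of_nat n \<noteq> (0::'f::field)"
  shows "poly (binomial_poly s) (of_nat j) = (of_nat (j choose s) :: 'f)"
proof -
  have "(\<Prod>l<s. of_nat j - of_nat l) = (of_nat (fact s * (j choose s)) :: 'f)"
  proof (induction s)
    case (Suc s)
    have "(\<Prod>l<Suc s. of_nat j - of_nat l) = (of_nat (fact s * (j choose s)) :: 'f) * (of_nat j - of_nat s)"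
      by (simp add: Suc.IH)
    also have "\<dots> = of_nat (fact s * ((j choose s) * (j - s)))"
      by (cases "s \<le> j") (simp_all add: of_nat_diff mult.assoc binomial_eq_0)
    also have "fact s * ((j choose s) * (j - s)) = fact (Suc s) * (j choose Suc s)"
      unfolding times_binomial_Suc[symmetric] by (simp add: algebra_simps id_apply)
    finally show ?case .
  qed simp
  then show ?thesis
    using char0[rule_format, of "fact s"] by (simp add: binomial_poly_def poly_prod mult.assoc[symmetric] id_apply del: of_nat_fact)
qed

text \<open>The natural numbers are infinitely many points of a field of characteristic zero.\<close>

lemma poly_eq_if_eq_on_nat:
  fixes P Q :: "'f::field poly"
  assumes char0: "\<forall>n>0. of_nat n \<noteq> (0::'f)"
    and eq: "\<And>j. poly P (of_nat j) = poly Q (of_nat j)"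
  shows "poly P t = poly Q t"
proof -
  have inj: "inj (of_nat :: nat \<Rightarrow> 'f)"
  proof (rule linorder_injI)
    fix m n :: nat assume "m < n"
    then have "of_nat n - of_nat m \<noteq> (0::'f)" using char0[rule_format, of "n - m"] by (simp add: of_nat_diff)
    then show "of_nat m \<noteq> (of_nat n :: 'f)" by auto
  qed
  have "range (of_nat :: nat \<Rightarrow> 'f) \<subseteq> {t. poly (P - Q) t = 0}" using eq by auto
  then have "infinite {t. poly (P - Q) t = 0}"
    using inj by (meson finite_subset infinite_UNIV_nat range_inj_infinite)
  then have "P - Q = 0" using poly_roots_finite by blast
  then show ?thesis by simp
qed

lemma ex_poly_along_curve:
  fixes p :: "('x::finite, 'f::field) mpoly" and q :: "'x \<Rightarrow> 'f poly"
  shows "\<exists>P. \<forall>t. eval_poly id (\<lambda>i. poly (q i) t) p = poly P t"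
  by (intro exI[of _ "\<Sum>m\<in>Poly_Mapping.keys p. Polynomial.smult (Poly_Mapping.lookup p m)
      (\<Prod>i\<in>UNIV. q i ^ Poly_Mapping.lookup m i)"])
    (simp add: eval_poly_monomials monomial_value_def poly_sum poly_prod)

lemma (in nonarch_local_field) points_closed:
  fixes E :: "('x::finite, 'f) mpoly set"
  assumes "\<And>n. Z n \<in> points id {0} E" "\<And>i. null_diff (\<lambda>n. Z n i) (z i)"
  shows "z \<in> points id {0} E"
proof -
  have "eval_poly id z p = 0" if "p \<in> E" for p
  proof -
    have "null_diff (\<lambda>n. eval_poly id (Z n) p) (eval_poly id z p)"
      using assms(2) by (rule null_diff_eval_poly)
    moreover have "eval_poly id (Z n) p = 0" for n using assms(1)[of n] that by (auto simp: points_def)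
    ultimately show ?thesis using null_diff_unique null_diff_const by fastforce
  qed
  then show ?thesis by (simp add: points_def)
qed

text \<open>If \<open>n\<close> is not divisible by \<open>p\<close>, then \<open>n x = p y + 1\<close> for some \<open>x\<close> and \<open>y\<close>, and \<open>p y + 1\<close> has
  value \<open>1\<close>.\<close>

lemma (in nonarch_local_field) char_0_if_residue_char_nonzero:
  assumes p: "prime p" "v (of_nat p) < 1" "of_nat p \<noteq> (0::'f)" and n: "0 < n"
  shows "of_nat n \<noteq> (0::'f)"
  using n
proof (induction n rule: less_induct)
  case (less n)
  show ?case
  proof (cases "p dvd n")
    case True
    then obtain m where m: "n = p * m" by blast
    then have "0 < m" "m < n" using less.prems prime_gt_1_nat[OF p(1)] by auto
    then show ?thesis using less.IH p(3) m by simp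
  next
    case False
    then have "coprime n p" using p(1) prime_imp_coprime coprime_commute by blast
    then obtain x y where xy: "n * x = p * y + 1" using bezout_nat[of n p] less.prems by auto
    show ?thesis
    proof
      assume "of_nat n = (0::'f)"
      then have "of_nat (p * y + 1) = (0::'f)" unfolding xy[symmetric] by simp
      then have "(of_nat p * of_nat y :: 'f) = - 1" by (simp add: eq_neg_iff_add_eq_0 add.commute)
      then have "v (of_nat p) * v (of_nat y) = 1" by (metis mult v_minus v_1)
      moreover have "v (of_nat p) * v (of_nat y) \<le> v (of_nat p) * 1"
        using nonneg v_of_nat_le by (intro mult_left_mono)
      ultimately show False using p(2) by simp
    qed
  qed
qed

section \<open>Roots in embedded groups\<close>

text \<open>The data provided by \<open>ex_matrix_embedding\<close>.\<close>

locale embedded_group = valued_matrices v N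
  for v :: "'f::field \<Rightarrow> real" and N +
  fixes G :: "('n::finite, 'f) affine_group" and T :: "('n \<Rightarrow> 'f) \<Rightarrow> 'f lin"
    and w :: "'n \<Rightarrow> nat \<Rightarrow> nat \<Rightarrow> 'f"
  assumes G: "group_scheme G"
    and T_in': "g \<in> carrier (rational_points G) \<Longrightarrow> T g \<in> mats"
    and T_one: "T (unit_pt G id) = 1"
    and T_mult': "g \<in> carrier (rational_points G) \<Longrightarrow> h \<in> carrier (rational_points G) \<Longrightarrow>
        T (mult_pt G id g h) = T g * T h"
    and T_coord': "g \<in> carrier (rational_points G) \<Longrightarrow>
        g i = (\<Sum>a<N. \<Sum>b<N. w i a b * unblock N (T g) $$ (a, b))"
    and T_cont': "(\<And>n. Y n \<in> carrier (rational_points G)) \<Longrightarrow> g \<in> carrier (rational_points G) \<Longrightarrow>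
        (\<And>i. null_diff (\<lambda>n. Y n i) (g i)) \<Longrightarrow> a < N \<Longrightarrow> b < N \<Longrightarrow>
        null_diff (\<lambda>n. unblock N (T (Y n)) $$ (a, b)) (unblock N (T g) $$ (a, b))"
begin

abbreviation \<Gamma> where "\<Gamma> \<equiv> rational_points G"
abbreviation X where "X \<equiv> carrier \<Gamma>"

sublocale \<Gamma>: group \<Gamma>
  by (rule group_rational_points[OF G])

lemmas T_in [intro] = T_in' and T_coord = T_coord'

lemma mult_eq: "x \<otimes>\<^bsub>\<Gamma>\<^esub> y = mult_pt G id x y" and one_eq: "\<one>\<^bsub>\<Gamma>\<^esub> = unit_pt G id"
  by (simp_all add: rational_points_simps)

lemma T_mult: "x \<in> X \<Longrightarrow> y \<in> X \<Longrightarrow> T (x \<otimes>\<^bsub>\<Gamma>\<^esub> y) = T x * T y"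
  by (simp add: mult_eq T_mult')

lemma subgroup_power: "subgroup Y \<Gamma> \<Longrightarrow> y \<in> Y \<Longrightarrow> y [^]\<^bsub>\<Gamma>\<^esub> n \<in> Y" for n :: nat
  by (induction n) (simp_all add: subgroup.one_closed subgroup.m_closed)

lemma T_1: "T \<one>\<^bsub>\<Gamma>\<^esub> = 1"
  by (simp add: one_eq T_one)

lemma T_power: "x \<in> X \<Longrightarrow> T (x [^]\<^bsub>\<Gamma>\<^esub> n) = T x ^ n" for n :: nat
  by (induction n) (simp_all add: T_1 T_mult power_commutes)

lemma T_inj:
  assumes "x \<in> X" "y \<in> X" "T x = T y"
  shows "x = y"
proof
  fix i
  have "x i = (\<Sum>a<N. \<Sum>b<N. w i a b * unblock N (T y) $$ (a, b))"
    unfolding assms(3)[symmetric] by (rule T_coord[OF assms(1)])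
  also have "\<dots> = y i" by (rule T_coord[OF assms(2), symmetric])
  finally show "x i = y i" .
qed

lemma converges_T:
  assumes "\<And>n. Z n \<in> X" "z \<in> X" "\<And>i. null_diff (\<lambda>n. Z n i) (z i)"
  shows "converges (\<lambda>n. T (Z n)) (T z)"
  unfolding converges_def
  using assms T_cont'[of Z z] by (auto intro!: nm_tendsto_0_if_entries)

lemma null_diff_entries:
  assumes "converges Z z" "a < N" "b < N"
  shows "null_diff (\<lambda>n. unblock N (Z n) $$ (a, b)) (unblock N z $$ (a, b))"
proof (rule null_diff_le)
  show "v (unblock N (Z n) $$ (a, b) - unblock N z $$ (a, b)) \<le> nm (Z n - z)" for n
    using nm_ge[OF assms(2,3), of "Z n - z"] assms by (simp add: unblock_simps)
qed (use assms in \<open>simp add: converges_def\<close>)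

lemma null_diff_coord:
  assumes "converges (\<lambda>n. T (Z n)) (T z)" "\<And>n. Z n \<in> X" "z \<in> X"
  shows "null_diff (\<lambda>n. Z n i) (z i)"
proof -
  have "null_diff (\<lambda>n. \<Sum>a<N. \<Sum>b<N. w i a b * unblock N (T (Z n)) $$ (a, b))
      (\<Sum>a<N. \<Sum>b<N. w i a b * unblock N (T z) $$ (a, b))"
    using assms(1) by (intro null_diff_sum null_diff_mult null_diff_const null_diff_entries) auto
  then show ?thesis unfolding T_coord[OF assms(2), symmetric] T_coord[OF assms(3), symmetric] .
qed

lemma coord_bounded:
  fixes Z :: "nat \<Rightarrow> 'n \<Rightarrow> 'f"
  assumes "\<And>n. Z n \<in> X" "\<And>n. nm (T (Z n)) \<le> C"
  shows "\<exists>B. \<forall>n i. v (Z n i) \<le> B"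
proof -
  define W where "W = Max (insert 0 ((\<lambda>(i, a, b). v (w i a b)) ` (UNIV \<times> {..<N} \<times> {..<N})))"
  have W0: "0 \<le> W" unfolding W_def by (intro Max_ge) auto
  have W: "v (w i a b) \<le> W" if "a < N" "b < N" for i a b
  proof -
    have "(i, a, b) \<in> UNIV \<times> {..<N} \<times> {..<N}" using that by auto
    then have "(\<lambda>(i, a, b). v (w i a b)) (i, a, b) \<in> (\<lambda>(i, a, b). v (w i a b)) ` (UNIV \<times> {..<N} \<times> {..<N})"
      by (rule imageI)
    then show ?thesis unfolding W_def by (intro Max_ge) auto
  qed
  have C: "0 \<le> C" using assms(2)[of 0] nm_nonneg'[of "T (Z 0)"] by linarith
  have "v (\<Sum>a<N. \<Sum>b<N. w i a b * unblock N (T (Z n)) $$ (a, b)) \<le> W * C" for n i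
  proof (intro v_sum_le)
    fix a b assume ab: "a \<in> {..<N}" "b \<in> {..<N}"
    show "v (w i a b * unblock N (T (Z n)) $$ (a, b)) \<le> W * C"
      unfolding mult using ab W W0 nonneg nm_ge[of a b "T (Z n)"] assms(2)[of n]
      by (intro mult_mono) auto
  qed (use W0 C in auto)
  then have "v (Z n i) \<le> W * C" for n i
    unfolding T_coord[OF assms(1), symmetric] .
  then show ?thesis by blast
qed

lemma root_if_finite_order:
  fixes k M :: nat
  assumes Y: "subgroup Y \<Gamma>" and g: "g \<in> Y" and k: "0 < k" "coprime M k" and gM: "g [^]\<^bsub>\<Gamma>\<^esub> M = \<one>\<^bsub>\<Gamma>\<^esub>"
  shows "\<exists>y\<in>Y. y [^]\<^bsub>\<Gamma>\<^esub> k = g"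
proof -
  have gX: "g \<in> X" using Y g subgroup.subset by blast
  obtain b c where bc: "k * b = M * c + 1" using bezout_nat[of k M] k by (auto simp: coprime_commute coprime_imp_gcd_eq_1)
  have "(g [^]\<^bsub>\<Gamma>\<^esub> b) [^]\<^bsub>\<Gamma>\<^esub> k = g [^]\<^bsub>\<Gamma>\<^esub> (b * k)" using gX by (rule \<Gamma>.nat_pow_pow)
  also have "\<dots> = g [^]\<^bsub>\<Gamma>\<^esub> (M * c + 1)" using bc by (simp only: mult.commute)
  also have "\<dots> = (g [^]\<^bsub>\<Gamma>\<^esub> M) [^]\<^bsub>\<Gamma>\<^esub> c \<otimes>\<^bsub>\<Gamma>\<^esub> g"
    using gX by (simp add: \<Gamma>.nat_pow_pow)
  finally have "(g [^]\<^bsub>\<Gamma>\<^esub> b) [^]\<^bsub>\<Gamma>\<^esub> k = g" using gX gM by simp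
  moreover have "g [^]\<^bsub>\<Gamma>\<^esub> b \<in> Y" using subgroup_power[OF Y g] by simp
  ultimately show ?thesis by blast
qed

text \<open>Choose \<open>b a\<close> with \<open>k * b a\<close> congruent to \<open>1\<close> modulo \<open>M * p ^ a\<close>. The powers of \<open>g\<close> with exponents \<open>b a\<close> are bounded, and their \<open>k\<close>-th powers
  tend to \<open>g\<close>; so the limit of a convergent subsequence is a root. It satisfies the
  equations \<open>E\<close> since these are closed conditions.\<close>

lemma root_if_topologically_torsion:
  fixes k M p :: nat
  assumes Y: "subgroup Y \<Gamma>" "Y = points id {0} E" and g: "g \<in> Y"
    and p: "prime p" "\<not> p dvd k" and k: "0 < k" and M: "0 < M" "coprime M k"
    and bounded: "\<And>j. nm (T g ^ j) \<le> C"
    and lim: "(\<lambda>a. nm (T g ^ (M * p ^ a) - 1)) \<longlonglongrightarrow> 0"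
  shows "\<exists>y\<in>Y. y [^]\<^bsub>\<Gamma>\<^esub> k = g"
proof -
  have YX: "Y \<subseteq> X" using Y(1) subgroup.subset by blast
  then have gX: "g \<in> X" using g by blast
  then have TgA: "T g \<in> mats" ..
  have "\<exists>b c. k * b = M * p ^ a * c + 1" for a
  proof -
    have "coprime k (M * p ^ a)"
      using M(2) p prime_imp_coprime[of p k] by (auto simp: coprime_commute)
    then show ?thesis using bezout_nat[of k "M * p ^ a"] k by auto
  qed
  then obtain b c where bc: "\<And>a. k * b a = M * p ^ a * c a + 1" by metis
  define Z where "Z a = g [^]\<^bsub>\<Gamma>\<^esub> b a" for a
  have ZY: "Z a \<in> Y" for a unfolding Z_def using subgroup_power[OF Y(1) g] by simp
  then have ZX: "Z a \<in> X" for a using YX by blast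
  have TZ: "T (Z a) = T g ^ b a" for a unfolding Z_def using gX by (rule T_power)
  have "nm (T (Z a)) \<le> C" for a unfolding TZ by (rule bounded)
  then obtain B where B: "\<And>n i. v (Z n i) \<le> B" using coord_bounded[of Z C] ZX by blast
  have "\<exists>y r. strict_mono (r :: nat \<Rightarrow> nat) \<and> (\<forall>i\<in>UNIV. null_diff (\<lambda>n. Z (r n) i) (y i))"
    by (rule bounded_family_subsequence[OF finite B])
  then obtain y r where r: "strict_mono (r :: nat \<Rightarrow> nat)" "\<And>i. null_diff (\<lambda>n. Z (r n) i) (y i)"
    by blast
  have "y \<in> Y" unfolding Y(2)
    by (rule points_closed[OF ZY[unfolded Y(2)] r(2)])
  then have yX: "y \<in> X" using YX by blast
  have "converges (\<lambda>n. T (Z (r n)) ^ k) (T y ^ k)"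
    using ZX yX r(2) by (intro converges_power converges_T)
  moreover have "converges (\<lambda>n. T (Z (r n)) ^ k) (T g)"
  proof (rule converges_nm_le)
    show "T (Z (r n)) ^ k \<in> mats" for n using ZX by auto
    show "T g \<in> mats" by fact
    fix n
    let ?a = "r n"
    let ?z = "T g ^ (M * p ^ ?a)"
    \<comment> \<open>The exponents \<open>c\<close> are unbounded, but \<open>z ^ c - 1\<close> is \<open>z - 1\<close> times a bounded sum.\<close>
    have "T (Z ?a) ^ k = T g ^ (k * b ?a)" unfolding TZ by (simp add: mult.commute flip: power_mult)
    also have "\<dots> = T g * ?z ^ c ?a" unfolding bc by (simp add: power_mult)
    finally have "T (Z ?a) ^ k - T g = T g * (?z ^ c ?a - 1)" by (simp add: right_diff_distrib)
    also have "?z ^ c ?a - 1 = (?z - 1) * (\<Sum>l<c ?a. ?z ^ l)"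
      using one_minus_power[of ?z "c ?a"] by (metis minus_diff_eq minus_mult_left)
    finally have eq: "T (Z ?a) ^ k - T g = T g * ((?z - 1) * (\<Sum>l<c ?a. ?z ^ l))" .
    have C: "0 \<le> C" using bounded[of 0] nm_nonneg'[of "T g ^ 0"] by linarith
    have sum: "nm (\<Sum>l<c ?a. ?z ^ l) \<le> C"
      using TgA C bounded by (intro nm_sum_le) (auto simp flip: power_mult)
    have "nm (T (Z ?a) ^ k - T g) \<le> nm (T g) * nm ((?z - 1) * (\<Sum>l<c ?a. ?z ^ l))"
      unfolding eq using TgA by (intro nm_mult_le) auto
    also have "\<dots> \<le> nm (T g) * (nm (?z - 1) * nm (\<Sum>l<c ?a. ?z ^ l))"
      using TgA nm_nonneg' by (intro mult_left_mono nm_mult_le) auto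
    also have "\<dots> \<le> nm (T g) * (nm (?z - 1) * C)"
      using sum nm_nonneg' by (intro mult_left_mono)
    finally show "nm (T (Z ?a) ^ k - T g) \<le> nm (T g) * (nm (T g ^ (M * p ^ r n) - 1) * C)" .
  next
    have "(\<lambda>n. nm (T g ^ (M * p ^ r n) - 1)) \<longlonglongrightarrow> 0"
      using LIMSEQ_subseq_LIMSEQ[OF lim r(1)] by (simp add: o_def)
    then have "(\<lambda>n. nm (T g) * (nm (T g ^ (M * p ^ r n) - 1) * C)) \<longlonglongrightarrow> nm (T g) * (0 * C)"
      by (intro tendsto_intros)
    then show "(\<lambda>n. nm (T g) * (nm (T g ^ (M * p ^ r n) - 1) * C)) \<longlonglongrightarrow> 0" by simp
  qed
  ultimately have "T y ^ k = T g" by (rule converges_unique)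
  then have "y [^]\<^bsub>\<Gamma>\<^esub> k = g" using yX gX by (intro T_inj) (auto simp: T_power)
  then show ?thesis using \<open>y \<in> Y\<close> by blast
qed

text \<open>For \<open>u = g ^ M\<close> the binomial formula shows that the coordinates of \<open>u ^ j\<close> are polynomials in \<open>j\<close>. This defines a curve
  \<open>c\<close> with \<open>c j = u ^ j\<close>. Every identity between polynomials in its coordinates that holds at the natural
  numbers holds along the whole curve. This applies to the equations \<open>E\<close>, to
  \<open>c (j t) * c t = c ((j + 1) t)\<close> and to \<open>c t * g = g * c t\<close>. So \<open>y = c (1 / k)\<close> satisfies \<open>y ^ k = u\<close> and commutes with \<open>g\<close>. With
  \<open>M * \<beta> = k * \<gamma> + 1\<close>, the element \<open>y ^ \<beta> * g ^ (- \<gamma>)\<close> is a root of \<open>g\<close>.\<close>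

lemma root_if_unipotent:
  fixes k M :: nat
  assumes char0: "\<forall>n>0. of_nat n \<noteq> (0::'f)"
    and Y: "subgroup Y \<Gamma>" "Y = points id {0} E" and g: "g \<in> Y"
    and k: "0 < k" and M: "0 < M" "coprime M k" and nil: "(T g ^ M - 1) ^ N = 0"
  shows "\<exists>y\<in>Y. y [^]\<^bsub>\<Gamma>\<^esub> k = g"
proof -
  have YX: "Y \<subseteq> X" using Y(1) subgroup.subset by blast
  then have gX: "g \<in> X" using g by blast
  define u where "u = g [^]\<^bsub>\<Gamma>\<^esub> M"
  have uY: "u [^]\<^bsub>\<Gamma>\<^esub> j \<in> Y" for j :: nat
    unfolding u_def by (intro subgroup_power[OF Y(1)] g)
  have uX: "u \<in> X" unfolding u_def using gX by simp
  define z where "z = T g ^ M - 1"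
  define coord where "coord i Z = (\<Sum>a<N. \<Sum>b<N. w i a b * unblock N Z $$ (a, b))" for i Z
  define q where "q i = (\<Sum>s<N. Polynomial.smult (coord i (z ^ s)) (binomial_poly s))" for i
  define c where "c t = (\<lambda>i. poly (q i) t)" for t
  have c_nat: "c (of_nat j) = u [^]\<^bsub>\<Gamma>\<^esub> j" for j
  proof
    fix i
    have "T u = 1 + z" unfolding u_def z_def using gX by (simp add: T_power)
    then have "T (u [^]\<^bsub>\<Gamma>\<^esub> j) = (\<Sum>s<N. of_nat (j choose s) * z ^ s)"
      using unipotent_power_binomial[of z N j] nil uX by (simp add: z_def[symmetric] T_power)
    also have "\<dots> = (\<Sum>s<N. scalar (of_nat (j choose s)) * z ^ s)" by (simp add: sc_of_nat)
    finally have T: "T (u [^]\<^bsub>\<Gamma>\<^esub> j) = (\<Sum>s<N. scalar (of_nat (j choose s)) * z ^ s)" .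
    have "(u [^]\<^bsub>\<Gamma>\<^esub> j) i = (\<Sum>a<N. \<Sum>b<N. w i a b * (\<Sum>s<N. of_nat (j choose s) * unblock N (z ^ s) $$ (a, b)))"
      unfolding T_coord[OF \<Gamma>.nat_pow_closed[OF uX]] T
      by (simp add: unblock_sum_index unblock_simps)
    also have "\<dots> = (\<Sum>a<N. \<Sum>b<N. \<Sum>s<N. of_nat (j choose s) * (w i a b * unblock N (z ^ s) $$ (a, b)))"
      by (simp add: sum_distrib_left mult_ac)
    also have "\<dots> = (\<Sum>a<N. \<Sum>s<N. \<Sum>b<N. of_nat (j choose s) * (w i a b * unblock N (z ^ s) $$ (a, b)))"
      by (intro sum.cong refl sum.swap)
    also have "\<dots> = (\<Sum>s<N. \<Sum>a<N. \<Sum>b<N. of_nat (j choose s) * (w i a b * unblock N (z ^ s) $$ (a, b)))"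
      by (rule sum.swap)
    also have "\<dots> = (\<Sum>s<N. of_nat (j choose s) * coord i (z ^ s))"
      by (simp add: coord_def sum_distrib_left)
    also have "\<dots> = c (of_nat j) i"
      by (simp add: c_def q_def poly_sum poly_binomial_poly[OF char0] mult.commute)
    finally show "c (of_nat j) i = (u [^]\<^bsub>\<Gamma>\<^esub> j) i" by simp
  qed
  have cY: "c t \<in> Y" for t
  proof -
    have "eval_poly id (c t) f = 0" if f: "f \<in> E" for f
    proof -
      obtain P where P: "\<And>t. eval_poly id (c t) f = poly P t"
        using ex_poly_along_curve[of q f] unfolding c_def by blast
      have "poly P (of_nat j) = poly 0 (of_nat j)" for j
        using uY[of j] f by (simp add: P[symmetric] c_nat Y(2) points_def)
      then have "poly P t = poly 0 t" by (rule poly_eq_if_eq_on_nat[OF char0])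
      then show ?thesis by (simp add: P)
    qed
    then show ?thesis by (simp add: Y(2) points_def)
  qed
  have case_sum_poly: "case_sum (\<lambda>i. poly (q1 i) t) (\<lambda>i. poly (q2 i) t) = (\<lambda>i. poly (case_sum q1 q2 i) t)"
    for q1 q2 :: "'n \<Rightarrow> 'f poly" and t
    by (auto simp: fun_eq_iff split: sum.split)
  have mult_poly: "\<exists>P. \<forall>t. mult_pt G id (\<lambda>i. poly (q1 i) t) (\<lambda>i. poly (q2 i) t) i = poly P t"
    for q1 q2 i
    unfolding mult_pt_def case_sum_poly by (rule ex_poly_along_curve)
  have c_mult: "c (of_nat j * t) \<otimes>\<^bsub>\<Gamma>\<^esub> c t = c (of_nat (Suc j) * t)" for j t
  proof
    fix i
    let ?q = "\<lambda>j i. pcompose (q i) [:0, of_nat j:]"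
    have c_scaled: "c (of_nat j * t) = (\<lambda>i. poly (?q j i) t)" for j t
      by (simp add: c_def poly_pcompose mult.commute)
    obtain P where P: "\<And>t. (c (of_nat j * t) \<otimes>\<^bsub>\<Gamma>\<^esub> c t) i = poly P t"
      using mult_poly[of "?q j" q i] unfolding mult_eq c_scaled unfolding c_def by blast
    have "poly P (of_nat n) = poly (?q (Suc j) i) (of_nat n)" for n
    proof -
      have "poly P (of_nat n) = (c (of_nat (j * n)) \<otimes>\<^bsub>\<Gamma>\<^esub> c (of_nat n)) i"
        unfolding P[symmetric] by simp
      also have "\<dots> = c (of_nat (Suc j * n)) i"
        unfolding c_nat using uX by (simp add: \<Gamma>.nat_pow_mult add.commute)
      also have "\<dots> = c (of_nat (Suc j) * of_nat n) i" by (simp only: of_nat_mult)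
      finally show ?thesis unfolding c_scaled .
    qed
    then have "poly P t = poly (?q (Suc j) i) t" by (rule poly_eq_if_eq_on_nat[OF char0])
    then show "(c (of_nat j * t) \<otimes>\<^bsub>\<Gamma>\<^esub> c t) i = c (of_nat (Suc j) * t) i"
      by (subst P) (simp only: c_scaled)
  qed
  have c_comm: "c t \<otimes>\<^bsub>\<Gamma>\<^esub> g = g \<otimes>\<^bsub>\<Gamma>\<^esub> c t" for t
  proof
    fix i
    have "\<exists>P. \<forall>t. (c t \<otimes>\<^bsub>\<Gamma>\<^esub> g) i = poly P t"
      using mult_poly[of q "\<lambda>i. [:g i:]" i] by (simp add: c_def mult_eq)
    then obtain P where P: "\<And>t. (c t \<otimes>\<^bsub>\<Gamma>\<^esub> g) i = poly P t" by blast
    have "\<exists>Q. \<forall>t. (g \<otimes>\<^bsub>\<Gamma>\<^esub> c t) i = poly Q t"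
      using mult_poly[of "\<lambda>i. [:g i:]" q i] by (simp add: c_def mult_eq)
    then obtain Q where Q: "\<And>t. (g \<otimes>\<^bsub>\<Gamma>\<^esub> c t) i = poly Q t" by blast
    have "poly P (of_nat n) = poly Q (of_nat n)" for n
      unfolding P[symmetric] Q[symmetric] c_nat u_def
      using gX by (simp only: \<Gamma>.nat_pow_pow \<Gamma>.nat_pow_Suc[symmetric] \<Gamma>.nat_pow_Suc2[symmetric])
    then have "poly P t = poly Q t" by (rule poly_eq_if_eq_on_nat[OF char0])
    then show "(c t \<otimes>\<^bsub>\<Gamma>\<^esub> g) i = (g \<otimes>\<^bsub>\<Gamma>\<^esub> c t) i" by (simp add: P Q)
  qed
  define y where "y = c (inverse (of_nat k))"
  have yY: "y \<in> Y" and yX: "y \<in> X" unfolding y_def using cY YX by auto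
  have "y [^]\<^bsub>\<Gamma>\<^esub> j = c (of_nat j * inverse (of_nat k))" for j :: nat
  proof (induction j)
    case 0
    then show ?case using c_nat[of 0] by simp
  next
    case (Suc j)
    then show ?case using c_mult[of j "inverse (of_nat k)"] by (simp add: y_def del: of_nat_Suc)
  qed
  from this[of k] have yk: "y [^]\<^bsub>\<Gamma>\<^esub> k = u"
    using char0[rule_format, OF k] c_nat[of 1] uX by simp
  have yg: "y \<otimes>\<^bsub>\<Gamma>\<^esub> g = g \<otimes>\<^bsub>\<Gamma>\<^esub> y" unfolding y_def by (rule c_comm)
  obtain \<beta> \<gamma> where bg: "M * \<beta> = k * \<gamma> + 1" using bezout_nat[of M k] M by auto
  define a where "a = y [^]\<^bsub>\<Gamma>\<^esub> \<beta>"
  define b where "b = g [^]\<^bsub>\<Gamma>\<^esub> \<gamma>"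
  have ab_in: "a \<in> X" "b \<in> X" "a \<in> Y" "b \<in> Y"
    unfolding a_def b_def using gX yX g yY subgroup_power[OF Y(1)] by auto
  have "b \<otimes>\<^bsub>\<Gamma>\<^esub> y = y \<otimes>\<^bsub>\<Gamma>\<^esub> b" unfolding b_def by (rule \<Gamma>.group_commutes_pow[OF yg[symmetric] gX yX])
  then have "a \<otimes>\<^bsub>\<Gamma>\<^esub> b = b \<otimes>\<^bsub>\<Gamma>\<^esub> a" unfolding a_def
    using ab_in yX by (intro \<Gamma>.group_commutes_pow) auto
  then have comm: "a \<otimes>\<^bsub>\<Gamma>\<^esub> inv\<^bsub>\<Gamma>\<^esub> b = inv\<^bsub>\<Gamma>\<^esub> b \<otimes>\<^bsub>\<Gamma>\<^esub> a"
    using ab_in by (metis \<Gamma>.inv_closed \<Gamma>.inv_solve_left \<Gamma>.inv_solve_right \<Gamma>.m_assoc \<Gamma>.m_closed)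
  have "(a \<otimes>\<^bsub>\<Gamma>\<^esub> inv\<^bsub>\<Gamma>\<^esub> b) [^]\<^bsub>\<Gamma>\<^esub> k = a [^]\<^bsub>\<Gamma>\<^esub> k \<otimes>\<^bsub>\<Gamma>\<^esub> inv\<^bsub>\<Gamma>\<^esub> b [^]\<^bsub>\<Gamma>\<^esub> k"
    using comm ab_in by (intro \<Gamma>.pow_mult_distrib) auto
  also have "a [^]\<^bsub>\<Gamma>\<^esub> k = (y [^]\<^bsub>\<Gamma>\<^esub> k) [^]\<^bsub>\<Gamma>\<^esub> \<beta>"
    unfolding a_def using yX by (simp add: \<Gamma>.nat_pow_pow mult.commute)
  also have "\<dots> = g [^]\<^bsub>\<Gamma>\<^esub> (k * \<gamma> + 1)"
    unfolding yk u_def using gX by (simp add: \<Gamma>.nat_pow_pow bg)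
  also have "\<dots> = g \<otimes>\<^bsub>\<Gamma>\<^esub> b [^]\<^bsub>\<Gamma>\<^esub> k"
    unfolding b_def using gX by (simp add: \<Gamma>.nat_pow_pow mult.commute flip: \<Gamma>.nat_pow_Suc2)
  also have "g \<otimes>\<^bsub>\<Gamma>\<^esub> b [^]\<^bsub>\<Gamma>\<^esub> k \<otimes>\<^bsub>\<Gamma>\<^esub> inv\<^bsub>\<Gamma>\<^esub> b [^]\<^bsub>\<Gamma>\<^esub> k = g"
    using gX ab_in by (simp add: \<Gamma>.m_assoc \<Gamma>.nat_pow_inv)
  finally have "(a \<otimes>\<^bsub>\<Gamma>\<^esub> inv\<^bsub>\<Gamma>\<^esub> b) [^]\<^bsub>\<Gamma>\<^esub> k = g" .
  moreover have "a \<otimes>\<^bsub>\<Gamma>\<^esub> inv\<^bsub>\<Gamma>\<^esub> b \<in> Y"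
    using ab_in Y(1) by (simp add: subgroup.m_closed subgroup.m_inv_closed)
  ultimately show ?thesis by blast
qed

text \<open>The three kinds of exponents lead to the three constructions of roots. The subgroup \<open>Y\<close>
  in which roots are sought is independent of \<open>H\<close>, so that the statement serves for the group itself and for
  its algebraic subgroups.\<close>

theorem roots_if_dense:
  fixes k :: nat
  assumes H: "H \<lhd> \<Gamma>"
    and closed: "\<And>Z z. (\<And>n. Z n \<in> H) \<Longrightarrow> z \<in> X \<Longrightarrow> (\<And>i. null_diff (\<lambda>n. Z n i) (z i)) \<Longrightarrow> z \<in> H"
    and denseH: "\<And>h. h \<in> H \<Longrightarrow> \<exists>Z. (\<forall>n. Z n \<in> H) \<and> (\<forall>i. null_diff (\<lambda>n. (Z n [^]\<^bsub>\<Gamma>\<^esub> k) i) (h i))"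
    and denseG: "\<And>g. g \<in> X \<Longrightarrow> \<exists>Z W. (\<forall>n. Z n \<in> X \<and> W n \<in> H) \<and>
        (\<forall>i. null_diff (\<lambda>n. (Z n [^]\<^bsub>\<Gamma>\<^esub> k \<otimes>\<^bsub>\<Gamma>\<^esub> W n) i) (g i))"
    and k: "2 \<le> k" and Y: "subgroup Y \<Gamma>" "Y = points id {0} E" and g: "g \<in> Y"
  shows "\<exists>y\<in>Y. y [^]\<^bsub>\<Gamma>\<^esub> k = g"
proof -
  interpret H: normal H \<Gamma> by fact
  have HX: "h \<in> X" if "h \<in> H" for h using that H.subset by blast
  have gX: "g \<in> X" using Y(1) g subgroup.subset by blast
  have HT: "\<exists>Z W. (\<forall>n. Z n \<in> T ` H \<and> W n \<in> {1}) \<and> converges (\<lambda>n. Z n ^ k * W n) h" if h: "h \<in> T ` H" for h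
  proof -
    obtain h' where h': "h' \<in> H" "h = T h'" using h by blast
    obtain Z where Z: "\<And>n. Z n \<in> H" "\<And>i. null_diff (\<lambda>n. (Z n [^]\<^bsub>\<Gamma>\<^esub> k) i) (h' i)" using denseH[OF h'(1)] by blast
    have "converges (\<lambda>n. T (Z n [^]\<^bsub>\<Gamma>\<^esub> k)) (T h')"
      using Z h'(1) HX by (intro converges_T) auto
    then have "converges (\<lambda>n. T (Z n) ^ k * 1) h" using Z(1) HX h'(2) by (simp add: T_power)
    then show ?thesis using Z(1) by (intro exI[of _ "\<lambda>n. T (Z n)"] exI[of _ "\<lambda>n. 1"]) auto
  qed
  have GT: "\<exists>Z W. (\<forall>n. Z n \<in> T ` X \<and> W n \<in> T ` H) \<and> converges (\<lambda>n. Z n ^ k * W n) x" if x: "x \<in> T ` X" for x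
  proof -
    obtain x' where x': "x' \<in> X" "x = T x'" using x by blast
    obtain Z W where Z: "\<And>n. Z n \<in> X" "\<And>n. W n \<in> H" "\<And>i. null_diff (\<lambda>n. (Z n [^]\<^bsub>\<Gamma>\<^esub> k \<otimes>\<^bsub>\<Gamma>\<^esub> W n) i) (x' i)"
      using denseG[OF x'(1)] by blast
    have "converges (\<lambda>n. T (Z n [^]\<^bsub>\<Gamma>\<^esub> k \<otimes>\<^bsub>\<Gamma>\<^esub> W n)) (T x')"
      using Z x'(1) HX by (intro converges_T) auto
    then have "converges (\<lambda>n. T (Z n) ^ k * T (W n)) x" using Z(1,2) HX x'(2) by (simp add: T_power T_mult)
    then show ?thesis using Z(1,2) by (intro exI[of _ "\<lambda>n. T (Z n)"] exI[of _ "\<lambda>n. T (W n)"]) auto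
  qed
  have TX: "T ` X \<subseteq> mats" "1 \<in> T ` X" "\<And>x y. x \<in> T ` X \<Longrightarrow> y \<in> T ` X \<Longrightarrow> x * y \<in> T ` X"
    using T_1 \<Gamma>.one_closed \<Gamma>.m_closed by (auto simp: image_iff simp flip: T_mult)
  have TH: "T ` H \<subseteq> T ` X" "1 \<in> T ` H" "\<And>x y. x \<in> T ` H \<Longrightarrow> y \<in> T ` H \<Longrightarrow> x * y \<in> T ` H"
    using T_1 H.one_closed H.m_closed HX by (auto simp: image_iff simp flip: T_mult)
  have Tnormal: "\<exists>h'\<in>T ` H. h * x = x * h'" if x: "x \<in> T ` X" and h: "h \<in> T ` H" for x h
  proof -
    obtain x' h' where *: "x' \<in> X" "h' \<in> H" "x = T x'" "h = T h'" using x h by blast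
    then have "inv\<^bsub>\<Gamma>\<^esub> x' \<otimes>\<^bsub>\<Gamma>\<^esub> h' \<otimes>\<^bsub>\<Gamma>\<^esub> x' \<in> H" by (intro H.inv_op_closed1)
    moreover have "h' \<otimes>\<^bsub>\<Gamma>\<^esub> x' = x' \<otimes>\<^bsub>\<Gamma>\<^esub> (inv\<^bsub>\<Gamma>\<^esub> x' \<otimes>\<^bsub>\<Gamma>\<^esub> h' \<otimes>\<^bsub>\<Gamma>\<^esub> x')"
      using * HX by (simp add: \<Gamma>.m_assoc[symmetric])
    ultimately show ?thesis using * HX by (metis T_mult imageI)
  qed
  have Tinv: "\<exists>y\<in>T ` S. x * y = 1 \<and> y * x = 1" if S: "subgroup S \<Gamma>" and x: "x \<in> T ` S" for S x
  proof -
    obtain x' where x': "x' \<in> S" "x = T x'" using x by blast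
    then have x'X: "x' \<in> X" using S subgroup.subset by blast
    have "inv\<^bsub>\<Gamma>\<^esub> x' \<in> S" using S x'(1) subgroup.m_inv_closed by metis
    moreover have "x * T (inv\<^bsub>\<Gamma>\<^esub> x') = 1" "T (inv\<^bsub>\<Gamma>\<^esub> x') * x = 1"
      using x'X T_mult[of x' "inv\<^bsub>\<Gamma>\<^esub> x'"] T_mult[of "inv\<^bsub>\<Gamma>\<^esub> x'" x'] by (simp_all add: x'(2) T_1)
    ultimately show ?thesis by blast
  qed
  interpret D: dense_powers v scalar mats nm "\<lambda>a i. Polynomial.coeff (revchar a) i" N "N * N" "T ` X" "T ` H" k
  proof
    show "T ` X \<subseteq> mats" "1 \<in> T ` X" "T ` H \<subseteq> T ` X" "1 \<in> T ` H" by fact+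
    show "x * y \<in> T ` X" if "x \<in> T ` X" "y \<in> T ` X" for x y using that by (rule TX(3))
    show "x * y \<in> T ` H" if "x \<in> T ` H" "y \<in> T ` H" for x y using that by (rule TH(3))
    show "\<exists>y\<in>T ` X. x * y = 1 \<and> y * x = 1" if "x \<in> T ` X" for x using \<Gamma>.subgroup_self that by (rule Tinv)
    show "\<exists>y\<in>T ` H. x * y = 1 \<and> y * x = 1" if "x \<in> T ` H" for x using H.is_subgroup that by (rule Tinv)
    show "\<exists>h'\<in>T ` H. h * x = x * h'" if "x \<in> T ` X" "h \<in> T ` H" for x h using that by (rule Tnormal)
    show "2 \<le> k" by fact
    show "x \<in> T ` H" if Z: "\<And>n. Z n \<in> T ` H" "converges Z x" "x \<in> T ` X" for Z x
    proof -
      obtain x' where x': "x' \<in> X" "x = T x'" using Z(3) by blast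
      have "\<forall>n. \<exists>z. z \<in> H \<and> Z n = T z" using Z(1) by blast
      then obtain Z' where Z': "\<And>n. Z' n \<in> H" "\<And>n. Z n = T (Z' n)" by metis
      then have "Z = (\<lambda>n. T (Z' n))" by blast
      then have "converges (\<lambda>n. T (Z' n)) (T x')" using Z(2) x'(2) by simp
      then have "null_diff (\<lambda>n. Z' n i) (x' i)" for i using Z'(1) HX x'(1) by (intro null_diff_coord) auto
      then have "x' \<in> H" by (rule closed[OF Z'(1) x'(1)])
      then show ?thesis using x'(2) by blast
    qed
    show "\<exists>Z. (\<forall>n. Z n \<in> T ` H) \<and> converges (\<lambda>n. Z n ^ k ^ m) h" if h: "h \<in> T ` H" for h m
    proof -
      have "\<exists>Z W. (\<forall>n. Z n \<in> T ` H \<and> W n \<in> {1}) \<and> converges (\<lambda>n. Z n ^ k ^ m * W n) h"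
        using TH TX by (intro dense_powers_iterate[OF _ _ _ _ _ _ _ HT h]) auto
      then obtain Z W where Z: "\<And>n. Z n \<in> T ` H" "\<And>n. W n \<in> {1}" "converges (\<lambda>n. Z n ^ k ^ m * W n) h"
        by blast
      have "W = (\<lambda>_. 1)" using Z(2) by auto
      then show ?thesis using Z(1,3) by auto
    qed
    show "\<exists>Z W. (\<forall>n. Z n \<in> T ` X \<and> W n \<in> T ` H) \<and> converges (\<lambda>n. Z n ^ k ^ m * W n) x" if x: "x \<in> T ` X" for x m
      by (rule dense_powers_iterate[OF TX(1,3,2) TH Tnormal GT x])
  qed
  have Tg: "T g \<in> T ` X" using gX by blast
  have k0: "0 < k" using k by simp
  obtain p where p: "prime p" "v (of_nat p) < 1" using ex_residue_char by blast
  show ?thesis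
  proof (cases "p dvd k")
    case False
    obtain M where M: "0 < M" "coprime M k" "(\<lambda>a. nm (T g ^ (M * p ^ a) - 1)) \<longlonglongrightarrow> 0"
      using D.coprime_exponent_if_residue_char_coprime[OF p False] Tg by blast
    obtain C where "\<And>j. nm (T g ^ j) \<le> C" using D.bounded_powers[OF Tg] by blast
    then show ?thesis by (rule root_if_topologically_torsion[OF Y g p(1) False k0 M(1,2) _ M(3)])
  next
    case True
    show ?thesis
    proof (cases "of_nat p = (0::'f)")
      case char: True
      obtain M where M: "0 < M" "coprime M k" "T g ^ M = 1"
        using D.coprime_exponent_if_char[OF p(1) char True] Tg by blast
      then have "g [^]\<^bsub>\<Gamma>\<^esub> M = \<one>\<^bsub>\<Gamma>\<^esub>" using gX by (intro T_inj) (auto simp: T_power T_1)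
      then show ?thesis by (rule root_if_finite_order[OF Y(1) g k0 M(2)])
    next
      case char: False
      obtain M where M: "0 < M" "coprime M k" "(T g ^ M - 1) ^ N = 0"
        using D.coprime_exponent_unipotent[OF p True] Tg by blast
      show ?thesis
      proof (rule root_if_unipotent[OF _ Y g k0 M])
        show "\<forall>n>0. of_nat n \<noteq> (0::'f)" using char_0_if_residue_char_nonzero[OF p char] by blast
      qed
    qed
  qed
qed

end

section \<open>The topology on rational points\<close>

context nonarch_local_field
begin

lemma openin_rational_ball:
  fixes G :: "('n::finite, 'f) affine_group"
  shows "openin (rational_topology v G) {y \<in> carrier (rational_points G). \<forall>i. v (y i - x i) < e}"
proof -
  interpret M: Metric_space UNIV "\<lambda>x y. v (x - y)" by (rule Metric_space)
  have "openin (product_topology (\<lambda>_. field_topology v) UNIV) (PiE UNIV (\<lambda>i::'n. M.mball (x i) e))"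
    by (subst openin_PiE) (auto simp: field_topology_def)
  moreover have "{y \<in> carrier (rational_points G). \<forall>i. v (y i - x i) < e}
      = PiE UNIV (\<lambda>i::'n. M.mball (x i) e) \<inter> carrier (rational_points G)"
    by (auto simp: M.mball_def PiE_def Pi_def v_minus_commute)
  ultimately show ?thesis unfolding rational_topology_def by (auto simp: openin_subtopology)
qed

lemma limitin_rational_topology:
  fixes G :: "('n::finite, 'f) affine_group"
  assumes "\<And>n. Z n \<in> carrier (rational_points G)" "z \<in> carrier (rational_points G)"
    "\<And>i. null_diff (\<lambda>n. Z n i) (z i)"
  shows "limitin (rational_topology v G) Z z sequentially"
proof -
  interpret M: Metric_space UNIV "\<lambda>x y. v (x - y)" by (rule Metric_space)
  have "limitin (field_topology v) (\<lambda>n. Z n i) (z i) sequentially" for i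
    using assms(3)[of i] by (simp add: field_topology_def M.limitin_metric_dist_null null_diff_def)
  then have "limitin (product_topology (\<lambda>_. field_topology v) UNIV) Z z sequentially"
    by (simp add: limitin_componentwise)
  then show ?thesis
    unfolding rational_topology_def limitin_subtopology using assms(1,2) by simp
qed

lemma ex_sequence_if_close:
  fixes x :: "'n::finite \<Rightarrow> 'f"
  assumes "\<And>e. 0 < e \<Longrightarrow> \<exists>s\<in>S. \<forall>i. v (f s i - x i) < e"
  shows "\<exists>Z. (\<forall>n. Z n \<in> S) \<and> (\<forall>i. null_diff (\<lambda>n. f (Z n) i) (x i))"
proof -
  have "\<exists>s. s \<in> S \<and> (\<forall>i. v (f s i - x i) < 1 / Suc n)" for n using assms[of "1 / Suc n"] by auto
  then obtain Z where Z: "\<And>n. Z n \<in> S" "\<And>n i. v (f (Z n) i - x i) < 1 / Suc n" by metis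
  have "null_diff (\<lambda>n. f (Z n) i) (x i)" for i
  proof (rule null_diff_le)
    show "v (f (Z n) i - x i) \<le> 1 / Suc n" for n using Z(2)[of n i] by simp
    show "(\<lambda>n. 1 / real (Suc n)) \<longlonglongrightarrow> 0" by (intro LIMSEQ_Suc lim_1_over_n)
  qed
  then show ?thesis using Z(1) by blast
qed

lemma ex_sequence_in_closure:
  fixes G :: "('n::finite, 'f) affine_group"
  assumes "x \<in> rational_topology v G closure_of S"
  shows "\<exists>Z. (\<forall>n. Z n \<in> S) \<and> (\<forall>i. null_diff (\<lambda>n. Z n i) (x i))"
proof (rule ex_sequence_if_close[of S "\<lambda>s. s" x])
  fix e :: real assume e: "0 < e"
  have "x \<in> carrier (rational_points G)"
    using assms by (simp add: in_closure_of topspace_rational_topology)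
  then have "x \<in> {y \<in> carrier (rational_points G). \<forall>i. v (y i - x i) < e}" using e by simp
  moreover have "\<And>U. x \<in> U \<Longrightarrow> openin (rational_topology v G) U \<Longrightarrow> \<exists>y\<in>S. y \<in> U"
    using assms by (auto simp: in_closure_of)
  ultimately have "\<exists>y\<in>S. y \<in> {y \<in> carrier (rational_points G). \<forall>i. v (y i - x i) < e}"
    using openin_rational_ball[of G x e] by (metis (no_types, lifting))
  then show "\<exists>s\<in>S. \<forall>i. v (s i - x i) < e" by auto
qed

text \<open>Otherwise every ball around some point \<open>x\<close> of \<open>U\<close> contains a point outside \<open>U\<close>, and such points form a sequence that
  converges to \<open>x\<close>.\<close>

lemma openin_rational_topologyI:
  fixes G :: "('n::finite, 'f) affine_group"
  assumes sub: "U \<subseteq> carrier (rational_points G)"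
    and seq: "\<And>z Z. z \<in> U \<Longrightarrow> (\<And>n. Z n \<in> carrier (rational_points G)) \<Longrightarrow>
        (\<And>i. null_diff (\<lambda>n. Z n i) (z i)) \<Longrightarrow> \<exists>n. Z n \<in> U"
  shows "openin (rational_topology v G) U"
proof (subst openin_subopen, intro ballI)
  fix x assume x: "x \<in> U"
  let ?B = "\<lambda>e. {y \<in> carrier (rational_points G). \<forall>i. v (y i - x i) < e}"
  have "\<exists>e>0. ?B e \<subseteq> U"
  proof (rule ccontr)
    assume no: "\<not> ?thesis"
    have "\<exists>Z. (\<forall>n. Z n \<in> carrier (rational_points G) - U) \<and> (\<forall>i. null_diff (\<lambda>n. Z n i) (x i))"
    proof (rule ex_sequence_if_close[of _ "\<lambda>s. s" x])
      show "\<exists>s\<in>carrier (rational_points G) - U. \<forall>i. v (s i - x i) < e" if "0 < e" for e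
        using no that by blast
    qed
    then obtain Z where Z: "\<And>n. Z n \<in> carrier (rational_points G) - U" "\<And>i. null_diff (\<lambda>n. Z n i) (x i)" by blast
    have "\<exists>n. Z n \<in> U" using Z by (intro seq[OF x]) auto
    then show False using Z(1) by auto
  qed
  then obtain e where e: "0 < e" "?B e \<subseteq> U" by blast
  show "\<exists>V. openin (rational_topology v G) V \<and> x \<in> V \<and> V \<subseteq> U"
    using openin_rational_ball[of G x e] e x sub by (intro exI[of _ "?B e"]) auto
qed

lemma closedin_points:
  fixes G :: "('n::finite, 'f) affine_group"
  assumes sub: "points id {0} E \<subseteq> carrier (rational_points G)"
  shows "closedin (rational_topology v G) (points id {0} E)"
  unfolding closedin_def topspace_rational_topology
proof (intro conjI sub openin_rational_topologyI)
  fix z Z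
  assume z: "z \<in> carrier (rational_points G) - points id {0} E"
    and Z: "\<And>n. Z n \<in> carrier (rational_points G)" "\<And>i. null_diff (\<lambda>n. Z n i) (z i)"
  show "\<exists>n. Z n \<in> carrier (rational_points G) - points id {0} E"
  proof (rule ccontr)
    assume "\<not> ?thesis"
    then have "Z n \<in> points id {0} E" for n using Z(1) by blast
    then have "z \<in> points id {0} E" using Z(2) by (rule points_closed)
    then show False using z by blast
  qed
qed auto

text \<open>A ball \<open>?U\<close> around \<open>g\<close> has an open image in the quotient, because the union of its left translates by elements of \<open>H\<close> is
  open. Density yields a power \<open>(H x)\<^sup>k\<close> in this image, that is, an element of \<open>?U\<close> in \<open>H x\<^sup>k = x\<^sup>k H\<close>.\<close>

lemma dense_quotient_sequence:
  fixes G :: "('n::finite, 'f) affine_group" and k :: nat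
  assumes G: "group_scheme G" and H: "H \<lhd> rational_points G"
    and dense: "power_dense (quotient_topology (rational_topology v G) (\<lambda>x. H #>\<^bsub>rational_points G\<^esub> x))
            (rational_points G Mod H) k"
    and g: "g \<in> carrier (rational_points G)"
  shows "\<exists>Z W. (\<forall>n. Z n \<in> carrier (rational_points G) \<and> W n \<in> H) \<and>
    (\<forall>i. null_diff (\<lambda>n. (Z n [^]\<^bsub>rational_points G\<^esub> k \<otimes>\<^bsub>rational_points G\<^esub> W n) i) (g i))"
proof -
  let ?\<Gamma> = "rational_points G" and ?T = "rational_topology v G"
  let ?q = "\<lambda>x. H #>\<^bsub>?\<Gamma>\<^esub> x"
  let ?Q = "quotient_topology ?T ?q"
  interpret \<Gamma>: group ?\<Gamma> by (rule group_rational_points[OF G])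
  interpret H: normal H ?\<Gamma> by fact
  have q: "quotient_map ?T ?Q ?q" by (rule quotient_map_quotient_topology)
  have topQ: "topspace ?Q = ?q ` carrier ?\<Gamma>"
    using q by (simp add: quotient_map_def topspace_rational_topology)
  have mult_lim: "null_diff (\<lambda>n. (h \<otimes>\<^bsub>?\<Gamma>\<^esub> Z n) i) ((h \<otimes>\<^bsub>?\<Gamma>\<^esub> z) i)"
    if "\<And>i. null_diff (\<lambda>n. Z n i) (z i)" for h Z z i
    using that by (simp add: rational_points_simps null_diff_mult_pt null_diff_const)
  have "\<exists>s\<in>carrier ?\<Gamma> \<times> H. \<forall>i. v ((fst s [^]\<^bsub>?\<Gamma>\<^esub> k \<otimes>\<^bsub>?\<Gamma>\<^esub> snd s) i - g i) < e" if e: "0 < e" for e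
  proof -
    let ?U = "{y \<in> carrier ?\<Gamma>. \<forall>i. v (y i - g i) < e}"
    have gU: "g \<in> ?U" using g e by simp
    have openU: "openin ?T ?U" by (rule openin_rational_ball)
    have pre: "{x \<in> carrier ?\<Gamma>. ?q x \<in> ?q ` ?U} = {x \<in> carrier ?\<Gamma>. \<exists>h\<in>H. h \<otimes>\<^bsub>?\<Gamma>\<^esub> x \<in> ?U}"
    proof (intro Collect_cong conj_cong refl iffI)
      fix x assume x: "x \<in> carrier ?\<Gamma>" and "?q x \<in> ?q ` ?U"
      then obtain y where y: "y \<in> ?U" "?q x = ?q y" by blast
      then have "y \<in> ?q x" using \<Gamma>.rcos_self[OF _ H.is_subgroup, of y] by auto
      then show "\<exists>h\<in>H. h \<otimes>\<^bsub>?\<Gamma>\<^esub> x \<in> ?U" using y(1) unfolding r_coset_def by blast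
    next
      fix x assume x: "x \<in> carrier ?\<Gamma>" and "\<exists>h\<in>H. h \<otimes>\<^bsub>?\<Gamma>\<^esub> x \<in> ?U"
      then obtain h where h: "h \<in> H" "h \<otimes>\<^bsub>?\<Gamma>\<^esub> x \<in> ?U" by blast
      then have "h \<otimes>\<^bsub>?\<Gamma>\<^esub> x \<in> ?q x" unfolding r_coset_def by blast
      then have "?q x = ?q (h \<otimes>\<^bsub>?\<Gamma>\<^esub> x)" by (rule \<Gamma>.repr_independence[OF _ x H.is_subgroup])
      then show "?q x \<in> ?q ` ?U" using h(2) by blast
    qed
    have "openin ?T {x \<in> carrier ?\<Gamma>. \<exists>h\<in>H. h \<otimes>\<^bsub>?\<Gamma>\<^esub> x \<in> ?U}"
    proof (rule openin_rational_topologyI)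
      fix z Z
      assume z: "z \<in> {x \<in> carrier ?\<Gamma>. \<exists>h\<in>H. h \<otimes>\<^bsub>?\<Gamma>\<^esub> x \<in> ?U}"
        and Z: "\<And>n. Z n \<in> carrier ?\<Gamma>" "\<And>i. null_diff (\<lambda>n. Z n i) (z i)"
      obtain h where h: "h \<in> H" "h \<otimes>\<^bsub>?\<Gamma>\<^esub> z \<in> ?U" using z by blast
      have hX: "h \<in> carrier ?\<Gamma>" using h(1) H.subset by blast
      have "limitin ?T (\<lambda>n. h \<otimes>\<^bsub>?\<Gamma>\<^esub> Z n) (h \<otimes>\<^bsub>?\<Gamma>\<^esub> z) sequentially"
        using Z z hX by (intro limitin_rational_topology mult_lim) auto
      then have "eventually (\<lambda>n. h \<otimes>\<^bsub>?\<Gamma>\<^esub> Z n \<in> ?U) sequentially"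
        using openU h(2) unfolding limitin_def by blast
      then obtain n where "h \<otimes>\<^bsub>?\<Gamma>\<^esub> Z n \<in> ?U" by (auto simp: eventually_sequentially)
      then show "\<exists>n. Z n \<in> {x \<in> carrier ?\<Gamma>. \<exists>h\<in>H. h \<otimes>\<^bsub>?\<Gamma>\<^esub> x \<in> ?U}"
        using Z(1) h(1) by blast
    qed auto
    then have "openin ?T {x \<in> topspace ?T. ?q x \<in> ?q ` ?U}"
      by (simp only: pre topspace_rational_topology)
    moreover have "?q ` ?U \<subseteq> topspace ?Q" unfolding topQ by blast
    ultimately have openQ: "openin ?Q (?q ` ?U)" using q unfolding quotient_map_def by blast
    have "?q g \<in> ?Q closure_of power_image (?\<Gamma> Mod H) k"
      using dense g unfolding power_dense_def topQ by blast
    then have "\<And>V. ?q g \<in> V \<Longrightarrow> openin ?Q V \<Longrightarrow> \<exists>C. C \<in> power_image (?\<Gamma> Mod H) k \<and> C \<in> V"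
      by (auto simp: in_closure_of)
    from this[OF imageI[OF gU] openQ]
    obtain C where C: "C \<in> power_image (?\<Gamma> Mod H) k" "C \<in> ?q ` ?U" by (elim exE conjE)
    obtain y where y: "y \<in> ?U" "C = ?q y" using C(2) by blast
    obtain D where D: "D \<in> carrier (?\<Gamma> Mod H)" "C = D [^]\<^bsub>?\<Gamma> Mod H\<^esub> k" using C(1) by (auto simp: power_image_def)
    obtain x where x: "x \<in> carrier ?\<Gamma>" "D = ?q x" using D(1) by (auto simp: FactGroup_def RCOSETS_def)
    interpret q: group_hom ?\<Gamma> "?\<Gamma> Mod H" ?q
      by (intro group_hom.intro group_hom_axioms.intro \<Gamma>.is_group H.factorgroup_is_group H.r_coset_hom_Mod)
    have "?q y = ?q (x [^]\<^bsub>?\<Gamma>\<^esub> k)" using y(2) D(2) x q.hom_nat_pow by simp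
    then have "y \<in> ?q (x [^]\<^bsub>?\<Gamma>\<^esub> k)" using \<Gamma>.rcos_self[OF _ H.is_subgroup, of y] y(1) by auto
    then have "y \<in> x [^]\<^bsub>?\<Gamma>\<^esub> k <#\<^bsub>?\<Gamma>\<^esub> H" using H.coset_eq x(1) by auto
    then obtain h where "h \<in> H" "y = x [^]\<^bsub>?\<Gamma>\<^esub> k \<otimes>\<^bsub>?\<Gamma>\<^esub> h" unfolding l_coset_def by blast
    then show ?thesis using x(1) y(1) by (intro bexI[of _ "(x, h)"]) auto
  qed
  from ex_sequence_if_close[OF this] obtain Z where Z: "\<And>n. Z n \<in> carrier ?\<Gamma> \<times> H"
      "\<And>i. null_diff (\<lambda>n. (fst (Z n) [^]\<^bsub>?\<Gamma>\<^esub> k \<otimes>\<^bsub>?\<Gamma>\<^esub> snd (Z n)) i) (g i)" by blast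
  have "fst (Z n) \<in> carrier ?\<Gamma> \<and> snd (Z n) \<in> H" for n using Z(1)[of n] by (simp add: mem_Times_iff)
  then show ?thesis
    using Z(2) by (intro exI[of _ "\<lambda>n. fst (Z n)"] exI[of _ "\<lambda>n. snd (Z n)"]) blast
qed

lemma power_subset_group: "x [^]\<^bsub>A\<lparr>carrier := S\<rparr>\<^esub> (n::nat) = x [^]\<^bsub>A\<^esub> n"
  by (simp add: nat_pow_def)

lemma dense_subgroup_sequence:
  fixes G :: "('n::finite, 'f) affine_group" and k :: nat
  assumes H: "H \<subseteq> carrier (rational_points G)"
    and dense: "power_dense (subtopology (rational_topology v G) H) ((rational_points G)\<lparr>carrier := H\<rparr>) k"
    and h: "h \<in> H"
  shows "\<exists>Z. (\<forall>n. Z n \<in> H) \<and> (\<forall>i. null_diff (\<lambda>n. (Z n [^]\<^bsub>rational_points G\<^esub> k) i) (h i))"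
proof -
  let ?P = "power_image ((rational_points G)\<lparr>carrier := H\<rparr>) k"
  have P: "?P = (\<lambda>x. x [^]\<^bsub>rational_points G\<^esub> k) ` H"
    by (simp add: power_image_def power_subset_group)
  have "h \<in> subtopology (rational_topology v G) H closure_of ?P"
    using dense h H unfolding power_dense_def by (simp add: topspace_rational_topology) blast
  then have "h \<in> rational_topology v G closure_of (H \<inter> ?P)"
    unfolding closure_of_subtopology by blast
  then obtain Z where Z: "\<And>n. Z n \<in> H \<inter> ?P" "\<And>i. null_diff (\<lambda>n. Z n i) (h i)"
    using ex_sequence_in_closure by blast
  have "\<exists>x. x \<in> H \<and> Z n = x [^]\<^bsub>rational_points G\<^esub> k" for n using Z(1)[of n] unfolding P by blast
  then obtain x where x: "\<And>n. x n \<in> H" "\<And>n. Z n = x n [^]\<^bsub>rational_points G\<^esub> k" by metis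
  have "Z = (\<lambda>n. x n [^]\<^bsub>rational_points G\<^esub> k)" using x(2) by blast
  then show ?thesis using Z(2) x(1) by auto
qed

lemma ex_embedded_group:
  fixes G :: "('n::finite, 'f) affine_group"
  assumes "group_scheme G"
  shows "\<exists>N T w. embedded_group v N G T w"
proof -
  obtain N T w where *: "0 < N" "\<forall>g\<in>carrier (rational_points G). T g \<in> matrix_size.mats N" "T (unit_pt G id) = 1"
    "\<forall>g\<in>carrier (rational_points G). \<forall>h\<in>carrier (rational_points G). T (mult_pt G id g h) = T g * T h"
    "\<forall>g\<in>carrier (rational_points G). \<forall>i. g i = (\<Sum>a<N. \<Sum>b<N. w i a b * unblock N (T g) $$ (a, b))"
    "\<forall>Y g. (\<forall>n. Y n \<in> carrier (rational_points G)) \<longrightarrow> g \<in> carrier (rational_points G) \<longrightarrow>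
       (\<forall>i. null_diff (\<lambda>n. Y n i) (g i)) \<longrightarrow>
       (\<forall>a<N. \<forall>b<N. null_diff (\<lambda>n. unblock N (T (Y n)) $$ (a, b)) (unblock N (T g) $$ (a, b)))"
    using ex_matrix_embedding[OF assms] by (elim exE conjE) (rule that)
  interpret matrix_size N by unfold_locales (rule *(1))
  have "embedded_group v N G T w"
    by unfold_locales (use assms * in blast)+
  then show ?thesis by blast
qed

text \<open>For \<open>Y\<close> the whole group this is the second assertion. The case \<open>k = 1\<close> is separate because the
  exponents \<open>k ^ m\<close> then do not grow.\<close>

lemma roots_in_subgroup:
  fixes G :: "('n::finite, 'f) affine_group" and k :: nat
  assumes G: "group_scheme G" and k: "1 \<le> k"
    and H: "H \<lhd> rational_points G" "closedin (rational_topology v G) H"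
      "power_dense (subtopology (rational_topology v G) H) ((rational_points G)\<lparr>carrier := H\<rparr>) k"
      "power_dense (quotient_topology (rational_topology v G) (\<lambda>x. H #>\<^bsub>rational_points G\<^esub> x))
            (rational_points G Mod H) k"
    and Y: "subgroup Y (rational_points G)" "Y = points id {0} E"
  shows "power_surjective ((rational_points G)\<lparr>carrier := Y\<rparr>) k"
proof -
  obtain N T w where "embedded_group v N G T w" using ex_embedded_group[OF G] by blast
  then interpret embedded_group v N G T w .
  interpret H: normal H \<Gamma> by fact
  have YX: "Y \<subseteq> X" using Y(1) subgroup.subset by blast
  have "\<exists>y\<in>Y. y [^]\<^bsub>\<Gamma>\<^esub> k = g" if g: "g \<in> Y" for g
  proof (cases "k = 1")
    case True
    then show ?thesis using g YX by (intro bexI[of _ g]) auto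
  next
    case False
    then have "2 \<le> k" using k by simp
    show ?thesis
    proof (rule roots_if_dense[OF H(1) _ _ _ \<open>2 \<le> k\<close> Y g])
      show "z \<in> H" if Z: "\<And>n. Z n \<in> H" "z \<in> X" "\<And>i. null_diff (\<lambda>n. Z n i) (z i)" for Z z
      proof (rule limitin_closedin[OF _ H(2)])
        show "limitin (rational_topology v G) Z z sequentially"
          using Z H.subset by (intro limitin_rational_topology) auto
      qed (use Z in auto)
      show "\<exists>Z. (\<forall>n. Z n \<in> H) \<and> (\<forall>i. null_diff (\<lambda>n. (Z n [^]\<^bsub>\<Gamma>\<^esub> k) i) (h i))" if "h \<in> H" for h
        by (rule dense_subgroup_sequence[OF H.subset H(3) that])
      show "\<exists>Z W. (\<forall>n. Z n \<in> X \<and> W n \<in> H) \<and>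
          (\<forall>i. null_diff (\<lambda>n. (Z n [^]\<^bsub>\<Gamma>\<^esub> k \<otimes>\<^bsub>\<Gamma>\<^esub> W n) i) (g i))" if "g \<in> X" for g
        by (rule dense_quotient_sequence[OF G H(1,4) that])
    qed
  qed
  then have "Y \<subseteq> (\<lambda>y. y [^]\<^bsub>\<Gamma>\<^esub> k) ` Y" by (metis imageI subsetI)
  moreover have "(\<lambda>y. y [^]\<^bsub>\<Gamma>\<^esub> k) ` Y \<subseteq> Y" using subgroup_power[OF Y(1)] by (rule image_subsetI)
  ultimately show ?thesis
    by (simp add: power_surjective_def power_image_def power_subset_group subset_antisym)
qed

lemma power_dense_if_surjective:
  "topspace T = carrier A \<Longrightarrow> power_surjective A k \<Longrightarrow> power_dense T A k"
  unfolding power_dense_def power_surjective_def by (metis closure_of_topspace)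

lemma power_surjective_Mod:
  assumes "group A" "H \<lhd> A" "power_surjective A k"
  shows "power_surjective (A Mod H) k"
proof -
  interpret H: normal H A by fact
  interpret q: group_hom A "A Mod H" "\<lambda>x. H #>\<^bsub>A\<^esub> x"
    by (intro group_hom.intro group_hom_axioms.intro assms(1) H.factorgroup_is_group H.r_coset_hom_Mod)
  have carrier: "carrier (A Mod H) = (\<lambda>x. H #>\<^bsub>A\<^esub> x) ` carrier A"
    by (auto simp: FactGroup_def RCOSETS_def)
  have "power_image (A Mod H) k = (\<lambda>x. H #>\<^bsub>A\<^esub> x) ` power_image A k"
    unfolding power_image_def carrier image_image by (intro image_cong refl) (simp add: q.hom_nat_pow)
  then show ?thesis using assms(3) by (simp add: power_surjective_def carrier)
qed

lemma dense_if_surjective: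
  fixes G :: "('n::finite, 'f) affine_group"
  assumes G: "group_scheme G" and H: "H \<lhd> rational_points G"
    and surj: "power_surjective ((rational_points G)\<lparr>carrier := H\<rparr>) k" "power_surjective (rational_points G Mod H) k"
  shows "power_dense (subtopology (rational_topology v G) H) ((rational_points G)\<lparr>carrier := H\<rparr>) k"
    and "power_dense (quotient_topology (rational_topology v G) (\<lambda>x. H #>\<^bsub>rational_points G\<^esub> x))
            (rational_points G Mod H) k"
proof -
  interpret H: normal H "rational_points G" by fact
  have "topspace (subtopology (rational_topology v G) H) = H"
    using H.subset by (auto simp: topspace_rational_topology)
  then show "power_dense (subtopology (rational_topology v G) H) ((rational_points G)\<lparr>carrier := H\<rparr>) k"
    using surj(1) by (intro power_dense_if_surjective) auto
  have "topspace (quotient_topology (rational_topology v G) (\<lambda>x. H #>\<^bsub>rational_points G\<^esub> x))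
      = (\<lambda>x. H #>\<^bsub>rational_points G\<^esub> x) ` carrier (rational_points G)"
    using quotient_map_quotient_topology[of "rational_topology v G" "\<lambda>x. H #>\<^bsub>rational_points G\<^esub> x"]
    by (simp add: quotient_map_def topspace_rational_topology)
  also have "\<dots> = carrier (rational_points G Mod H)"
    by (auto simp: FactGroup_def RCOSETS_def)
  finally show "power_dense (quotient_topology (rational_topology v G) (\<lambda>x. H #>\<^bsub>rational_points G\<^esub> x))
            (rational_points G Mod H) k"
    using surj(2) by (intro power_dense_if_surjective)
qed

end

section \<open>Algebraic subgroups\<close>

text \<open>Since the equations of \<open>G\<close> lie in the ideal of \<open>H\<close>, they vanish at the points of \<open>H\<close>.\<close>

lemma algebraic_subgroup_points:
  fixes G H :: "('n::finite, 'f::field) affine_group"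
  assumes G: "algebraic_group G" and H: "algebraic_subgroup H G"
  shows "rational_points H = (rational_points G)\<lparr>carrier := carrier (rational_points H)\<rparr>"
    and "subgroup (carrier (rational_points H)) (rational_points G)"
proof -
  have eq: "H = G\<lparr>gp_eqs := gp_eqs H\<rparr>" and sub: "gp_eqs G \<subseteq> ideal_gen (gp_eqs H)" and gH: "group_scheme H"
    using H by (auto simp: algebraic_subgroup_def algebraic_group_def)
  interpret \<Gamma>: group "rational_points G"
    using G by (intro group_rational_points) (simp add: algebraic_group_def)
  have ops: "gp_mult H = gp_mult G" "gp_unit H = gp_unit G" by (subst eq, simp)+
  show *: "rational_points H = (rational_points G)\<lparr>carrier := carrier (rational_points H)\<rparr>"
    by (simp add: rational_points_def mult_pt_def[abs_def] unit_pt_def ops)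
  have "carrier (rational_points H) \<subseteq> carrier (rational_points G)"
  proof
    fix x assume "x \<in> carrier (rational_points H)"
    then have x: "x \<in> points id {0} (gp_eqs H)" by (simp add: rational_points_simps)
    have "eval_poly id x p = 0" if "p \<in> gp_eqs G" for p using points_ideal_gen[OF x] sub that by blast
    then show "x \<in> carrier (rational_points G)" by (simp add: rational_points_simps points_def)
  qed
  moreover have "group ((rational_points G)\<lparr>carrier := carrier (rational_points H)\<rparr>)"
    using group_rational_points[OF gH] by (subst (asm) *)
  ultimately show "subgroup (carrier (rational_points H)) (rational_points G)"
    by (rule \<Gamma>.group_incl_imp_subgroup)
qed

text \<open>Normality of group schemes is applied to points with constant coordinates, that is, in the test ring modulo \<open>0\<close>.\<close>

lemma algebraic_normal_subgroup_points:
  fixes G H :: "('n::finite, 'f::field) affine_group"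
  assumes G: "algebraic_group G" and H: "algebraic_normal_subgroup H G"
  shows "carrier (rational_points H) \<lhd> rational_points G"
proof -
  let ?c = "\<lambda>x i. Const (x i) :: 'f test_ring"
  have gG: "group_scheme G" using G by (simp add: algebraic_group_def)
  interpret \<Gamma>: group "rational_points G" by (rule group_rational_points[OF gG])
  have sub: "subgroup (carrier (rational_points H)) (rational_points G)"
    using algebraic_subgroup_points(2)[OF G] H by (simp add: algebraic_normal_subgroup_def)
  have ideal: "is_ideal ({0} :: 'f test_ring set)"
    by (rule module.subspace_single_0[OF module_mult])
  have pts: "?c x \<in> test_points {0} E \<longleftrightarrow> x \<in> points id {0} E" for x and E :: "('n, 'f) mpoly set"
    by (auto simp: points_def eval_poly_Const Const_eq_iff simp flip: Const_0)
  have m: "mult_pt G Const (?c x) (?c y) = ?c (mult_pt G id x y)" for x y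
  proof -
    have "case_sum (?c x) (?c y) = ?c (case_sum x y)"
      by (auto simp: fun_eq_iff split: sum.split)
    then show ?thesis by (simp add: mult_pt_def eval_poly_Const)
  qed
  have e: "unit_pt G Const = ?c (unit_pt G id)" by (simp add: unit_pt_def id_apply)
  have i: "inv_pt G Const (?c x) = ?c (inv_pt G id x)" for x by (simp add: inv_pt_def eval_poly_Const)
  have c: "cong_mod {0} (?c x) (?c y) \<longleftrightarrow> x = y" for x y :: "'n \<Rightarrow> 'f"
    by (simp add: cong_mod_def Const_eq_iff fun_eq_iff)
  have inv: "inv\<^bsub>rational_points G\<^esub> x = inv_pt G id x" if x: "x \<in> carrier (rational_points G)" for x
  proof -
    have x': "?c x \<in> test_points {0} (gp_eqs G)" using x by (simp add: pts rational_points_simps)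
    note g = gG[unfolded group_scheme_def Let_def, rule_format, OF ideal]
    have "inv_pt G Const (?c x) \<in> test_points {0} (gp_eqs G)" using g x' by blast
    then have in': "inv_pt G id x \<in> carrier (rational_points G)" by (simp add: i pts rational_points_simps)
    have "cong_mod {0} (mult_pt G Const (inv_pt G Const (?c x)) (?c x)) (unit_pt G Const)" using g x' by blast
    then have "mult_pt G id (inv_pt G id x) x = unit_pt G id" by (simp only: i m e c)
    then show ?thesis using x in' by (intro \<Gamma>.inv_equality) (simp_all add: rational_points_simps)
  qed
  show ?thesis
  proof (rule \<Gamma>.normal_invI[OF sub])
    fix x h assume x: "x \<in> carrier (rational_points G)" and h: "h \<in> carrier (rational_points H)"
    have "mult_pt G Const (mult_pt G Const (?c x) (?c h)) (inv_pt G Const (?c x)) \<in> test_points {0} (gp_eqs H)"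
      using H x h ideal by (auto simp: algebraic_normal_subgroup_def pts rational_points_simps)
    then have "mult_pt G id (mult_pt G id x h) (inv_pt G id x) \<in> points id {0} (gp_eqs H)"
      by (simp only: i m pts)
    then show "x \<otimes>\<^bsub>rational_points G\<^esub> h \<otimes>\<^bsub>rational_points G\<^esub> inv\<^bsub>rational_points G\<^esub> x \<in> carrier (rational_points H)"
      using x by (simp add: inv) (simp add: rational_points_simps)
  qed
qed

theorem theorem1p3:
  fixes v :: "'f::field \<Rightarrow> real"
    and G :: "('n::finite, 'f) affine_group"
    and k :: nat
  assumes "nonarch_local_field v"
    and "algebraic_group G"
    and "k \<ge> 1"
  shows
    "(\<forall>H. power_surjective (rational_points G) k \<and> algebraic_subgroup H G
          \<longrightarrow> power_surjective (rational_points H) k) \<and>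
     (\<forall>H. H \<lhd> rational_points G \<and> closedin (rational_topology v G) H \<and>
          power_dense (subtopology (rational_topology v G) H)
            ((rational_points G)\<lparr>carrier := H\<rparr>) k \<and>
          power_dense (quotient_topology (rational_topology v G) (\<lambda>x. H #>\<^bsub>rational_points G\<^esub> x))
            (rational_points G Mod H) k
          \<longrightarrow> power_surjective (rational_points G) k) \<and>
     (\<forall>H. algebraic_normal_subgroup H G \<longrightarrow>
          (power_surjective (rational_points G) k \<longleftrightarrow>
             power_surjective (rational_points H) k \<and>
             power_surjective (rational_points G Mod carrier (rational_points H)) k))"
proof -
  interpret nonarch_local_field v by fact
  have G: "group_scheme G" using assms(2) by (simp add: algebraic_group_def)
  interpret \<Gamma>: group "rational_points G" by (rule group_rational_points[OF G])
  let ?X = "carrier (rational_points G)"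
  have X: "?X = points id {0} (gp_eqs G)" "(rational_points G)\<lparr>carrier := ?X\<rparr> = rational_points G"
    by (simp_all add: rational_points_simps)
  have 1: "power_surjective (rational_points H) k"
    if surj: "power_surjective (rational_points G) k" and H: "algebraic_subgroup H G" for H
  proof -
    \<comment> \<open>Density of the powers in the whole group is the case of the normal subgroup \<open>?X\<close>.\<close>
    have normal: "?X \<lhd> rational_points G" by (intro \<Gamma>.normal_invI \<Gamma>.subgroup_self) simp
    note dense = dense_if_surjective[OF G normal, unfolded X(2), OF surj power_surjective_Mod[OF \<Gamma>.is_group normal surj]]
    have "closedin (rational_topology v G) ?X"
      using closedin_topspace[of "rational_topology v G"] by (simp add: topspace_rational_topology)
    then have "power_surjective ((rational_points G)\<lparr>carrier := carrier (rational_points H)\<rparr>) k"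
      using dense algebraic_subgroup_points(2)[OF assms(2) H] rational_points_simps(1)
      by (rule roots_in_subgroup[OF G assms(3) normal, unfolded X(2)])
    then show ?thesis using algebraic_subgroup_points(1)[OF assms(2) H] by simp
  qed
  have 2: "power_surjective (rational_points G) k"
    if "H \<lhd> rational_points G" "closedin (rational_topology v G) H"
      "power_dense (subtopology (rational_topology v G) H) ((rational_points G)\<lparr>carrier := H\<rparr>) k"
      "power_dense (quotient_topology (rational_topology v G) (\<lambda>x. H #>\<^bsub>rational_points G\<^esub> x))
            (rational_points G Mod H) k" for H
    using roots_in_subgroup[OF G assms(3) that \<Gamma>.subgroup_self X(1)] by (simp only: X(2))
  have 3: "power_surjective (rational_points G) k \<longleftrightarrow>
             power_surjective (rational_points H) k \<and>
             power_surjective (rational_points G Mod carrier (rational_points H)) k"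
    if H: "algebraic_normal_subgroup H G" for H
  proof
    have sub: "algebraic_subgroup H G" using H by (simp add: algebraic_normal_subgroup_def)
    have normal: "carrier (rational_points H) \<lhd> rational_points G"
      by (rule algebraic_normal_subgroup_points[OF assms(2) H])
    show "power_surjective (rational_points H) k \<and>
        power_surjective (rational_points G Mod carrier (rational_points H)) k"
      if "power_surjective (rational_points G) k"
      using 1[OF that sub] power_surjective_Mod[OF \<Gamma>.is_group normal that] by blast
    assume "power_surjective (rational_points H) k \<and>
        power_surjective (rational_points G Mod carrier (rational_points H)) k"
    then have "power_surjective ((rational_points G)\<lparr>carrier := carrier (rational_points H)\<rparr>) k"
      "power_surjective (rational_points G Mod carrier (rational_points H)) k"
      using algebraic_subgroup_points(1)[OF assms(2) sub] by simp_all
    note dense = dense_if_surjective[OF G normal this]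
    have "closedin (rational_topology v G) (carrier (rational_points H))"
      using normal_imp_subgroup[OF normal] subgroup.subset unfolding rational_points_simps(1)[of H]
      by (intro closedin_points) blast
    then show "power_surjective (rational_points G) k" using dense by (rule 2[OF normal])
  qed
  show ?thesis using 1 2 3 by blast
qed

end
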